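(* Any AF-algebra associated with a sequence of simplicial groups $(\mathbb{Z}^{m_1},u_1)\xrightarrow{A_1}(\mathbb{Z}^{m_2},u_2)\xrightarrow{A_2}(\mathbb{Z}^{m_3},u_3)\xrightarrow{A_3}\cdots$ with property (RFD) is itself residually finite dimensional. Conversely, any residually finite dimensional, infinite dimensional, separable AF-algebra is realized by (i.e., is the AF-algebra associated with) a sequence of simplicial groups with property (RFD).
   Context: A $C^*$-algebra is residually finite dimensional (RFD) if it has a separating family of finite dimensional representations. Sequence of simplicial groups: $(\mathbb{Z}^{m_1},u_1)\xrightarrow{A_1}(\mathbb{Z}^{m_2},u_2)\xrightarrow{A_2}\cdots$, where $m_n\ge 1$ are integers, each $A_n$ is an $m_{n+1}\times m_n$ matrix with non-negative integer entries which is non-degenerate in the sense that all its rows and columns are non-zero, and $u_n\in\mathbb{Z}^{m_n}$ is an order unit (all entries are strictly positive) with $A_nu_n\le u_{n+1}$ entrywise. The associated AF-algebra is the inductive limit $\mathcal{A}=\varinjlim(\mathcal{A}_n,\varphi_n)$, where $\mathcal{A}_n=\bigoplus_{i=1}^{m_n}\mathcal{A}_{n,i}$ with each $\mathcal{A}_{n,i}$ (isomorphic to) the full matrix algebra $M_{u_n(i)}$, and $\varphi_n\colon\mathcal{A}_n\to\mathcal{A}_{n+1}$ is the $^*$-homomorphism, determined up to unitary equivalence, whose partial map $\mathcal{A}_{n,k}\to\mathcal{A}_{n+1,\ell}$ has multiplicity $A_n(\ell,k)$. Property (RFD): there is a strictly increasing sequence $\{r_n\}_{n=1}^\infty$ of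 integers with $1\le r_n\le m_n$ such that, for every $n\ge1$, $$A_n=\begin{pmatrix} I_{r_n} & 0\\ A_n^{(2,1)} & A_n^{(2,2)}\\ A_n^{(3,1)} & A_n^{(3,2)}\end{pmatrix}$$ with respect to the block decompositions $m_{n+1}=r_n+(r_{n+1}-r_n)+(m_{n+1}-r_{n+1})$ of the rows and $m_n=r_n+(m_n-r_n)$ of the columns; each column of the $(r_{n+1}-r_n)\times(m_n-r_n)$ matrix $A_n^{(2,2)}$ is non-zero; and $u_{n+1}(j)=u_n(j)$ for $1\le j\le r_n$. (If $r_n=m_n$ the second block column, and the condition on $A_n^{(2,2)}$, are absent; if $r_{n+1}=m_{n+1}$ the third block row is absent.)
   Formalization: In the converse, non-zero rows of the matrices A_n are claimed only if the algebra has a full projection (e.g. is unital); otherwise only non-zero columns. As stated it fails for c_0, which has no full projection. The first half is proved without assuming non-zero rows. *)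

theory Defs
  imports
    "HOL-Analysis.Abstract_Topological_Spaces"
    "Jordan_Normal_Form.Schur_Decomposition"
begin

section \<open>C*-algebras\<close>

text \<open>Complex C*-algebras, not necessarily unital.  The real scalar multiplication of the
  underlying Banach space is the restriction of the complex one.\<close>

class cstar_algebra = real_normed_algebra + banach +
  fixes scaleC :: "complex \<Rightarrow> 'a \<Rightarrow> 'a" (infixr \<open>*\<^sub>C\<close> 75)
    and star :: "'a \<Rightarrow> 'a"
  assumes scaleC_add_right: "c *\<^sub>C (x + y) = c *\<^sub>C x + c *\<^sub>C y"
    and scaleC_add_left: "(c + d) *\<^sub>C x = c *\<^sub>C x + d *\<^sub>C x"
    and scaleC_scaleC: "c *\<^sub>C d *\<^sub>C x = (c * d) *\<^sub>C x"
    and scaleR_scaleC: "scaleR r x = complex_of_real r *\<^sub>C x"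
    and norm_scaleC: "norm (c *\<^sub>C x) = cmod c * norm x"
    and mult_scaleC_left: "(c *\<^sub>C x) * y = c *\<^sub>C (x * y)"
    and mult_scaleC_right: "x * (c *\<^sub>C y) = c *\<^sub>C (x * y)"
    and star_star: "star (star x) = x"
    and star_add: "star (x + y) = star x + star y"
    and star_scaleC: "star (c *\<^sub>C x) = cnj c *\<^sub>C star x"
    and star_mult: "star (x * y) = star y * star x"
    and cstar_identity: "norm (star x * x) = (norm x)\<^sup>2"

interpretation complex_vector: vector_space "scaleC :: complex \<Rightarrow> 'a \<Rightarrow> 'a::cstar_algebra"
proof
  fix x :: 'a
  have "scaleC 1 x = scaleR 1 x"
    using scaleR_scaleC[of 1 x] by simp
  then show "scaleC 1 x = x" by simp
qed (simp_all add: scaleC_add_right scaleC_add_left scaleC_scaleC)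

definition finite_dim :: "'a::cstar_algebra set \<Rightarrow> bool" where
  "finite_dim V \<longleftrightarrow> (\<exists>F. finite F \<and> V = complex_vector.span F)"

definition cstar_subalgebra :: "'a::cstar_algebra set \<Rightarrow> bool" where
  "cstar_subalgebra B \<longleftrightarrow> complex_vector.subspace B \<and> closed B \<and>
     (\<forall>x\<in>B. \<forall>y\<in>B. x * y \<in> B) \<and> (\<forall>x\<in>B. star x \<in> B)"

text \<open>AF-algebras of arbitrary density character: an upward directed family of finite
  dimensional C*-subalgebras has dense union.  In the separable case the family can be
  taken to be an increasing sequence.\<close>

definition AF_algebra :: "'a::cstar_algebra itself \<Rightarrow> bool" where
  "AF_algebra _ \<longleftrightarrow> (\<exists>\<B> :: 'a set set.
     \<B> \<noteq> {} \<and> (\<forall>B\<in>\<B>. cstar_subalgebra B \<and> finite_dim B) \<and>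
     (\<forall>B\<in>\<B>. \<forall>C\<in>\<B>. \<exists>D\<in>\<B>. B \<union> C \<subseteq> D) \<and> closure (\<Union>\<B>) = UNIV)"

text \<open>A projection that generates the whole algebra as a closed two-sided ideal; the unit of
  a unital algebra is an example.\<close>

definition full_projection :: "'a::cstar_algebra \<Rightarrow> bool" where
  "full_projection p \<longleftrightarrow> p * p = p \<and> star p = p \<and>
     closure (complex_vector.span {a * p * b | a b. True}) = UNIV"


section \<open>Explicit *-algebras on carrier sets\<close>

record 'a star_algebra =
  elems :: "'a set"
  add_op :: "'a \<Rightarrow> 'a \<Rightarrow> 'a"
  mult_op :: "'a \<Rightarrow> 'a \<Rightarrow> 'a"
  scale_op :: "complex \<Rightarrow> 'a \<Rightarrow> 'a"
  star_op :: "'a \<Rightarrow> 'a"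
  norm_op :: "'a \<Rightarrow> real"

definition star_hom ::
  "('a, 'm) star_algebra_scheme \<Rightarrow> ('b, 'n) star_algebra_scheme \<Rightarrow> ('a \<Rightarrow> 'b) \<Rightarrow> bool" where
  "star_hom X Y f \<longleftrightarrow>
     (\<forall>x\<in>elems X. f x \<in> elems Y) \<and>
     (\<forall>x\<in>elems X. \<forall>y\<in>elems X. f (add_op X x y) = add_op Y (f x) (f y)) \<and>
     (\<forall>x\<in>elems X. \<forall>y\<in>elems X. f (mult_op X x y) = mult_op Y (f x) (f y)) \<and>
     (\<forall>c. \<forall>x\<in>elems X. f (scale_op X c x) = scale_op Y c (f x)) \<and>
     (\<forall>x\<in>elems X. f (star_op X x) = star_op Y (f x))"

definition whole_algebra :: "'a::cstar_algebra star_algebra" where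
  "whole_algebra = \<lparr>elems = UNIV, add_op = (+), mult_op = (*), scale_op = scaleC,
     star_op = star, norm_op = norm\<rparr>"

definition l2_norm_vec :: "complex vec \<Rightarrow> real" where
  "l2_norm_vec v = sqrt (\<Sum>i<dim_vec v. (cmod (v $ i))\<^sup>2)"

definition operator_norm :: "complex mat \<Rightarrow> real" where
  "operator_norm M =
     Sup {l2_norm_vec (M *\<^sub>v v) | v. v \<in> carrier_vec (dim_col M) \<and> l2_norm_vec v \<le> 1}"

definition matrix_algebra :: "nat \<Rightarrow> complex mat star_algebra" where
  "matrix_algebra k = \<lparr>elems = carrier_mat k k, add_op = (+), mult_op = (*),
     scale_op = (\<cdot>\<^sub>m), star_op = mat_adjoint, norm_op = operator_norm\<rparr>"

definition residually_finite_dimensional :: "'a::cstar_algebra itself \<Rightarrow> bool" where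
  "residually_finite_dimensional _ \<longleftrightarrow> (\<exists>\<R> :: (nat \<times> ('a \<Rightarrow> complex mat)) set.
     (\<forall>(k, \<pi>)\<in>\<R>. star_hom whole_algebra (matrix_algebra k) \<pi>) \<and>
     (\<forall>x y. x \<noteq> y \<longrightarrow> (\<exists>(k, \<pi>)\<in>\<R>. \<pi> x \<noteq> \<pi> y)))"

text \<open>The direct sum of the full matrix algebras of sizes \<open>u $ i\<close>, \<open>i < dim_vec u\<close>.  A summand
  index out of range carries the value \<open>undefined\<close>, so that equality of elements is
  componentwise.\<close>

definition block_size :: "int vec \<Rightarrow> nat \<Rightarrow> nat" where
  "block_size u i = nat (u $ i)"

definition direct_sum_algebra :: "int vec \<Rightarrow> (nat \<Rightarrow> complex mat) star_algebra" where
  "direct_sum_algebra u = \<lparr>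
     elems = (\<Pi>\<^sub>E i\<in>{..<dim_vec u}. carrier_mat (block_size u i) (block_size u i)),
     add_op = (\<lambda>x y. \<lambda>i\<in>{..<dim_vec u}. x i + y i),
     mult_op = (\<lambda>x y. \<lambda>i\<in>{..<dim_vec u}. x i * y i),
     scale_op = (\<lambda>c x. \<lambda>i\<in>{..<dim_vec u}. c \<cdot>\<^sub>m x i),
     star_op = (\<lambda>x. \<lambda>i\<in>{..<dim_vec u}. mat_adjoint (x i)),
     norm_op = (\<lambda>x. Max ((\<lambda>i. operator_norm (x i)) ` {..<dim_vec u}))\<rparr>"


section \<open>Partial maps and multiplicities\<close>

definition unitary_mat :: "nat \<Rightarrow> complex mat \<Rightarrow> bool" where
  "unitary_mat q U \<longleftrightarrow> U \<in> carrier_mat q q \<and>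
     mat_adjoint U * U = 1\<^sub>m q \<and> U * mat_adjoint U = 1\<^sub>m q"

text \<open>A map from \<open>p \<times> p\<close> to \<open>q \<times> q\<close> matrices has multiplicity \<open>c\<close> if it is unitarily equivalent
  to the map sending \<open>x\<close> to \<open>diag(x, \<dots>, x, 0)\<close> with \<open>c\<close> copies of \<open>x\<close>.\<close>

definition has_multiplicity :: "nat \<Rightarrow> nat \<Rightarrow> (complex mat \<Rightarrow> complex mat) \<Rightarrow> nat \<Rightarrow> bool" where
  "has_multiplicity p q f c \<longleftrightarrow> c * p \<le> q \<and> (\<exists>U. unitary_mat q U \<and>
     (\<forall>x\<in>carrier_mat p p.
        f x = U * diag_block_mat (replicate c x @ [0\<^sub>m (q - c * p) (q - c * p)]) * mat_adjoint U))"

definition summand_embedding :: "int vec \<Rightarrow> nat \<Rightarrow> complex mat \<Rightarrow> (nat \<Rightarrow> complex mat)" where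
  "summand_embedding u k x = (\<lambda>i\<in>{..<dim_vec u}.
     if i = k then x else 0\<^sub>m (block_size u i) (block_size u i))"

definition has_multiplicity_matrix ::
  "int vec \<Rightarrow> int vec \<Rightarrow> ((nat \<Rightarrow> complex mat) \<Rightarrow> (nat \<Rightarrow> complex mat)) \<Rightarrow> int mat \<Rightarrow> bool" where
  "has_multiplicity_matrix u v \<phi> A \<longleftrightarrow> (\<forall>k<dim_vec u. \<forall>l<dim_vec v.
     has_multiplicity (block_size u k) (block_size v l)
       (\<lambda>x. \<phi> (summand_embedding u k x) l) (nat (A $$ (l, k))))"


section \<open>Inductive limits\<close>

text \<open>\<open>connecting_map \<phi> n k\<close> is the composite \<open>\<phi> (n + k - 1) \<circ> \<dots> \<circ> \<phi> n\<close>.\<close>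

primrec connecting_map :: "(nat \<Rightarrow> 'b \<Rightarrow> 'b) \<Rightarrow> nat \<Rightarrow> nat \<Rightarrow> 'b \<Rightarrow> 'b" where
  "connecting_map \<phi> n 0 = id"
| "connecting_map \<phi> n (Suc k) = \<phi> (n + k) \<circ> connecting_map \<phi> n k"

text \<open>The C*-inductive limit is the completion of the algebraic direct limit with respect to
  the seminorm \<open>a \<mapsto> lim\<^sub>k \<parallel>\<phi>\<^bsub>n+k,n\<^esub> a\<parallel>\<close> (elements of seminorm zero being divided out).
  Accordingly, the (complete) algebra \<open>'a\<close> together with maps \<open>\<mu> n\<close> is such a limit if the \<open>\<mu> n\<close>
  form a compatible family of *-homomorphisms, are isometric for that seminorm, and have
  dense union of images.\<close>

definition inductive_limit ::
  "(nat \<Rightarrow> 'b star_algebra) \<Rightarrow> (nat \<Rightarrow> 'b \<Rightarrow> 'b) \<Rightarrow> (nat \<Rightarrow> 'b \<Rightarrow> 'a::cstar_algebra) \<Rightarrow> bool" where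
  "inductive_limit X \<phi> \<mu> \<longleftrightarrow>
     (\<forall>n. star_hom (X n) (X (Suc n)) (\<phi> n)) \<and>
     (\<forall>n. star_hom (X n) whole_algebra (\<mu> n)) \<and>
     (\<forall>n. \<forall>a\<in>elems (X n). \<mu> (Suc n) (\<phi> n a) = \<mu> n a) \<and>
     (\<forall>n. \<forall>a\<in>elems (X n).
        (\<lambda>k. norm_op (X (n + k)) (connecting_map \<phi> n k a)) \<longlonglongrightarrow> norm (\<mu> n a)) \<and>
     closure (\<Union>n. \<mu> n ` elems (X n)) = UNIV"


section \<open>Sequences of simplicial groups\<close>

text \<open>Sequences, vectors and matrices are indexed from zero.  The order \<open>\<le>\<close> on vectors is the
  entrywise one.  Nonzero rows are a separate condition: together with order units and
  nonzero columns, they force the limit to have a full projection (the image of the unit of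
  the first algebra), so an algebra without one, such as the algebra of null sequences, is
  not the limit of any sequence with nonzero rows.\<close>

definition simplicial_sequence ::
  "(nat \<Rightarrow> nat) \<Rightarrow> (nat \<Rightarrow> int vec) \<Rightarrow> (nat \<Rightarrow> int mat) \<Rightarrow> bool" where
  "simplicial_sequence m u A \<longleftrightarrow> (\<forall>n.
     1 \<le> m n \<and>
     u n \<in> carrier_vec (m n) \<and> (\<forall>i<m n. 0 < u n $ i) \<and>
     A n \<in> carrier_mat (m (Suc n)) (m n) \<and>
     (\<forall>i<m (Suc n). \<forall>j<m n. 0 \<le> A n $$ (i, j)) \<and>
     (\<forall>j<m n. col (A n) j \<noteq> 0\<^sub>v (m (Suc n))) \<and>
     A n *\<^sub>v u n \<le> u (Suc n))"

definition nonzero_rows :: "(nat \<Rightarrow> nat) \<Rightarrow> (nat \<Rightarrow> int mat) \<Rightarrow> bool" where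
  "nonzero_rows m A \<longleftrightarrow> (\<forall>n. \<forall>i<m (Suc n). row (A n) i \<noteq> 0\<^sub>v (m n))"

definition associated_AF_algebra ::
  "'a::cstar_algebra itself \<Rightarrow> (nat \<Rightarrow> int vec) \<Rightarrow> (nat \<Rightarrow> int mat) \<Rightarrow> bool" where
  "associated_AF_algebra _ u A \<longleftrightarrow>
     (\<exists>\<phi> (\<mu> :: nat \<Rightarrow> (nat \<Rightarrow> complex mat) \<Rightarrow> 'a).
        (\<forall>n. has_multiplicity_matrix (u n) (u (Suc n)) (\<phi> n) (A n)) \<and>
        inductive_limit (\<lambda>n. direct_sum_algebra (u n)) \<phi> \<mu>)"

text \<open>Blocks with zero rows or columns are matrices of dimension zero, so the degenerate cases
  \<open>r n = m n\<close> and \<open>r (Suc n) = m (Suc n)\<close> need no separate treatment.\<close>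

definition property_RFD ::
  "(nat \<Rightarrow> nat) \<Rightarrow> (nat \<Rightarrow> int vec) \<Rightarrow> (nat \<Rightarrow> int mat) \<Rightarrow> bool" where
  "property_RFD m u A \<longleftrightarrow> (\<exists>r :: nat \<Rightarrow> nat. strict_mono r \<and> (\<forall>n.
     1 \<le> r n \<and> r n \<le> m n \<and>
     (\<exists>A21 A22 A31 A32.
        A21 \<in> carrier_mat (r (Suc n) - r n) (r n) \<and>
        A22 \<in> carrier_mat (r (Suc n) - r n) (m n - r n) \<and>
        A31 \<in> carrier_mat (m (Suc n) - r (Suc n)) (r n) \<and>
        A32 \<in> carrier_mat (m (Suc n) - r (Suc n)) (m n - r n) \<and>
        A n = four_block_mat (1\<^sub>m (r n)) (0\<^sub>m (r n) (m n - r n))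
                (A21 @\<^sub>r A31) (A22 @\<^sub>r A32) \<and>
        (\<forall>j<m n - r n. col A22 j \<noteq> 0\<^sub>v (r (Suc n) - r n))) \<and>
     (\<forall>j<r n. u (Suc n) $ j = u n $ j)))"

end

theory Submission
  imports
    Defs
    "HOL-Analysis.L2_Norm"
    "Jordan_Normal_Form.Spectral_Radius"
begin

text \<open>For an algebra given by a sequence with property (RFD), each summand \<open>j < r n\<close> is carried
  unitarily onto the \<open>j\<close>-th summand of every later stage, so the coordinate maps, corrected by
  unitaries, are compatible and extend to contractive representations of the limit.  Every other
  summand of stage \<open>n\<close> maps injectively into some summand \<open>j < r (Suc n)\<close> of the next stage,
  whence these representations together compute the norm and are separating.

  For the converse, call a surjective representation onto a full matrix algebra irreducible.
  Irreducible representations with pairwise distinct kernels are jointly surjective, also on a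
  dense subalgebra; a complete list of them identifies a finite dimensional *-subalgebra with a
  direct sum of matrix algebras.  Along an exhausting sequence of finite dimensional subalgebras
  one chooses alternately finitely many irreducible representations of the whole algebra that
  detect all summands of the current stage, and a later stage on which they are still jointly
  surjective.  They are its first summands, and the connecting maps then have the required
  block form.  If there is a full projection, the stages are replaced by the ideals generated
  in them by the unit \<open>q\<close> of the first one, which makes every row nonzero.\<close>

text \<open>The obstacle in the converse is that a representation of a single stage need not extend
  to the limit. The shared summands must therefore be representations of the whole algebra, and such
  a representation is a summand of a stage only if it stays surjective there. Surjectivity on late
  stages is a density statement and needs continuity, which the notion of representation does not
  include; it is derived from quasi-inverses. Chosen representations are only ever appended at the
  end of a list, so equal positions carry literally the same representation at consecutive stages,
  and the identity and zero blocks are read off from traces. Infinite dimension makes the list grow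
  strictly, because no finite list is faithful. Separation of points by irreducible representations
  also replaces the structure theory of finite dimensional C*-algebras: units, summands and the
  uniqueness of the norm are all obtained from complete lists. In the forward direction,
  multiplicity one between summands of equal size leaves no room for a zero part, so the partial map
  is exactly conjugation by a unitary.\<close>

unbundle no vec_syntax

section \<open>Complex matrices, projections and isometries\<close>

lemma mat_assoc:
  "dim_col A = dim_row B \<Longrightarrow> dim_col B = dim_row C \<Longrightarrow>
    A * B * C = A * (B * (C :: 'a :: semiring_0 mat))"
  by (rule assoc_mult_mat[of _ "dim_row A" "dim_row B" _ "dim_row C" _ "dim_col C"]) auto

lemma mat_vec_assoc:
  "dim_col A = dim_row B \<Longrightarrow> dim_col B = dim_vec v \<Longrightarrow>
    A * B *\<^sub>v v = A *\<^sub>v (B *\<^sub>v (v :: 'a :: comm_semiring_0 vec))"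
  by (rule assoc_mult_mat_vec[of _ "dim_row A" "dim_row B" _ "dim_vec v"])
    auto

lemma zero_mat_mult_vec: "dim_vec v = m \<Longrightarrow> 0\<^sub>m n m *\<^sub>v v = (0\<^sub>v n :: 'a :: semiring_0 vec)"
  by (intro eq_vecI) (auto simp: scalar_prod_def)

lemma mat_mult_zero_vec: "dim_col x = m \<Longrightarrow> x *\<^sub>v 0\<^sub>v m = (0\<^sub>v (dim_row x) :: 'a :: semiring_0 vec)"
  by (intro eq_vecI) (auto simp: scalar_prod_def)

lemma smult_zero_mat [simp]: "c \<cdot>\<^sub>m 0\<^sub>m n m = (0\<^sub>m n m :: 'a :: mult_zero mat)"
  by (intro eq_matI) auto

lemma mult_mat_entry:
  assumes "A \<in> carrier_mat n m" "B \<in> carrier_mat m k" "i < n" "j < k"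
  shows "(A * B) $$ (i, j) = (\<Sum>l<m. A $$ (i, l) * B $$ (l, j))"
  using assms by (auto simp: scalar_prod_def lessThan_atLeast0 intro!: sum.cong)

lemma mult_mat_vec_entry:
  assumes "A \<in> carrier_mat n m" "v \<in> carrier_vec m" "i < n"
  shows "(A *\<^sub>v v) $ i = (\<Sum>l<m. A $$ (i, l) * v $ l)"
  using assms by (auto simp: scalar_prod_def lessThan_atLeast0 intro!: sum.cong)

lemma mat_adjoint_dim [simp]:
  "dim_row (mat_adjoint A) = dim_col A" "dim_col (mat_adjoint A) = dim_row A"
  by (simp_all add: mat_adjoint_def)

lemma mat_adjoint_carrier [simp, intro]:
  "A \<in> carrier_mat n m \<Longrightarrow> mat_adjoint A \<in> carrier_mat m n"
  by (rule carrier_matI) (simp_all add: carrier_matD)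

lemma mat_adjoint_entry [simp]:
  fixes A :: "complex mat"
  shows "i < dim_col A \<Longrightarrow> j < dim_row A \<Longrightarrow> mat_adjoint A $$ (i, j) = cnj (A $$ (j, i))"
  by (simp add: mat_adjoint_def mat_of_rows_def)

lemma mat_adjoint_adjoint [simp]: "mat_adjoint (mat_adjoint A) = (A :: complex mat)"
  by (rule eq_matI) auto

lemma mat_adjoint_minus:
  fixes A :: "complex mat"
  assumes "A \<in> carrier_mat n m" "B \<in> carrier_mat n m"
  shows "mat_adjoint (A - B) = mat_adjoint A - mat_adjoint B"
  by (rule eq_matI) (use assms in auto)

lemma mat_adjoint_one [simp]: "mat_adjoint (1\<^sub>m n :: complex mat) = 1\<^sub>m n"
  by (rule eq_matI) auto

lemma mat_adjoint_zero [simp]: "mat_adjoint (0\<^sub>m n m :: complex mat) = 0\<^sub>m m n"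
  by (rule eq_matI) auto

lemma mat_adjoint_mult:
  fixes A :: "complex mat"
  assumes A: "A \<in> carrier_mat n m" and B: "B \<in> carrier_mat m k"
  shows "mat_adjoint (A * B) = mat_adjoint B * mat_adjoint A"
proof (rule eq_matI)
  fix i j assume "i < dim_row (mat_adjoint B * mat_adjoint A)"
    "j < dim_col (mat_adjoint B * mat_adjoint A)"
  then have ij: "i < k" "j < n" using A B by auto
  have "mat_adjoint (A * B) $$ (i, j) = cnj ((A * B) $$ (j, i))"
    using ij A B by auto
  also have "\<dots> = (\<Sum>l<m. cnj (B $$ (l, i)) * cnj (A $$ (j, l)))"
    using mult_mat_entry[OF A B ij(2) ij(1)] by (simp add: mult.commute)
  also have "\<dots> = (\<Sum>l<m. mat_adjoint B $$ (i, l) * mat_adjoint A $$ (l, j))"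
    using ij A B by (intro sum.cong) auto
  also have "\<dots> = (mat_adjoint B * mat_adjoint A) $$ (i, j)"
    using mult_mat_entry[of "mat_adjoint B" k m "mat_adjoint A" n i j] ij A B by auto
  finally show "mat_adjoint (A * B) $$ (i, j) = (mat_adjoint B * mat_adjoint A) $$ (i, j)" .
qed (use A B in auto)

lemma mat_eq_by_vec:
  fixes A B :: "'a :: comm_ring_1 mat"
  assumes A: "A \<in> carrier_mat n m" and B: "B \<in> carrier_mat n m"
    and eq: "\<And>v. v \<in> carrier_vec m \<Longrightarrow> A *\<^sub>v v = B *\<^sub>v v"
  shows "A = B"
proof (rule eq_matI)
  fix i j assume "i < dim_row B" "j < dim_col B"
  then have ij: "i < n" "j < m" using B by auto
  have "A *\<^sub>v unit_vec m j = B *\<^sub>v unit_vec m j" by (rule eq) simp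
  then have "(A *\<^sub>v unit_vec m j) $ i = (B *\<^sub>v unit_vec m j) $ i" by simp
  then show "A $$ (i, j) = B $$ (i, j)"
    using ij A B by (auto simp: mult_mat_vec_def)
qed (use A B in auto)

section \<open>Trace and orthogonal projections\<close>

definition mat_tr :: "complex mat \<Rightarrow> complex" where
  "mat_tr A = (\<Sum>i<dim_row A. A $$ (i, i))"

lemma mat_tr_mult_commute:
  assumes "A \<in> carrier_mat n m" "B \<in> carrier_mat m n"
  shows "mat_tr (A * B) = mat_tr (B * A)"
proof -
  have "mat_tr (A * B) = (\<Sum>i<n. \<Sum>l<m. A $$ (i, l) * B $$ (l, i))"
    unfolding mat_tr_def using assms by (auto intro!: sum.cong simp: mult_mat_entry[OF assms] simp del: index_mult_mat(1))
  also have "\<dots> = (\<Sum>l<m. \<Sum>i<n. B $$ (l, i) * A $$ (i, l))"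
    by (subst sum.swap) (simp add: mult.commute)
  also have "\<dots> = mat_tr (B * A)"
    unfolding mat_tr_def using assms by (auto intro!: sum.cong simp: mult_mat_entry[OF assms(2,1)] simp del: index_mult_mat(1))
  finally show ?thesis .
qed

lemma mat_tr_one [simp]: "mat_tr (1\<^sub>m n) = of_nat n"
  by (simp add: mat_tr_def)

lemma mat_tr_minus:
  assumes "A \<in> carrier_mat n n" "B \<in> carrier_mat n n"
  shows "mat_tr (A - B) = mat_tr A - mat_tr B"
  using assms by (auto simp: mat_tr_def sum_subtractf)

definition projection_mat :: "nat \<Rightarrow> complex mat \<Rightarrow> bool" where
  "projection_mat n P \<longleftrightarrow> P \<in> carrier_mat n n \<and> P * P = P \<and> mat_adjoint P = P"

text \<open>From P = P P and self-adjointness, a diagonal entry is the squared length of its row.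
  Hence traces of projections are real and nonnegative.\<close>

lemma projection_mat_diag:
  assumes P: "projection_mat n P" and i: "i < n"
  shows "P $$ (i, i) = of_real (\<Sum>k<n. (cmod (P $$ (i, k)))\<^sup>2)"
proof -
  have Pc: "P \<in> carrier_mat n n" and PP: "P * P = P" and Pa: "mat_adjoint P = P"
    using P by (auto simp: projection_mat_def)
  have "P $$ (i, i) = (P * P) $$ (i, i)" by (simp add: PP)
  also have "\<dots> = (\<Sum>k<n. P $$ (i, k) * P $$ (k, i))" by (rule mult_mat_entry[OF Pc Pc i i])
  also have "\<dots> = (\<Sum>k<n. of_real ((cmod (P $$ (i, k)))\<^sup>2))"
  proof (rule sum.cong)
    fix k assume "k \<in> {..<n}"
    then have "P $$ (k, i) = cnj (P $$ (i, k))"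
      using mat_adjoint_entry[of k P i] Pc Pa i by auto
    then show "P $$ (i, k) * P $$ (k, i) = of_real ((cmod (P $$ (i, k)))\<^sup>2)"
      by (simp add: complex_norm_square del: of_real_power)
  qed simp
  finally show ?thesis by simp
qed

lemma projection_mat_tr_nonneg:
  assumes "projection_mat n P" shows "0 \<le> Re (mat_tr P)"
proof -
  have "dim_row P = n" using assms by (auto simp: projection_mat_def)
  then show ?thesis
    by (auto simp: mat_tr_def projection_mat_diag[OF assms] intro!: sum_nonneg)
qed

lemma projection_mat_complement:
  assumes "projection_mat n P" shows "projection_mat n (1\<^sub>m n - P)"
proof -
  have P: "P \<in> carrier_mat n n" "P * P = P" "mat_adjoint P = P"
    using assms by (auto simp: projection_mat_def)
  have "(1\<^sub>m n - P) * (1\<^sub>m n - P) = (1\<^sub>m n - P) * 1\<^sub>m n - (1\<^sub>m n - P) * P"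
    using P(1) by (intro mult_minus_distrib_mat) auto
  also have "(1\<^sub>m n - P) * P = 1\<^sub>m n * P - P * P"
    using P(1) by (intro minus_mult_distrib_mat) auto
  also have "\<dots> = 0\<^sub>m n n" using P by auto
  finally have "(1\<^sub>m n - P) * (1\<^sub>m n - P) = 1\<^sub>m n - P" using P(1) by auto
  moreover have "mat_adjoint (1\<^sub>m n - P) = 1\<^sub>m n - P"
    using mat_adjoint_minus[of "1\<^sub>m n" n n P] P by auto
  ultimately show ?thesis using P by (auto simp: projection_mat_def)
qed

text \<open>The complementary projection has nonnegative trace as well. Traces of projections stand
  in for the dimension of the range in all later dimension counts.\<close>

lemma projection_mat_tr_le:
  assumes "projection_mat n P" shows "Re (mat_tr P) \<le> n"
proof -
  have "0 \<le> Re (mat_tr (1\<^sub>m n - P))"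
    using projection_mat_tr_nonneg[OF projection_mat_complement[OF assms]] .
  then show ?thesis using assms mat_tr_minus[of "1\<^sub>m n" n P] by (auto simp: projection_mat_def)
qed

section \<open>Isometries as orthonormal bases of subspaces\<close>

definition isometry_mat :: "nat \<Rightarrow> nat \<Rightarrow> complex mat \<Rightarrow> bool" where
  "isometry_mat n c W \<longleftrightarrow> W \<in> carrier_mat n c \<and> mat_adjoint W * W = 1\<^sub>m c"

text \<open>The columns of \<open>W\<close> are an orthonormal family of \<open>c\<close> vectors,
  and \<open>W * mat_adjoint W\<close> projects onto their span. Its trace equals that of
  \<open>mat_adjoint W * W\<close>, the identity of size \<open>c\<close>.\<close>

lemma isometry_projection:
  assumes "isometry_mat n c W"
  shows "projection_mat n (W * mat_adjoint W)" "mat_tr (W * mat_adjoint W) = of_nat c"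
proof -
  have W: "W \<in> carrier_mat n c" "mat_adjoint W * W = 1\<^sub>m c"
    using assms by (auto simp: isometry_mat_def)
  note Wa = mat_adjoint_carrier[OF W(1)]
  have "W * mat_adjoint W * (W * mat_adjoint W) = W * (mat_adjoint W * W) * mat_adjoint W"
    by (simp add: mat_assoc carrier_matD[OF W(1)])
  then have "W * mat_adjoint W * (W * mat_adjoint W) = W * mat_adjoint W"
    using W by simp
  moreover have "mat_adjoint (W * mat_adjoint W) = W * mat_adjoint W"
    using mat_adjoint_mult[OF W(1) Wa] by simp
  ultimately show "projection_mat n (W * mat_adjoint W)"
    using W Wa by (auto simp: projection_mat_def)
  show "mat_tr (W * mat_adjoint W) = of_nat c"
    using mat_tr_mult_commute[OF W(1) Wa] W(2) by simp
qed

lemma isometry_mat_le: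
  assumes "isometry_mat n c W" shows "c \<le> n"
  using projection_mat_tr_le[OF isometry_projection(1)[OF assms]] isometry_projection(2)[OF assms]
  by simp

text \<open>One Gram-Schmidt step, for a vector that is already normalized and orthogonal to the
  columns present.\<close>

lemma isometry_mat_append:
  assumes W: "isometry_mat n c W" and w: "w \<in> carrier_vec n"
    and orth: "mat_adjoint W *\<^sub>v w = 0\<^sub>v c" and unit: "(\<Sum>i<n. (cmod (w $ i))\<^sup>2) = 1"
  shows "isometry_mat n (Suc c) (mat n (Suc c) (\<lambda>(i, s). if s < c then W $$ (i, s) else w $ i))"
    (is "isometry_mat n _ ?V")
proof -
  have Wc: "W \<in> carrier_mat n c" and WW: "mat_adjoint W * W = 1\<^sub>m c"
    using W by (auto simp: isometry_mat_def)
  have V: "?V \<in> carrier_mat n (Suc c)" by simp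
  have o: "(\<Sum>i<n. cnj (W $$ (i, s)) * w $ i) = 0" if "s < c" for s
  proof -
    have "(mat_adjoint W *\<^sub>v w) $ s = (\<Sum>i<n. mat_adjoint W $$ (s, i) * w $ i)"
      using Wc w that by (intro mult_mat_vec_entry) auto
    then show ?thesis using orth that Wc by auto
  qed
  have o': "(\<Sum>i<n. W $$ (i, s) * cnj (w $ i)) = 0" if "s < c" for s
    using arg_cong[OF o[OF that], of cnj] by simp
  have WWe: "(\<Sum>i<n. cnj (W $$ (i, s)) * W $$ (i, t)) = of_bool (s = t)" if "s < c" "t < c" for s t
  proof -
    have "(mat_adjoint W * W) $$ (s, t) = (\<Sum>i<n. mat_adjoint W $$ (s, i) * W $$ (i, t))"
      using Wc that by (intro mult_mat_entry) auto
    then show ?thesis using WW that Wc by auto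
  qed
  have "mat_adjoint ?V * ?V = 1\<^sub>m (Suc c)"
  proof (rule eq_matI)
    fix s t assume "s < dim_row (1\<^sub>m (Suc c) :: complex mat)" "t < dim_col (1\<^sub>m (Suc c) :: complex mat)"
    then have st: "s < Suc c" "t < Suc c" by auto
    have "(mat_adjoint ?V * ?V) $$ (s, t) = (\<Sum>i<n. mat_adjoint ?V $$ (s, i) * ?V $$ (i, t))"
      using st by (intro mult_mat_entry) auto
    also have "\<dots> = (\<Sum>i<n. cnj (if s < c then W $$ (i, s) else w $ i) * (if t < c then W $$ (i, t) else w $ i))"
      using st by (intro sum.cong) auto
    also have "\<dots> = of_bool (s = t)"
    proof -
      consider "s < c" "t < c" | "s < c" "t = c" | "s = c" "t < c" | "s = c" "t = c"
        using st by linarith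
      then show ?thesis
      proof cases
        case 1
        then show ?thesis using WWe[OF 1] by simp
      next
        case 2
        then show ?thesis using o[OF 2(1)] by simp
      next
        case 3
        then show ?thesis using o'[OF 3(2)] by (simp add: mult.commute)
      next
        case 4
        have "(\<Sum>i<n. cnj (w $ i) * w $ i) = of_real (\<Sum>i<n. (cmod (w $ i))\<^sup>2)"
          by (simp add: complex_norm_square mult.commute del: of_real_power)
        then show ?thesis using unit 4 by simp
      qed
    qed
    finally show "(mat_adjoint ?V * ?V) $$ (s, t) = 1\<^sub>m (Suc c) $$ (s, t)"
      using st by auto
  qed auto
  then show ?thesis using V by (simp add: isometry_mat_def)
qed

definition vec_subspace :: "nat \<Rightarrow> complex vec set \<Rightarrow> bool" where
  "vec_subspace n V \<longleftrightarrow> V \<subseteq> carrier_vec n \<and> 0\<^sub>v n \<in> V \<and> (\<forall>v\<in>V. \<forall>w\<in>V. v + w \<in> V) \<and>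
     (\<forall>c. \<forall>v\<in>V. c \<cdot>\<^sub>v v \<in> V)"

lemma mat_vec_in_subspace:
  assumes V: "vec_subspace n V" and W: "W \<in> carrier_mat n c" and u: "u \<in> carrier_vec c"
    and cols: "\<And>s. s < c \<Longrightarrow> col W s \<in> V"
  shows "W *\<^sub>v u \<in> V"
proof -
  \<comment> \<open>Partial sums over the first \<open>k\<close> columns; passing to the next column
    uses only the closure properties of \<open>V\<close>.\<close>
  have "vec n (\<lambda>i. \<Sum>l<k. W $$ (i, l) * u $ l) \<in> V" if "k \<le> c" for k
    using that
  proof (induction k)
    case 0
    have "vec n (\<lambda>i. \<Sum>l<0::nat. W $$ (i, l) * u $ l) = 0\<^sub>v n" by auto
    then show ?case using V by (auto simp: vec_subspace_def)
  next
    case (Suc k)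
    have "vec n (\<lambda>i. \<Sum>l<Suc k. W $$ (i, l) * u $ l)
        = vec n (\<lambda>i. \<Sum>l<k. W $$ (i, l) * u $ l) + u $ k \<cdot>\<^sub>v col W k"
      using Suc.prems W by (intro eq_vecI) auto
    then show ?case using Suc V cols[of k] by (auto simp: vec_subspace_def)
  qed
  moreover have "W *\<^sub>v u = vec n (\<lambda>i. \<Sum>l<c. W $$ (i, l) * u $ l)"
    using W u by (intro eq_vecI) (auto simp: mult_mat_vec_entry[OF W u] simp del: index_mult_mat_vec)
  ultimately show ?thesis by simp
qed

text \<open>Orthonormal families in \<open>V\<close> have at most \<open>n\<close> members, so one
  of maximal length exists. It spans \<open>V\<close>, since the residual of a vector outside the
  span could be normalized and appended.\<close>

lemma subspace_isometry:
  assumes V: "vec_subspace n V"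
  obtains c W where "isometry_mat n c W"
    "\<And>v. v \<in> carrier_vec n \<Longrightarrow> v \<in> V \<longleftrightarrow> W * mat_adjoint W *\<^sub>v v = v"
proof -
  define Q where "Q c \<longleftrightarrow> (\<exists>W. isometry_mat n c W \<and> (\<forall>s<c. col W s \<in> V))" for c
  have "Q 0"
    unfolding Q_def isometry_mat_def
    by (intro exI[of _ "0\<^sub>m n 0"]) auto
  moreover have "Q c \<Longrightarrow> c \<le> n" for c using isometry_mat_le by (auto simp: Q_def)
  ultimately obtain c where c: "Q c" "\<And>c'. Q c' \<Longrightarrow> c' \<le> c"
    using ex_has_greatest_nat[of Q 0 id "Suc n"] by (auto simp: less_Suc_eq_le)
  then obtain W where W: "isometry_mat n c W" and cols: "\<And>s. s < c \<Longrightarrow> col W s \<in> V"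
    by (auto simp: Q_def)
  have Wc: "W \<in> carrier_mat n c" and WW: "mat_adjoint W * W = 1\<^sub>m c"
    using W by (auto simp: isometry_mat_def)
  note Wa = mat_adjoint_carrier[OF Wc]
  have PV: "W * mat_adjoint W *\<^sub>v v \<in> V" if "v \<in> carrier_vec n" for v
    using mat_vec_in_subspace[OF V Wc _ cols, of "mat_adjoint W *\<^sub>v v"] that Wc Wa
    by (auto simp: assoc_mult_mat_vec[OF Wc Wa])
  have "W * mat_adjoint W *\<^sub>v v = v" if v: "v \<in> V" for v
  proof (rule ccontr)
    assume ne: "W * mat_adjoint W *\<^sub>v v \<noteq> v"
    have vc: "v \<in> carrier_vec n" using v V by (auto simp: vec_subspace_def)
    define p where "p = W * mat_adjoint W *\<^sub>v v"
    \<comment> \<open>The residual of \<open>v\<close> after projection to the span of the columns: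
      it lies in \<open>V\<close>, is orthogonal to all columns and is nonzero.\<close>
    define z where "z = v + (-1) \<cdot>\<^sub>v p"
    have pc: "p \<in> carrier_vec n" unfolding p_def by (rule mult_mat_vec_carrier[OF mult_carrier_mat[OF Wc Wa] vc])
    have zc: "z \<in> carrier_vec n" using pc vc by (auto simp: z_def)
    have zV: "z \<in> V" using V v PV[OF vc] by (auto simp: z_def p_def vec_subspace_def)
    have "mat_adjoint W *\<^sub>v p = (mat_adjoint W * W) *\<^sub>v (mat_adjoint W *\<^sub>v v)"
      using vc by (simp add: p_def mat_vec_assoc carrier_matD[OF Wc])
    then have "mat_adjoint W *\<^sub>v p = mat_adjoint W *\<^sub>v v" using WW Wa vc by auto
    then have "mat_adjoint W *\<^sub>v p = mat_adjoint W *\<^sub>v v" using WW Wa vc by auto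
    moreover have "mat_adjoint W *\<^sub>v z
        = mat_adjoint W *\<^sub>v v + (-1) \<cdot>\<^sub>v (mat_adjoint W *\<^sub>v p)"
      unfolding z_def using Wa vc pc
      by (simp add: mult_add_distrib_mat_vec[OF Wa vc] mult_mat_vec[OF Wa pc])
    moreover have "dim_vec (mat_adjoint W *\<^sub>v v) = c" using Wc by simp
    ultimately have z0: "mat_adjoint W *\<^sub>v z = 0\<^sub>v c"
      by (intro eq_vecI) simp_all
    have "z \<noteq> 0\<^sub>v n"
    proof
      assume "z = 0\<^sub>v n"
      have "p $ i = v $ i" if "i < n" for i
        using arg_cong[OF \<open>z = 0\<^sub>v n\<close>, of "\<lambda>z. z $ i"] that pc vc by (auto simp: z_def)
      then have "p = v" using pc vc by (intro eq_vecI) auto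
      then show False using ne p_def by simp
    qed
    moreover have "z = 0\<^sub>v n" if "\<And>i. i < n \<Longrightarrow> z $ i = 0"
      using that zc by (intro eq_vecI) auto
    ultimately obtain i where i: "i < n" "z $ i \<noteq> 0" by blast
    define r where "r = (\<Sum>i<n. (cmod (z $ i))\<^sup>2)"
    have "0 < (cmod (z $ i))\<^sup>2" using i by simp
    also have "\<dots> \<le> r" unfolding r_def using i by (intro member_le_sum) auto
    finally have r: "0 < r" .
    define w where "w = complex_of_real (1 / sqrt r) \<cdot>\<^sub>v z"
    have wc: "w \<in> carrier_vec n" using zc by (auto simp: w_def)
    have wV: "w \<in> V" using zV V by (auto simp: w_def vec_subspace_def)
    have w0: "mat_adjoint W *\<^sub>v w = 0\<^sub>v c"
      unfolding w_def using mult_mat_vec[OF Wa zc] z0 by auto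
    have "(\<Sum>i<n. (cmod (w $ i))\<^sup>2) = (\<Sum>i<n. (1 / r) * (cmod (z $ i))\<^sup>2)"
      using zc r by (intro sum.cong) (auto simp: w_def norm_mult norm_divide power_mult_distrib power_divide)
    also have "\<dots> = 1" using r unfolding sum_distrib_left[symmetric] r_def[symmetric] by simp
    finally have w1: "(\<Sum>i<n. (cmod (w $ i))\<^sup>2) = 1" .
    let ?U = "mat n (Suc c) (\<lambda>(i, s). if s < c then W $$ (i, s) else w $ i)"
    have "col ?U s \<in> V" if "s < Suc c" for s
    proof (cases "s < c")
      case True
      then have "col ?U s = col W s" using Wc by (intro eq_vecI) auto
      then show ?thesis using cols True by simp
    next
      case False
      then have "col ?U s = w" using wc that by (intro eq_vecI) auto
      then show ?thesis using wV by simp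
    qed
    then have "Q (Suc c)" using isometry_mat_append[OF W wc w0 w1] by (auto simp: Q_def)
    then show False using c(2) by fastforce
  qed
  then have "v \<in> V \<longleftrightarrow> W * mat_adjoint W *\<^sub>v v = v" if "v \<in> carrier_vec n" for v
    using PV[OF that] by metis
  then show ?thesis using that[OF W] by blast
qed

text \<open>The projection R onto the fixed space of P satisfies R P = P and P R = R. Taking
  adjoints in the first identity gives P R = P, so R and P coincide.\<close>

lemma projection_isometry:
  assumes P: "projection_mat n P"
  obtains c W where "isometry_mat n c W" "W * mat_adjoint W = P"
proof -
  have Pc: "P \<in> carrier_mat n n" and PP: "P * P = P" and Pa: "mat_adjoint P = P"
    using P by (auto simp: projection_mat_def)
  have "vec_subspace n {v \<in> carrier_vec n. P *\<^sub>v v = v}"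
    using Pc by (auto simp: vec_subspace_def mult_add_distrib_mat_vec mult_mat_vec)
  from subspace_isometry[OF this] obtain c W where W: "isometry_mat n c W" and
    mem: "\<And>v. v \<in> carrier_vec n \<Longrightarrow>
      v \<in> {v \<in> carrier_vec n. P *\<^sub>v v = v} \<longleftrightarrow> W * mat_adjoint W *\<^sub>v v = v"
    by blast
  have eq: "P *\<^sub>v v = v \<longleftrightarrow> W * mat_adjoint W *\<^sub>v v = v" if "v \<in> carrier_vec n" for v
    using mem[OF that] that by blast
  define R where "R = W * mat_adjoint W"
  have R: "projection_mat n R" unfolding R_def by (rule isometry_projection[OF W])
  then have Rc: "R \<in> carrier_mat n n" and RR: "R * R = R" and Ra: "mat_adjoint R = R"
    by (auto simp: projection_mat_def)
  have "R * P = P"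
  proof (rule mat_eq_by_vec[of _ n n])
    fix v :: "complex vec" assume v: "v \<in> carrier_vec n"
    have "P *\<^sub>v (P *\<^sub>v v) = P *\<^sub>v v" using assoc_mult_mat_vec[OF Pc Pc v] PP by simp
    then have "R *\<^sub>v (P *\<^sub>v v) = P *\<^sub>v v" using eq[of "P *\<^sub>v v"] Pc v by (auto simp: R_def)
    then show "R * P *\<^sub>v v = P *\<^sub>v v" using assoc_mult_mat_vec[OF Rc Pc v] by simp
  qed (use Rc Pc in auto)
  moreover have "P * R = R"
  proof (rule mat_eq_by_vec[of _ n n])
    fix v :: "complex vec" assume v: "v \<in> carrier_vec n"
    have "R *\<^sub>v (R *\<^sub>v v) = R *\<^sub>v v" using assoc_mult_mat_vec[OF Rc Rc v] RR by simp
    then have "P *\<^sub>v (R *\<^sub>v v) = R *\<^sub>v v" using eq[of "R *\<^sub>v v"] Rc v by (auto simp: R_def)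
    then show "P * R *\<^sub>v v = R *\<^sub>v v" using assoc_mult_mat_vec[OF Pc Rc v] by simp
  qed (use Rc Pc in auto)
  moreover have "mat_adjoint (R * P) = P * R" using mat_adjoint_mult[OF Rc Pc] Ra Pa by simp
  ultimately have "R = P" using Pa by metis
  then show ?thesis using that[OF W] R_def by simp
qed

section \<open>Irreducible *-algebras of matrices\<close>

definition unit_matrix :: "nat \<Rightarrow> nat \<Rightarrow> nat \<Rightarrow> nat \<Rightarrow> complex mat" where
  "unit_matrix p q i j = mat p q (\<lambda>(a, b). of_bool (a = i \<and> b = j))"

lemma unit_matrix_carrier [simp]: "unit_matrix p q i j \<in> carrier_mat p q"
  by (simp add: unit_matrix_def)

lemma unit_matrix_dim [simp]:
  "dim_row (unit_matrix p q i j) = p" "dim_col (unit_matrix p q i j) = q"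
  by (simp_all add: unit_matrix_def)

lemma unit_matrix_entry [simp]:
  "a < p \<Longrightarrow> b < q \<Longrightarrow> unit_matrix p q i j $$ (a, b) = of_bool (a = i \<and> b = j)"
  by (simp add: unit_matrix_def)

lemma mat_induct_units:
  fixes x :: "complex mat"
  assumes zero: "Q (0\<^sub>m p q)"
    and step: "\<And>x c i j. x \<in> carrier_mat p q \<Longrightarrow> Q x \<Longrightarrow> i < p \<Longrightarrow> j < q \<Longrightarrow>
      Q (x + c \<cdot>\<^sub>m unit_matrix p q i j)"
    and x: "x \<in> carrier_mat p q"
  shows "Q x"
proof -
  \<comment> \<open>The truncation of \<open>x\<close> to the positions in \<open>S\<close>;
    inserting one position adds a multiple of one matrix unit.\<close>
  define X where "X S = mat p q (\<lambda>k. if k \<in> S then x $$ k else 0)" for S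
  have "finite S \<Longrightarrow> S \<subseteq> {..<p} \<times> {..<q} \<Longrightarrow> Q (X S)" for S
  proof (induction S rule: finite_induct)
    case empty
    have "X {} = 0\<^sub>m p q" by (intro eq_matI) (auto simp: X_def)
    then show ?case using zero by simp
  next
    case (insert k S)
    obtain i j where k: "k = (i, j)" by force
    have "X (insert k S) = X S + x $$ k \<cdot>\<^sub>m unit_matrix p q i j"
      using insert.hyps(2) by (intro eq_matI) (auto simp: X_def k)
    moreover have "X S \<in> carrier_mat p q" by (simp add: X_def)
    ultimately show ?case using insert step[of "X S" i j] k by auto
  qed
  from this[of "{..<p} \<times> {..<q}"] have "Q (X ({..<p} \<times> {..<q}))" by simp
  moreover have "X ({..<p} \<times> {..<q}) = x"
    using x by (intro eq_matI) (auto simp: X_def)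
  ultimately show ?thesis by simp
qed

text \<open>Linearity is required on the carrier only, because a homomorphism of algebras given by
  carrier sets is unconstrained elsewhere.\<close>

lemma mat_linear_expand:
  fixes g :: "complex mat \<Rightarrow> complex"
  assumes add: "\<And>x y. x \<in> carrier_mat p q \<Longrightarrow> y \<in> carrier_mat p q \<Longrightarrow> g (x + y) = g x + g y"
    and smult: "\<And>c x. x \<in> carrier_mat p q \<Longrightarrow> g (c \<cdot>\<^sub>m x) = c * g x"
    and x: "x \<in> carrier_mat p q"
  shows "g x = (\<Sum>i<p. \<Sum>j<q. x $$ (i, j) * g (unit_matrix p q i j))"
proof (rule mat_induct_units[OF _ _ x])
  have "g (0 \<cdot>\<^sub>m 0\<^sub>m p q) = 0" by (subst smult) auto
  then show "g (0\<^sub>m p q) = (\<Sum>i<p. \<Sum>j<q. 0\<^sub>m p q $$ (i, j) * g (unit_matrix p q i j))"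
    by simp
next
  fix x c i j
  assume x: "x \<in> carrier_mat p q" and ij: "i < p" "j < q"
    and IH: "g x = (\<Sum>i<p. \<Sum>j<q. x $$ (i, j) * g (unit_matrix p q i j))"
  let ?y = "x + c \<cdot>\<^sub>m unit_matrix p q i j"
  have "(\<Sum>a<p. \<Sum>b<q. ?y $$ (a, b) * g (unit_matrix p q a b))
      = (\<Sum>a<p. \<Sum>b<q. x $$ (a, b) * g (unit_matrix p q a b)
          + (if a = i then if b = j then c * g (unit_matrix p q i j) else 0 else 0))"
    using x by (intro sum.cong refl) (auto simp: ring_distribs)
  also have "\<dots> = g x + c * g (unit_matrix p q i j)"
  proof -
    have "(\<Sum>a<p. \<Sum>b<q. if a = i then if b = j then c * g (unit_matrix p q i j) else 0 else 0)
        = (\<Sum>a<p. if a = i then c * g (unit_matrix p q i j) else 0)"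
      using ij by (intro sum.cong) auto
    then show ?thesis using ij by (simp add: sum.distrib IH)
  qed
  also have "\<dots> = g ?y" using x by (simp add: add smult)
  finally show "g ?y = (\<Sum>a<p. \<Sum>b<q. ?y $$ (a, b) * g (unit_matrix p q a b))" ..
qed

text \<open>\<open>W\<close> is an orthonormal basis of the orthogonal complement of the kernel of
  \<open>Y\<close>; the vector \<open>u\<close> in the kernel makes it shorter than
  \<open>c\<close>. This is the drop of rank in the proof of Burnside's theorem.\<close>

lemma singular_support:
  assumes Y: "Y \<in> carrier_mat c c" and u: "u \<in> carrier_vec c" "u \<noteq> 0\<^sub>v c" and Yu: "Y *\<^sub>v u = 0\<^sub>v c"
  obtains c' W where "c' < c" "isometry_mat c c' W" "Y * (W * mat_adjoint W) = (Y :: complex mat)"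
proof -
  define V where "V = {v \<in> carrier_vec c. Y *\<^sub>v v = 0\<^sub>v c}"
  have "vec_subspace c V"
    using Y by (auto simp: V_def vec_subspace_def mult_add_distrib_mat_vec mult_mat_vec)
  then obtain c0 W0 where W0: "isometry_mat c c0 W0"
    and mem: "\<And>v. v \<in> carrier_vec c \<Longrightarrow> v \<in> V \<longleftrightarrow> W0 * mat_adjoint W0 *\<^sub>v v = v"
    using subspace_isometry by blast
  define P where "P = W0 * mat_adjoint W0"
  have P: "projection_mat c P" "mat_tr P = of_nat c0"
    using isometry_projection[OF W0] by (auto simp: P_def)
  then have Pc: "P \<in> carrier_mat c c" and PP: "P * P = P" by (auto simp: projection_mat_def)
  from projection_isometry[OF projection_mat_complement[OF P(1)]]
  obtain c' W where W: "isometry_mat c c' W" and WP: "W * mat_adjoint W = 1\<^sub>m c - P" by blast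
  have "(of_nat c' :: complex) = of_nat c - of_nat c0"
    using isometry_projection(2)[OF W] P(2) Pc by (simp add: WP mat_tr_minus[of _ c])
  then have cc: "c' + c0 = c" by (metis add.commute add_diff_cancel_left' diff_add_cancel of_nat_add of_nat_eq_iff)
  have "c0 \<noteq> 0"
  proof
    assume "c0 = 0"
    then have "P = 0\<^sub>m c c"
      using W0 by (intro eq_matI) (auto simp: P_def isometry_mat_def scalar_prod_def)
    then have "P *\<^sub>v u = 0\<^sub>v c" using u by auto
    moreover have "u \<in> V" using u Yu by (auto simp: V_def)
    ultimately show False using mem[OF u(1)] u(2) by (auto simp: P_def)
  qed
  have "Y * P = 0\<^sub>m c c"
  proof (rule mat_eq_by_vec[of _ c c])
    fix v :: "complex vec" assume v: "v \<in> carrier_vec c"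
    have Pv: "P *\<^sub>v v \<in> carrier_vec c" using Pc v by auto
    have "P *\<^sub>v (P *\<^sub>v v) = P *\<^sub>v v" using assoc_mult_mat_vec[OF Pc Pc v] PP by simp
    then have "P *\<^sub>v v \<in> V" using mem[OF Pv] by (simp add: P_def)
    then show "Y * P *\<^sub>v v = 0\<^sub>m c c *\<^sub>v v"
      using assoc_mult_mat_vec[OF Y Pc v] v by (auto simp: V_def)
  qed (use Y Pc in auto)
  moreover have "Y * (1\<^sub>m c - P) = Y * 1\<^sub>m c - Y * P"
    using Y Pc by (intro mult_minus_distrib_mat) auto
  ultimately have "Y * (W * mat_adjoint W) = Y" using Y by (auto simp: WP)
  then show ?thesis using that[of c' W] W cc \<open>c0 \<noteq> 0\<close> by simp
qed

section \<open>Burnside's theorem for self-adjoint matrix algebras\<close>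

lemma complex_eigenvector:
  fixes A :: "complex mat"
  assumes "A \<in> carrier_mat n n" "0 < n"
  obtains c v where "v \<in> carrier_vec n" "v \<noteq> 0\<^sub>v n" "A *\<^sub>v v = c \<cdot>\<^sub>v v"
  using spectrum_non_empty[OF assms(1)] assms
  by (auto simp: spectrum_def eigenvalue_def eigenvector_def)

definition star_matrices :: "nat \<Rightarrow> complex mat set \<Rightarrow> bool" where
  "star_matrices n C \<longleftrightarrow> C \<subseteq> carrier_mat n n \<and> (\<forall>x\<in>C. \<forall>y\<in>C. x + y \<in> C) \<and>
     (\<forall>c. \<forall>x\<in>C. c \<cdot>\<^sub>m x \<in> C) \<and> (\<forall>x\<in>C. \<forall>y\<in>C. x * y \<in> C) \<and> (\<forall>x\<in>C. mat_adjoint x \<in> C)"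

text \<open>The nonzero element excludes the zero algebra, which for \<open>n = 1\<close> also
  commutes with trivial projections only. It forces \<open>n\<close> to be positive.\<close>

definition irreducible_matrices :: "nat \<Rightarrow> complex mat set \<Rightarrow> bool" where
  "irreducible_matrices n C \<longleftrightarrow> (\<exists>x\<in>C. x \<noteq> 0\<^sub>m n n) \<and>
     (\<forall>P. projection_mat n P \<and> (\<forall>x\<in>C. x * P = P * x) \<longrightarrow> P = 0\<^sub>m n n \<or> P = 1\<^sub>m n)"

text \<open>Let P be the projection onto \<open>V\<close>. Invariance means x P = P x P for all x in
  \<open>C\<close>; the same identity for the adjoint of x gives P x = P x P. Hence P commutes with
  \<open>C\<close>.\<close>

lemma invariant_subspace_trivial:
  assumes C: "star_matrices n C" and irr: "irreducible_matrices n C"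
    and V: "vec_subspace n V" and inv: "\<And>x v. x \<in> C \<Longrightarrow> v \<in> V \<Longrightarrow> x *\<^sub>v v \<in> V"
  shows "V = {0\<^sub>v n} \<or> V = carrier_vec n"
proof -
  obtain c W where W: "isometry_mat n c W"
    and mem: "\<And>v. v \<in> carrier_vec n \<Longrightarrow> v \<in> V \<longleftrightarrow> W * mat_adjoint W *\<^sub>v v = v"
    using subspace_isometry[OF V] by blast
  define P where "P = W * mat_adjoint W"
  have P: "projection_mat n P" unfolding P_def by (rule isometry_projection[OF W])
  then have Pc: "P \<in> carrier_mat n n" and PP: "P * P = P" and Pa: "mat_adjoint P = P"
    by (auto simp: projection_mat_def)
  have PV: "P *\<^sub>v v \<in> V" if v: "v \<in> carrier_vec n" for v
    using mem[of "P *\<^sub>v v"] Pc v PP assoc_mult_mat_vec[OF Pc Pc v] by (auto simp: P_def)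
  have xP: "x * P = P * (x * P)" if x: "x \<in> C" for x
  proof (rule mat_eq_by_vec[of _ n n])
    have xc: "x \<in> carrier_mat n n" using x C by (auto simp: star_matrices_def)
    fix v :: "complex vec" assume v: "v \<in> carrier_vec n"
    have "x *\<^sub>v (P *\<^sub>v v) \<in> V" using inv[OF x PV[OF v]] .
    then have "P *\<^sub>v (x *\<^sub>v (P *\<^sub>v v)) = x *\<^sub>v (P *\<^sub>v v)"
      using mem[of "x *\<^sub>v (P *\<^sub>v v)"] Pc xc v by (auto simp: P_def)
    then show "x * P *\<^sub>v v = P * (x * P) *\<^sub>v v"
      using v by (simp add: mat_vec_assoc carrier_matD[OF Pc] carrier_matD[OF xc])
  qed (use x C Pc in \<open>auto simp: star_matrices_def\<close>)
  have "x * P = P * x" if x: "x \<in> C" for x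
  proof -
    have xc: "x \<in> carrier_mat n n" and xa: "mat_adjoint x \<in> C"
      using x C by (auto simp: star_matrices_def)
    have xac: "mat_adjoint x \<in> carrier_mat n n" using xc by simp
    have "mat_adjoint (mat_adjoint x * P) = mat_adjoint (P * (mat_adjoint x * P))"
      using xP[OF xa] by simp
    then have "P * x = P * x * P"
      using mat_adjoint_mult[OF xac Pc] mat_adjoint_mult[OF Pc mult_carrier_mat[OF xac Pc]]
      by (simp add: Pa)
    then show ?thesis using xP[OF x] Pc xc by (simp add: mat_assoc carrier_matD[OF Pc] carrier_matD[OF xc])
  qed
  then have "P = 0\<^sub>m n n \<or> P = 1\<^sub>m n" using irr P by (auto simp: irreducible_matrices_def)
  then show ?thesis
  proof
    assume P0: "P = 0\<^sub>m n n"
    have "v = 0\<^sub>v n" if "v \<in> V" for v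
    proof -
      have vc: "v \<in> carrier_vec n" using that V by (auto simp: vec_subspace_def)
      have "P *\<^sub>v v = v" using mem[OF vc] that by (simp add: P_def)
      then show ?thesis using P0 vc zero_mat_mult_vec[of v n n] by simp
    qed
    then show ?thesis using V by (auto simp: vec_subspace_def)
  next
    assume P1: "P = 1\<^sub>m n"
    have "v \<in> V" if "v \<in> carrier_vec n" for v
      using mem[OF that] that P1 by (auto simp: P_def)
    then show ?thesis using V by (auto simp: vec_subspace_def)
  qed
qed

text \<open>The orbit of \<open>v\<close> under \<open>C\<close> is an invariant subspace. If it
  were zero, the vectors killed by all of \<open>C\<close> would be a nonzero invariant subspace,
  hence everything, although \<open>C\<close> contains a nonzero matrix.\<close>

lemma irreducible_transitive:
  assumes C: "star_matrices n C" and irr: "irreducible_matrices n C"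
    and v: "v \<in> carrier_vec n" "v \<noteq> 0\<^sub>v n" and w: "w \<in> carrier_vec n"
  obtains x where "x \<in> C" "x *\<^sub>v v = w"
proof -
  have Cc: "x \<in> carrier_mat n n" if "x \<in> C" for x using that C by (auto simp: star_matrices_def)
  obtain x0 where x0: "x0 \<in> C" "x0 \<noteq> 0\<^sub>m n n" using irr by (auto simp: irreducible_matrices_def)
  have "0 \<cdot>\<^sub>m x0 = 0\<^sub>m n n" using Cc[OF x0(1)] by (intro eq_matI) auto
  then have z: "0\<^sub>m n n \<in> C" using C x0(1) unfolding star_matrices_def by metis
  define V where "V = (\<lambda>x. x *\<^sub>v v) ` C"
  have "vec_subspace n V"
    unfolding vec_subspace_def
  proof (intro conjI ballI allI)
    show "V \<subseteq> carrier_vec n" using mult_mat_vec_carrier[OF Cc v(1)] by (auto simp: V_def)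
    show "0\<^sub>v n \<in> V" using z v
      by (auto simp: V_def zero_mat_mult_vec intro!: image_eqI[of _ _ "0\<^sub>m n n"])
    fix a b assume "a \<in> V" "b \<in> V"
    then obtain x y where xy: "a = x *\<^sub>v v" "b = y *\<^sub>v v" "x \<in> C" "y \<in> C" by (auto simp: V_def)
    then have "a + b = (x + y) *\<^sub>v v"
      using add_mult_distrib_mat_vec[OF Cc[of x] Cc[of y] v(1)] by simp
    then show "a + b \<in> V" using C xy by (auto simp: V_def star_matrices_def)
  next
    fix c a assume "a \<in> V"
    then obtain x where x: "a = x *\<^sub>v v" "x \<in> C" unfolding V_def by blast
    have "c \<cdot>\<^sub>v a = (c \<cdot>\<^sub>m x) *\<^sub>v v"
      using Cc[OF x(2)] v x by (intro eq_vecI) auto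
    then show "c \<cdot>\<^sub>v a \<in> V" using C x by (auto simp: V_def star_matrices_def)
  qed
  moreover have "y *\<^sub>v a \<in> V" if ya: "y \<in> C" "a \<in> V" for y a
  proof -
    obtain x where x: "a = x *\<^sub>v v" "x \<in> C" using ya unfolding V_def by blast
    then have "y *\<^sub>v a = (y * x) *\<^sub>v v"
      using assoc_mult_mat_vec[OF Cc[OF ya(1)] Cc[OF x(2)] v(1)] by simp
    then show ?thesis using C ya x by (auto simp: V_def star_matrices_def)
  qed
  ultimately have "V = {0\<^sub>v n} \<or> V = carrier_vec n"
    by (rule invariant_subspace_trivial[OF C irr])
  moreover have "V \<noteq> {0\<^sub>v n}"
  proof
    assume "V = {0\<^sub>v n}"
    define V0 where "V0 = {v \<in> carrier_vec n. \<forall>x\<in>C. x *\<^sub>v v = 0\<^sub>v n}"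
    have v0: "v \<in> V0" using v \<open>V = {0\<^sub>v n}\<close> by (auto simp: V0_def V_def)
    have Cz: "x *\<^sub>v 0\<^sub>v n = 0\<^sub>v n" if "x \<in> C" for x
      using Cc[OF that] mat_mult_zero_vec[of x n] by simp
    have "vec_subspace n V0"
      using Cz
      by (auto simp: vec_subspace_def V0_def mult_add_distrib_mat_vec[OF Cc] mult_mat_vec[OF Cc])
    moreover have "y *\<^sub>v a \<in> V0" if "y \<in> C" "a \<in> V0" for y a
      using that Cz by (auto simp: V0_def)
    ultimately have "V0 = {0\<^sub>v n} \<or> V0 = carrier_vec n"
      by (rule invariant_subspace_trivial[OF C irr])
    then have all: "V0 = carrier_vec n" using v0 v(2) by auto
    have "x0 = 0\<^sub>m n n"
      by (rule mat_eq_by_vec[of _ n n])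
        (use Cc[OF x0(1)] x0(1) all in \<open>auto simp: V0_def zero_mat_mult_vec\<close>)
    then show False using x0 by simp
  qed
  ultimately have "w \<in> V" using w by blast
  then show ?thesis using that by (auto simp: V_def)
qed

text \<open>Burnside's theorem for \<open>*\<close>-algebras.  If \<open>T \<noteq> 0\<close> has minimal rank, then an eigenvalue \<open>l\<close> of
  the compression of \<open>S * T\<close> to the support of \<open>T\<close> makes \<open>T * S * T - l T\<close> of smaller rank, hence
  zero; by transitivity \<open>T\<close> then has rank one.\<close>

theorem irreducible_star_matrices_full:
  assumes C: "star_matrices n C" and irr: "irreducible_matrices n C"
  shows "C = carrier_mat n n"
proof -
  have Cc: "x \<in> carrier_mat n n" if "x \<in> C" for x using that C by (auto simp: star_matrices_def)
  have Cadd: "x + y \<in> C" and Cmult: "x * y \<in> C" if "x \<in> C" "y \<in> C" for x y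
    using that C by (auto simp: star_matrices_def)
  have Csm: "c \<cdot>\<^sub>m x \<in> C" and Cadj: "mat_adjoint x \<in> C" if "x \<in> C" for x c
    using that C by (auto simp: star_matrices_def)
  obtain x0 where x0: "x0 \<in> C" "x0 \<noteq> 0\<^sub>m n n" using irr by (auto simp: irreducible_matrices_def)
  \<comment> \<open>The size of an isometry whose range projection supports \<open>T\<close> bounds
    the rank of \<open>T\<close>, and its least value over nonzero \<open>T\<close> serves as the
    minimal rank.\<close>
  define Q where "Q c \<longleftrightarrow> (\<exists>T\<in>C. T \<noteq> 0\<^sub>m n n \<and> (\<exists>W. isometry_mat n c W \<and> T * (W * mat_adjoint W) = T))" for c
  have "Q n"
    using x0 Cc[OF x0(1)]
    by (auto simp: Q_def isometry_mat_def intro!: bexI[of _ x0] exI[of _ "1\<^sub>m n"])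
  define c where "c = (LEAST c. Q c)"
  have "Q c" unfolding c_def using \<open>Q n\<close> by (rule LeastI)
  then obtain T W where T: "T \<in> C" "T \<noteq> 0\<^sub>m n n" and W: "isometry_mat n c W"
    and TW: "T * (W * mat_adjoint W) = T" by (auto simp: Q_def)
  have least: "\<not> Q c'" if "c' < c" for c' using that not_less_Least unfolding c_def by blast
  note Tc = Cc[OF T(1)]
  have Wc: "W \<in> carrier_mat n c" and WW: "mat_adjoint W * W = 1\<^sub>m c"
    using W by (auto simp: isometry_mat_def)
  note Wa = mat_adjoint_carrier[OF Wc]
  have TW': "T * (W * (mat_adjoint W * Z)) = T * Z" if "dim_row Z = n" for Z
    using arg_cong[OF TW, of "\<lambda>M. M * Z"] that
    by (simp add: mat_assoc carrier_matD[OF Tc] carrier_matD[OF Wc])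
  have WW': "mat_adjoint W * (W * Z) = Z" if "dim_row Z = c" for Z
    using arg_cong[OF WW, of "\<lambda>M. M * Z"] that
    by (simp add: mat_assoc carrier_matD[OF Wc])
  have "c \<noteq> 0"
  proof
    assume "c = 0"
    then have "T * (W * mat_adjoint W) = 0\<^sub>m n n"
      using Wc Tc by (intro eq_matI) (auto simp: scalar_prod_def)
    then show False using TW T by simp
  qed
  have TST: "\<exists>l. T * S * T = l \<cdot>\<^sub>m T" if S: "S \<in> C" for S
  proof -
    note Sc = Cc[OF S]
    define Z where "Z = mat_adjoint W * (S * T * W)"
    have Zc: "Z \<in> carrier_mat c c" unfolding Z_def using Wc Wa Sc Tc by auto
    obtain l u where u: "u \<in> carrier_vec c" "u \<noteq> 0\<^sub>v c" "Z *\<^sub>v u = l \<cdot>\<^sub>v u"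
      using complex_eigenvector[OF Zc] \<open>c \<noteq> 0\<close> by (metis gr0I)
    define Y where "Y = Z + (- l) \<cdot>\<^sub>m 1\<^sub>m c"
    have Yc: "Y \<in> carrier_mat c c" using Zc by (simp add: Y_def)
    have "Y *\<^sub>v u = Z *\<^sub>v u + ((- l) \<cdot>\<^sub>m 1\<^sub>m c) *\<^sub>v u"
      unfolding Y_def by (rule add_mult_distrib_mat_vec[OF Zc _ u(1)]) auto
    also have "((- l) \<cdot>\<^sub>m 1\<^sub>m c) *\<^sub>v u = (- l) \<cdot>\<^sub>v u"
      using u(1) by (intro eq_vecI) auto
    also have "Z *\<^sub>v u + (- l) \<cdot>\<^sub>v u = 0\<^sub>v c"
      using u by (intro eq_vecI) auto
    finally have "Y *\<^sub>v u = 0\<^sub>v c" .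
    then obtain c' W2 where W2: "c' < c" "isometry_mat c c' W2" "Y * (W2 * mat_adjoint W2) = Y"
      using singular_support[OF Yc u(1,2)] by blast
    have W2c: "W2 \<in> carrier_mat c c'" and WW2: "mat_adjoint W2 * W2 = 1\<^sub>m c'"
      using W2(2) by (auto simp: isometry_mat_def)
    \<comment> \<open>As \<open>T\<close> is supported on the range of \<open>W\<close>, this equals
      \<open>T * W * Y * mat_adjoint W\<close> with \<open>Y\<close> singular. It is supported on
      the range of \<open>W * W2\<close>, of size \<open>c' < c\<close>, so minimality makes it
      zero.\<close>
    define X where "X = T * S * T + (- l) \<cdot>\<^sub>m T"
    have X: "X \<in> C" unfolding X_def using T(1) S by (intro Cadd Cmult Csm)
    have "T * W * Z * mat_adjoint W = T * S * T"
      unfolding Z_def using TW' TW Tc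
      by (simp add: mat_assoc carrier_matD[OF Tc] carrier_matD[OF Wc] carrier_matD[OF Sc])
    moreover have "T * W * ((- l) \<cdot>\<^sub>m 1\<^sub>m c) * mat_adjoint W = (- l) \<cdot>\<^sub>m T"
    proof -
      have "T * W * ((- l) \<cdot>\<^sub>m 1\<^sub>m c) = (- l) \<cdot>\<^sub>m (T * W)"
        using Tc Wc mult_smult_distrib[of "T * W" n c "1\<^sub>m c" c "- l"] by simp
      then have "T * W * ((- l) \<cdot>\<^sub>m 1\<^sub>m c) * mat_adjoint W = (- l) \<cdot>\<^sub>m (T * W * mat_adjoint W)"
        using Tc Wc Wa mult_smult_assoc_mat[of "T * W" n c "mat_adjoint W" n "- l"] by simp
      then show ?thesis using TW by (simp add: mat_assoc carrier_matD[OF Tc] carrier_matD[OF Wc])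
    qed
    moreover have "T * W * Y * mat_adjoint W
        = T * W * Z * mat_adjoint W + T * W * ((- l) \<cdot>\<^sub>m 1\<^sub>m c) * mat_adjoint W"
    proof -
      have "T * W * Y = T * W * Z + T * W * ((- l) \<cdot>\<^sub>m 1\<^sub>m c)"
        unfolding Y_def using Tc Wc Zc by (intro mult_add_distrib_mat) auto
      then show ?thesis
        using add_mult_distrib_mat[OF mult_carrier_mat[OF mult_carrier_mat[OF Tc Wc] Zc]
            mult_carrier_mat[OF mult_carrier_mat[OF Tc Wc], of "(- l) \<cdot>\<^sub>m 1\<^sub>m c" c] Wa]
        by simp
    qed
    ultimately have XY: "X = T * W * Y * mat_adjoint W" by (simp add: X_def)
    have Y2: "Y * (W2 * (mat_adjoint W2 * M)) = Y * M" if "dim_row M = c" for M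
      using arg_cong[OF W2(3), of "\<lambda>N. N * M"] that
      by (simp add: mat_assoc carrier_matD[OF Yc] carrier_matD[OF W2c])
    have "isometry_mat n c' (W * W2)"
      using Wc W2c WW2
      by (auto simp: isometry_mat_def mat_adjoint_mult[OF Wc W2c] mat_assoc WW')
    moreover have "X * ((W * W2) * mat_adjoint (W * W2)) = X"
      using Tc by (simp add: XY mat_adjoint_mult[OF Wc W2c] mat_assoc carrier_matD[OF Tc]
          carrier_matD[OF Wc] carrier_matD[OF W2c] carrier_matD[OF Yc] WW' Y2)
    ultimately have "X = 0\<^sub>m n n" using least[OF W2(1)] X by (auto simp: Q_def)
    have "T * S * T = l \<cdot>\<^sub>m T"
    proof (rule eq_matI)
      fix i j assume ij: "i < dim_row (l \<cdot>\<^sub>m T)" "j < dim_col (l \<cdot>\<^sub>m T)"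
      then have "X $$ (i, j) = 0" using \<open>X = 0\<^sub>m n n\<close> Tc by simp
      then show "(T * S * T) $$ (i, j) = (l \<cdot>\<^sub>m T) $$ (i, j)"
        using ij Tc by (simp add: X_def)
    qed (use Tc in auto)
    then show ?thesis ..
  qed
  have "\<exists>v. v \<in> carrier_vec n \<and> T *\<^sub>v v \<noteq> 0\<^sub>v n"
  proof (rule ccontr)
    assume "\<not> ?thesis"
    then have "T = 0\<^sub>m n n"
      by (intro mat_eq_by_vec[of _ n n]) (use Tc in \<open>auto simp: zero_mat_mult_vec\<close>)
    then show False using T by simp
  qed
  then obtain v0 where v0: "v0 \<in> carrier_vec n" "T *\<^sub>v v0 \<noteq> 0\<^sub>v n" by blast
  define y where "y = T *\<^sub>v v0"
  have yc: "y \<in> carrier_vec n" unfolding y_def by (rule mult_mat_vec_carrier[OF Tc v0(1)])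
  \<comment> \<open>With \<open>S\<close> in \<open>C\<close> sending \<open>y\<close> to
    \<open>z\<close>, the vector T z is T S T applied to \<open>v0\<close>, a multiple of
    \<open>y\<close>. So the range of \<open>T\<close> is a line.\<close>
  have rank1: "\<exists>l. T *\<^sub>v z = l \<cdot>\<^sub>v y" if z: "z \<in> carrier_vec n" for z
  proof -
    obtain S where S: "S \<in> C" "S *\<^sub>v y = z"
      using irreducible_transitive[OF C irr yc _ z] v0 by (auto simp: y_def)
    obtain l where "T * S * T = l \<cdot>\<^sub>m T" using TST[OF S(1)] by blast
    then have "(T * S * T) *\<^sub>v v0 = (l \<cdot>\<^sub>m T) *\<^sub>v v0" by simp
    also have "(T * S * T) *\<^sub>v v0 = T *\<^sub>v z"
      using v0(1) S(2) unfolding y_def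
      by (simp add: mat_vec_assoc mat_assoc carrier_matD[OF Tc] carrier_matD[OF Cc[OF S(1)]])
    also have "(l \<cdot>\<^sub>m T) *\<^sub>v v0 = l \<cdot>\<^sub>v y"
      unfolding y_def using Tc v0(1) by (intro eq_vecI) auto
    finally show ?thesis by blast
  qed
  then have "\<forall>j. \<exists>l. T *\<^sub>v unit_vec n j = l \<cdot>\<^sub>v y" by simp
  then obtain f where f: "\<And>j. T *\<^sub>v unit_vec n j = f j \<cdot>\<^sub>v y" by metis
  have Tij: "T $$ (i, j) = y $ i * f j" if "i < n" "j < n" for i j
  proof -
    have "(T *\<^sub>v unit_vec n j) $ i = (f j \<cdot>\<^sub>v y) $ i" using f by simp
    then show ?thesis using that Tc yc by (auto simp: mult.commute)
  qed
  \<comment> \<open>\<open>T\<close> is the rank one matrix formed by \<open>y\<close> and the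
    adjoint of \<open>g\<close>. Multiplying it by \<open>a\<close> on the left and by the adjoint
    of \<open>b\<close> on the right replaces the pair by \<open>a y\<close> and \<open>b g\<close>,
    which transitivity turns into unit vectors.\<close>
  define g where "g = vec n (\<lambda>j. cnj (f j))"
  have gc: "g \<in> carrier_vec n" by (simp add: g_def)
  have "g \<noteq> 0\<^sub>v n"
  proof
    assume g0: "g = 0\<^sub>v n"
    have "f j = 0" if "j < n" for j
      using arg_cong[OF g0, of "\<lambda>g. g $ j"] that by (simp add: g_def)
    then have "T = 0\<^sub>m n n" using Tij Tc by (intro eq_matI) auto
    then show False using T by simp
  qed
  have unit: "unit_matrix n n s t \<in> C" if st: "s < n" "t < n" for s t
  proof -
    obtain a where a: "a \<in> C" "a *\<^sub>v y = unit_vec n s"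
      using irreducible_transitive[OF C irr yc, of "unit_vec n s"] v0(2) by (auto simp: y_def)
    obtain b where b: "b \<in> C" "b *\<^sub>v g = unit_vec n t"
      using irreducible_transitive[OF C irr gc \<open>g \<noteq> 0\<^sub>v n\<close>, of "unit_vec n t"] by auto
    note ac = Cc[OF a(1)] and bc = Cc[OF b(1)]
    have "a * T * mat_adjoint b = unit_matrix n n s t"
    proof (rule eq_matI)
      fix i j assume "i < dim_row (unit_matrix n n s t)" "j < dim_col (unit_matrix n n s t)"
      then have ij: "i < n" "j < n" by auto
      have "(a * T * mat_adjoint b) $$ (i, j)
          = (\<Sum>l<n. (\<Sum>k<n. a $$ (i, k) * (y $ k * f l)) * cnj (b $$ (j, l)))"
        using ij ac bc Tc Tij
        by (subst mult_mat_entry[of _ n n _ n])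
          (auto intro!: sum.cong simp: mult_mat_entry[OF ac Tc] simp del: index_mult_mat(1))
      also have "\<dots> = (\<Sum>k<n. a $$ (i, k) * y $ k) * cnj (\<Sum>l<n. b $$ (j, l) * cnj (f l))"
        by (simp add: sum_distrib_left sum_distrib_right mult_ac)
          (subst sum.swap, simp)
      also have "(\<Sum>k<n. a $$ (i, k) * y $ k) = (a *\<^sub>v y) $ i"
        using mult_mat_vec_entry[OF ac yc ij(1)] by simp
      also have "(\<Sum>l<n. b $$ (j, l) * cnj (f l)) = (b *\<^sub>v g) $ j"
        using mult_mat_vec_entry[OF bc gc ij(2)] by (simp add: g_def)
      finally show "(a * T * mat_adjoint b) $$ (i, j) = unit_matrix n n s t $$ (i, j)"
        using ij st a(2) b(2) by auto
    qed (use ac bc in auto)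
    moreover have "a * T * mat_adjoint b \<in> C" using a b T by (intro Cmult Cadj)
    ultimately show ?thesis by simp
  qed
  have "0 \<cdot>\<^sub>m x0 = 0\<^sub>m n n" using Cc[OF x0(1)] by (intro eq_matI) auto
  then have z: "0\<^sub>m n n \<in> C" using Csm x0(1) by metis
  have "x \<in> C" if "x \<in> carrier_mat n n" for x
    by (rule mat_induct_units[of "\<lambda>x. x \<in> C", OF z _ that]) (intro Cadd Csm unit)
  then show ?thesis using Cc by blast
qed

section \<open>The operator norm\<close>

lemma l2_norm_vec_L2_set: "l2_norm_vec v = L2_set (\<lambda>i. cmod (v $ i)) {..<dim_vec v}"
  by (simp add: l2_norm_vec_def L2_set_def)

lemma l2_norm_vec_nonneg [simp]: "0 \<le> l2_norm_vec v"
  by (simp add: l2_norm_vec_L2_set)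

lemma l2_norm_vec_zero [simp]: "l2_norm_vec (0\<^sub>v n) = 0"
  by (simp add: l2_norm_vec_def)

lemma l2_norm_vec_eq_0: "l2_norm_vec v = 0 \<Longrightarrow> v = 0\<^sub>v (dim_vec v)"
  by (intro eq_vecI) (auto simp: l2_norm_vec_L2_set L2_set_eq_0_iff)

lemma l2_norm_vec_smult: "l2_norm_vec (c \<cdot>\<^sub>v v) = cmod c * l2_norm_vec v"
  by (simp add: l2_norm_vec_L2_set L2_set_right_distrib norm_mult cong: L2_set_cong_simp)

lemma cmod_le_l2_norm_vec: "i < dim_vec v \<Longrightarrow> cmod (v $ i) \<le> l2_norm_vec v"
  unfolding l2_norm_vec_L2_set by (rule member_le_L2_set) auto

lemma l2_norm_vec_le_sum: "l2_norm_vec v \<le> (\<Sum>i<dim_vec v. cmod (v $ i))"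
  unfolding l2_norm_vec_L2_set by (rule L2_set_le_sum) auto

lemma l2_norm_vec_square: "complex_of_real ((l2_norm_vec v)\<^sup>2) = (\<Sum>i<dim_vec v. v $ i * cnj (v $ i))"
  by (simp add: l2_norm_vec_def sum_nonneg complex_norm_square del: of_real_power)

lemma l2_norm_vec_unit: "j < n \<Longrightarrow> l2_norm_vec (unit_vec n j) = 1"
proof -
  assume "j < n"
  have "(\<Sum>i<n. (cmod (unit_vec n j $ i))\<^sup>2) = (\<Sum>i<n. if i = j then 1 else 0)"
    using \<open>j < n\<close> by (intro sum.cong) (auto simp: unit_vec_def)
  then show ?thesis using \<open>j < n\<close> by (simp add: l2_norm_vec_def)
qed

lemma l2_cauchy_schwarz:
  assumes "dim_vec v = n" "dim_vec w = n"
  shows "cmod (\<Sum>i<n. v $ i * cnj (w $ i)) \<le> l2_norm_vec v * l2_norm_vec w"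
proof -
  have "cmod (\<Sum>i<n. v $ i * cnj (w $ i)) \<le> (\<Sum>i<n. \<bar>cmod (v $ i)\<bar> * \<bar>cmod (w $ i)\<bar>)"
    by (rule order_trans[OF norm_sum]) (simp add: norm_mult)
  also have "\<dots> \<le> l2_norm_vec v * l2_norm_vec w"
    unfolding l2_norm_vec_L2_set assms by (rule L2_set_mult_ineq)
  finally show ?thesis .
qed

lemma adjoint_inner:
  assumes M: "M \<in> carrier_mat n m" and v: "v \<in> carrier_vec m" and w: "w \<in> carrier_vec n"
  shows "(\<Sum>i<n. (M *\<^sub>v v) $ i * cnj (w $ i)) = (\<Sum>j<m. v $ j * cnj ((mat_adjoint M *\<^sub>v w) $ j))"
proof -
  have "(\<Sum>i<n. (M *\<^sub>v v) $ i * cnj (w $ i)) = (\<Sum>i<n. \<Sum>j<m. v $ j * (M $$ (i, j) * cnj (w $ i)))"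
    by (intro sum.cong refl)
      (simp add: mult_mat_vec_entry[OF M v] sum_distrib_right sum_distrib_left mult_ac del: index_mult_mat_vec)
  also have "\<dots> = (\<Sum>j<m. \<Sum>i<n. v $ j * (M $$ (i, j) * cnj (w $ i)))"
    by (rule sum.swap)
  also have "\<dots> = (\<Sum>j<m. v $ j * cnj ((mat_adjoint M *\<^sub>v w) $ j))"
    using M by (intro sum.cong refl)
      (simp add: mult_mat_vec_entry[OF mat_adjoint_carrier[OF M] w] sum_distrib_left
        carrier_matD[OF M] del: index_mult_mat_vec)
  finally show ?thesis .
qed

lemma l2_norm_mult_vec_square:
  assumes M: "M \<in> carrier_mat n m" and v: "v \<in> carrier_vec m"
  shows "complex_of_real ((l2_norm_vec (M *\<^sub>v v))\<^sup>2)
    = (\<Sum>j<m. v $ j * cnj ((mat_adjoint M * M *\<^sub>v v) $ j))"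
proof -
  have "complex_of_real ((l2_norm_vec (M *\<^sub>v v))\<^sup>2) = (\<Sum>i<n. (M *\<^sub>v v) $ i * cnj ((M *\<^sub>v v) $ i))"
    using M by (simp add: l2_norm_vec_square del: of_real_power index_mult_mat_vec)
  also have "\<dots> = (\<Sum>j<m. v $ j * cnj ((mat_adjoint M *\<^sub>v (M *\<^sub>v v)) $ j))"
    by (rule adjoint_inner[OF M v mult_mat_vec_carrier[OF M v]])
  finally show ?thesis using M v by (simp add: mat_vec_assoc del: index_mult_mat_vec)
qed

lemma isometry_l2_norm:
  assumes "isometry_mat n c W" "v \<in> carrier_vec c"
  shows "l2_norm_vec (W *\<^sub>v v) = l2_norm_vec v"
proof -
  have "complex_of_real ((l2_norm_vec (W *\<^sub>v v))\<^sup>2) = complex_of_real ((l2_norm_vec v)\<^sup>2)"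
    using assms l2_norm_mult_vec_square[of W n c v]
    by (auto simp: isometry_mat_def l2_norm_vec_square simp del: of_real_power)
  then have "(l2_norm_vec (W *\<^sub>v v))\<^sup>2 = (l2_norm_vec v)\<^sup>2" using of_real_eq_iff by blast
  then show ?thesis by simp
qed

text \<open>A crude bound. It shows that the supremum defining \<open>operator_norm\<close> is
  finite, and it later compares norms on finite dimensional algebras.\<close>

lemma l2_norm_mult_vec_le_entries:
  assumes M: "M \<in> carrier_mat n m" and v: "v \<in> carrier_vec m"
  shows "l2_norm_vec (M *\<^sub>v v) \<le> (\<Sum>i<n. \<Sum>j<m. cmod (M $$ (i, j))) * l2_norm_vec v"
proof -
  have "l2_norm_vec (M *\<^sub>v v) \<le> (\<Sum>i<n. cmod ((M *\<^sub>v v) $ i))"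
    using l2_norm_vec_le_sum[of "M *\<^sub>v v"] M by simp
  also have "\<dots> \<le> (\<Sum>i<n. \<Sum>j<m. cmod (M $$ (i, j)) * l2_norm_vec v)"
  proof (intro sum_mono)
    fix i assume "i \<in> {..<n}"
    then have "cmod ((M *\<^sub>v v) $ i) \<le> (\<Sum>j<m. cmod (M $$ (i, j) * v $ j))"
      using mult_mat_vec_entry[OF M v] by (auto intro: norm_sum simp del: index_mult_mat_vec)
    also have "\<dots> \<le> (\<Sum>j<m. cmod (M $$ (i, j)) * l2_norm_vec v)"
      using v by (intro sum_mono) (auto simp: norm_mult intro!: mult_left_mono cmod_le_l2_norm_vec)
    finally show "cmod ((M *\<^sub>v v) $ i) \<le> (\<Sum>j<m. cmod (M $$ (i, j)) * l2_norm_vec v)" .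
  qed
  finally show ?thesis by (simp add: sum_distrib_right)
qed

section \<open>Submultiplicativity, C*-identity and unitary invariance\<close>

lemma operator_norm_bdd:
  assumes M: "M \<in> carrier_mat n m"
  shows "bdd_above {l2_norm_vec (M *\<^sub>v v) |v. v \<in> carrier_vec (dim_col M) \<and> l2_norm_vec v \<le> 1}"
proof (rule bdd_aboveI)
  fix s assume "s \<in> {l2_norm_vec (M *\<^sub>v v) |v. v \<in> carrier_vec (dim_col M) \<and> l2_norm_vec v \<le> 1}"
  then obtain w where w: "s = l2_norm_vec (M *\<^sub>v w)" "w \<in> carrier_vec m" "l2_norm_vec w \<le> 1"
    using M by auto
  have "s \<le> (\<Sum>i<n. \<Sum>j<m. cmod (M $$ (i, j))) * l2_norm_vec w"
    using l2_norm_mult_vec_le_entries[OF M w(2)] w(1) by simp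
  also have "\<dots> \<le> (\<Sum>i<n. \<Sum>j<m. cmod (M $$ (i, j)))"
    using w(3) by (simp add: mult_left_le sum_nonneg)
  finally show "s \<le> (\<Sum>i<n. \<Sum>j<m. cmod (M $$ (i, j)))" .
qed

lemma operator_norm_bound:
  assumes M: "M \<in> carrier_mat n m" and v: "v \<in> carrier_vec m"
  shows "l2_norm_vec (M *\<^sub>v v) \<le> operator_norm M * l2_norm_vec v"
proof -
  define S where "S = {l2_norm_vec (M *\<^sub>v v) | v. v \<in> carrier_vec (dim_col M) \<and> l2_norm_vec v \<le> 1}"
  have bdd: "bdd_above S" unfolding S_def by (rule operator_norm_bdd[OF M])
  show ?thesis
  proof (cases "l2_norm_vec v = 0")
    case True
    then have "v = 0\<^sub>v m" using l2_norm_vec_eq_0[of v] v by simp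
    then show ?thesis using M by (simp add: mat_mult_zero_vec)
  next
    case False
    define r where "r = l2_norm_vec v"
    have r: "0 < r" using False l2_norm_vec_nonneg[of v] by (simp add: r_def order_less_le)
    define w where "w = complex_of_real (1 / r) \<cdot>\<^sub>v v"
    have w: "w \<in> carrier_vec m" "l2_norm_vec w = 1"
      using v r by (auto simp: w_def l2_norm_vec_smult r_def[symmetric] norm_divide)
    then have "l2_norm_vec (M *\<^sub>v w) \<le> Sup S"
      using bdd M by (intro cSup_upper) (auto simp: S_def)
    moreover have "M *\<^sub>v w = complex_of_real (1 / r) \<cdot>\<^sub>v (M *\<^sub>v v)"
      unfolding w_def by (rule mult_mat_vec[OF M v])
    ultimately have "l2_norm_vec (M *\<^sub>v v) / r \<le> Sup S"
      using r by (simp add: l2_norm_vec_smult norm_divide)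
    then show ?thesis using r by (simp add: operator_norm_def S_def r_def[symmetric] field_simps)
  qed
qed

lemma operator_norm_leI:
  assumes M: "M \<in> carrier_mat n m" and K: "0 \<le> K"
    and le: "\<And>v. v \<in> carrier_vec m \<Longrightarrow> l2_norm_vec (M *\<^sub>v v) \<le> K * l2_norm_vec v"
  shows "operator_norm M \<le> K"
  unfolding operator_norm_def
proof (rule cSup_least)
  show "{l2_norm_vec (M *\<^sub>v v) |v. v \<in> carrier_vec (dim_col M) \<and> l2_norm_vec v \<le> 1} \<noteq> {}"
    by (auto intro!: exI[of _ "0\<^sub>v (dim_col M)"])
  fix s assume "s \<in> {l2_norm_vec (M *\<^sub>v v) |v. v \<in> carrier_vec (dim_col M) \<and> l2_norm_vec v \<le> 1}"
  then obtain w where w: "s = l2_norm_vec (M *\<^sub>v w)" "w \<in> carrier_vec m" "l2_norm_vec w \<le> 1"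
    using M by auto
  have "s \<le> K * l2_norm_vec w" using le[OF w(2)] w(1) by simp
  also have "\<dots> \<le> K" using w(3) K by (simp add: mult_left_le)
  finally show "s \<le> K" .
qed

lemma operator_norm_nonneg:
  assumes M: "M \<in> carrier_mat n m"
  shows "0 \<le> operator_norm M"
proof -
  have "l2_norm_vec (M *\<^sub>v 0\<^sub>v (dim_col M)) \<le> operator_norm M"
    unfolding operator_norm_def
    by (intro cSup_upper operator_norm_bdd[OF M]) (auto intro!: exI[of _ "0\<^sub>v (dim_col M)"])
  then show ?thesis by (simp add: mat_mult_zero_vec)
qed

lemma operator_norm_le_entries:
  assumes M: "M \<in> carrier_mat n m"
  shows "operator_norm M \<le> (\<Sum>i<n. \<Sum>j<m. cmod (M $$ (i, j)))"
  by (rule operator_norm_leI[OF M]) (simp_all add: sum_nonneg l2_norm_mult_vec_le_entries[OF M])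

lemma entry_le_operator_norm:
  assumes M: "M \<in> carrier_mat n m" and ij: "i < n" "j < m"
  shows "cmod (M $$ (i, j)) \<le> operator_norm M"
proof -
  have "cmod ((M *\<^sub>v unit_vec m j) $ i) \<le> l2_norm_vec (M *\<^sub>v unit_vec m j)"
    using M ij by (intro cmod_le_l2_norm_vec) auto
  also have "\<dots> \<le> operator_norm M"
    using operator_norm_bound[OF M, of "unit_vec m j"] ij by (simp add: l2_norm_vec_unit)
  finally show ?thesis using M ij by simp
qed

lemma operator_norm_mult_le:
  assumes A: "A \<in> carrier_mat n m" and B: "B \<in> carrier_mat m k"
  shows "operator_norm (A * B) \<le> operator_norm A * operator_norm B"
proof (rule operator_norm_leI[OF mult_carrier_mat[OF A B]])
  fix v :: "complex vec" assume v: "v \<in> carrier_vec k"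
  have "l2_norm_vec (A *\<^sub>v (B *\<^sub>v v)) \<le> operator_norm A * l2_norm_vec (B *\<^sub>v v)"
    by (rule operator_norm_bound[OF A mult_mat_vec_carrier[OF B v]])
  also have "\<dots> \<le> operator_norm A * (operator_norm B * l2_norm_vec v)"
    by (rule mult_left_mono[OF operator_norm_bound[OF B v] operator_norm_nonneg[OF A]])
  finally show "l2_norm_vec (A * B *\<^sub>v v) \<le> operator_norm A * operator_norm B * l2_norm_vec v"
    using assoc_mult_mat_vec[OF A B v] by simp
qed (simp add: operator_norm_nonneg[OF A] operator_norm_nonneg[OF B])

text \<open>The squared length of M v is the inner product of v with
  \<open>mat_adjoint M * M\<close> applied to v; the Cauchy-Schwarz inequality bounds it.\<close>

lemma operator_norm_square_le:
  assumes M: "M \<in> carrier_mat n m"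
  shows "(operator_norm M)\<^sup>2 \<le> operator_norm (mat_adjoint M * M)"
proof -
  note MM = mult_carrier_mat[OF mat_adjoint_carrier[OF M] M]
  let ?K = "operator_norm (mat_adjoint M * M)"
  have "operator_norm M \<le> sqrt ?K"
  proof (rule operator_norm_leI[OF M])
    fix v :: "complex vec" assume v: "v \<in> carrier_vec m"
    have "(l2_norm_vec (M *\<^sub>v v))\<^sup>2 = cmod (complex_of_real ((l2_norm_vec (M *\<^sub>v v))\<^sup>2))"
      by (simp del: of_real_power)
    also have "\<dots> \<le> l2_norm_vec v * l2_norm_vec (mat_adjoint M * M *\<^sub>v v)"
      unfolding l2_norm_mult_vec_square[OF M v] by (rule l2_cauchy_schwarz) (use v M in auto)
    also have "\<dots> \<le> l2_norm_vec v * (?K * l2_norm_vec v)"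
      by (rule mult_left_mono[OF operator_norm_bound[OF MM v]]) simp
    also have "\<dots> = (sqrt ?K * l2_norm_vec v)\<^sup>2"
      using operator_norm_nonneg[OF MM] by (simp add: power2_eq_square algebra_simps)
    finally show "l2_norm_vec (M *\<^sub>v v) \<le> sqrt ?K * l2_norm_vec v"
      by (rule power2_le_imp_le) (simp add: operator_norm_nonneg[OF MM])
  qed (simp add: operator_norm_nonneg[OF MM])
  then have "(operator_norm M)\<^sup>2 \<le> (sqrt ?K)\<^sup>2"
    by (rule power_mono) (rule operator_norm_nonneg[OF M])
  then show ?thesis using operator_norm_nonneg[OF MM] by simp
qed

text \<open>Combine the previous inequality with submultiplicativity and cancel one factor
  \<open>operator_norm M\<close>. Used for \<open>M\<close> and its adjoint, this gives the
  C*-identity.\<close>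

lemma operator_norm_adjoint_le:
  assumes M: "M \<in> carrier_mat n m"
  shows "operator_norm M \<le> operator_norm (mat_adjoint M)"
proof (cases "operator_norm M = 0")
  case False
  then have "0 < operator_norm M" using operator_norm_nonneg[OF M] by simp
  moreover have "operator_norm M * operator_norm M \<le> operator_norm (mat_adjoint M) * operator_norm M"
    using order_trans[OF operator_norm_square_le[OF M] operator_norm_mult_le[OF mat_adjoint_carrier[OF M] M]]
    by (simp add: power2_eq_square)
  ultimately show ?thesis by simp
qed (use operator_norm_nonneg[OF mat_adjoint_carrier[OF M]] in simp)

lemma operator_norm_cstar:
  assumes M: "M \<in> carrier_mat n m"
  shows "operator_norm (mat_adjoint M * M) = (operator_norm M)\<^sup>2"
proof (rule antisym[OF _ operator_norm_square_le[OF M]])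
  have "operator_norm (mat_adjoint M) \<le> operator_norm M"
    using operator_norm_adjoint_le[OF mat_adjoint_carrier[OF M]] by simp
  then have "operator_norm (mat_adjoint M) * operator_norm M \<le> operator_norm M * operator_norm M"
    by (rule mult_right_mono[OF _ operator_norm_nonneg[OF M]])
  then show "operator_norm (mat_adjoint M * M) \<le> (operator_norm M)\<^sup>2"
    using operator_norm_mult_le[OF mat_adjoint_carrier[OF M] M] by (simp add: power2_eq_square)
qed

lemma unitary_mat_isometry:
  assumes "unitary_mat n U"
  shows "isometry_mat n n U" "isometry_mat n n (mat_adjoint U)"
  using assms by (auto simp: unitary_mat_def isometry_mat_def)

lemma isometry_operator_norm_le:
  assumes "isometry_mat n c W" shows "operator_norm W \<le> 1"
  by (rule operator_norm_leI[of W n c]) (use assms isometry_l2_norm[OF assms] in \<open>auto simp: isometry_mat_def\<close>)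

lemma operator_norm_unitary_conj:
  assumes U: "unitary_mat n U" and M: "M \<in> carrier_mat n n"
  shows "operator_norm (U * M * mat_adjoint U) = operator_norm M"
proof -
  have le: "operator_norm (U * M * mat_adjoint U) \<le> operator_norm M"
    if U: "unitary_mat n U" and M: "M \<in> carrier_mat n n" for U M
  proof -
    have Uc: "U \<in> carrier_mat n n" using U by (simp add: unitary_mat_def)
    note Ua = mat_adjoint_carrier[OF Uc]
    have "operator_norm (U * M * mat_adjoint U) \<le> operator_norm (U * M) * operator_norm (mat_adjoint U)"
      by (rule operator_norm_mult_le[OF mult_carrier_mat[OF Uc M] Ua])
    also have "\<dots> \<le> operator_norm (U * M) * 1"
      by (rule mult_left_mono[OF isometry_operator_norm_le[OF unitary_mat_isometry(2)[OF U]]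
            operator_norm_nonneg[OF mult_carrier_mat[OF Uc M]]])
    also have "\<dots> \<le> operator_norm U * operator_norm M"
      using operator_norm_mult_le[OF Uc M] by simp
    also have "\<dots> \<le> 1 * operator_norm M"
      by (rule mult_right_mono[OF isometry_operator_norm_le[OF unitary_mat_isometry(1)[OF U]]
            operator_norm_nonneg[OF M]])
    finally show ?thesis by simp
  qed
  have Uc: "U \<in> carrier_mat n n" "mat_adjoint U * U = 1\<^sub>m n" "U * mat_adjoint U = 1\<^sub>m n"
    using U by (auto simp: unitary_mat_def)
  have Ua: "unitary_mat n (mat_adjoint U)" using Uc by (simp add: unitary_mat_def)
  have "mat_adjoint U * (U * M * mat_adjoint U) * mat_adjoint (mat_adjoint U)
      = (mat_adjoint U * U) * M * (mat_adjoint U * U)"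
    using Uc(1) M by (simp add: mat_assoc carrier_matD[OF Uc(1)] carrier_matD[OF M])
  then have "mat_adjoint U * (U * M * mat_adjoint U) * mat_adjoint (mat_adjoint U) = M"
    using M by (simp add: Uc(2))
  then have "operator_norm M \<le> operator_norm (U * M * mat_adjoint U)"
    using le[OF Ua mult_carrier_mat[OF mult_carrier_mat[OF Uc(1) M] mat_adjoint_carrier[OF Uc(1)]]]
    by simp
  then show ?thesis using le[OF U M] by simp
qed

section \<open>Homomorphisms of full matrix algebras\<close>

lemma unit_matrix_mult:
  assumes "j < p" "k < p"
  shows "unit_matrix p p i j * unit_matrix p p k l = (if j = k then unit_matrix p p i l else 0\<^sub>m p p)"
proof (rule eq_matI)
  fix a b assume "a < dim_row (if j = k then unit_matrix p p i l else 0\<^sub>m p p)"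
    "b < dim_col (if j = k then unit_matrix p p i l else 0\<^sub>m p p)"
  then have ab: "a < p" "b < p" by (auto split: if_splits)
  have "(unit_matrix p p i j * unit_matrix p p k l) $$ (a, b)
      = (\<Sum>c<p. unit_matrix p p i j $$ (a, c) * unit_matrix p p k l $$ (c, b))"
    using ab by (intro mult_mat_entry) auto
  also have "\<dots> = (\<Sum>c<p. if c = j then of_bool (a = i \<and> j = k \<and> b = l) else 0)"
    using ab by (intro sum.cong) auto
  also have "\<dots> = of_bool (a = i \<and> j = k \<and> b = l)" using assms by simp
  finally show "(unit_matrix p p i j * unit_matrix p p k l) $$ (a, b)
      = (if j = k then unit_matrix p p i l else 0\<^sub>m p p) $$ (a, b)"
    using ab by auto
qed auto

lemma unit_matrix_adjoint: "mat_adjoint (unit_matrix p q i j) = unit_matrix q p j i"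
  by (rule eq_matI) auto

lemma mult_unit_matrix_entry:
  assumes x: "x \<in> carrier_mat p p" and ab: "a < p" "b < p" and i: "i < p"
  shows "(x * unit_matrix p p i j) $$ (a, b) = (if b = j then x $$ (a, i) else 0)"
proof -
  have "(x * unit_matrix p p i j) $$ (a, b) = (\<Sum>c<p. x $$ (a, c) * unit_matrix p p i j $$ (c, b))"
    using x ab by (intro mult_mat_entry) auto
  also have "\<dots> = (\<Sum>c<p. if c = i then (if b = j then x $$ (a, i) else 0) else 0)"
    using ab by (intro sum.cong) auto
  finally show ?thesis using i by simp
qed

text \<open>Index i lies in copy \<open>i div p\<close> at position \<open>i mod p\<close>. The
  closed form replaces the recursion over the list of blocks in entry computations.\<close>

lemma diag_block_replicate:
  fixes x :: "complex mat"
  assumes x: "x \<in> carrier_mat p p"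
  shows "diag_block_mat (replicate c x @ [0\<^sub>m r r]) = mat (c * p + r) (c * p + r)
    (\<lambda>(i, j). if i < c * p \<and> j < c * p \<and> i div p = j div p then x $$ (i mod p, j mod p) else 0)"
proof (induction c)
  case 0
  show ?case by (intro eq_matI) auto
next
  case (Suc c)
  have div: "(i - p) div p = i div p - 1" "(i - p) mod p = i mod p" "1 \<le> i div p"
    if "p \<le> i" "0 < p" for i
  proof -
    obtain k where "i = k + p" using \<open>p \<le> i\<close> le_Suc_ex by (metis add.commute)
    then show "(i - p) div p = i div p - 1" "(i - p) mod p = i mod p" "1 \<le> i div p"
      using \<open>0 < p\<close> by auto
  qed
  let ?D = "mat (c * p + r) (c * p + r)
    (\<lambda>(i, j). if i < c * p \<and> j < c * p \<and> i div p = j div p then x $$ (i mod p, j mod p) else 0)"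
  have "diag_block_mat (replicate (Suc c) x @ [0\<^sub>m r r])
      = four_block_mat x (0\<^sub>m p (c * p + r)) (0\<^sub>m (c * p + r) p) ?D"
    using Suc x by (simp add: Let_def)
  also have "\<dots> = mat (Suc c * p + r) (Suc c * p + r)
    (\<lambda>(i, j). if i < Suc c * p \<and> j < Suc c * p \<and> i div p = j div p then x $$ (i mod p, j mod p) else 0)"
    (is "_ = ?R")
  proof (rule eq_matI)
    fix i j assume "i < dim_row ?R" "j < dim_col ?R"
    then have ij: "i < p + (c * p + r)" "j < p + (c * p + r)" by auto
    show "four_block_mat x (0\<^sub>m p (c * p + r)) (0\<^sub>m (c * p + r) p) ?D $$ (i, j) = ?R $$ (i, j)"
    \<comment> \<open>For \<open>p = 0\<close> quotients carry no information, but then no index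
      lies below a multiple of \<open>p\<close> and both sides are zero matrices.\<close>
    proof (cases "p = 0")
      case True
      then show ?thesis using ij x by auto
    next
      case False
      consider "i < p" "j < p" | "i < p" "p \<le> j" | "p \<le> i" "j < p" | "p \<le> i" "p \<le> j" by linarith
      then show ?thesis
      proof cases
        case 1
        then show ?thesis using ij x by auto
      next
        case 2
        then have "i div p \<noteq> j div p" using div(3)[of j] False by auto
        then show ?thesis using 2 ij x by auto
      next
        case 3
        then have "i div p \<noteq> j div p" using div(3)[of i] False by auto
        then show ?thesis using 3 ij x by auto
      next
        case 4
        have "i - p < c * p \<longleftrightarrow> i < p + c * p" "j - p < c * p \<longleftrightarrow> j < p + c * p" using 4 by auto
        moreover have "(i - p) div p = (j - p) div p \<longleftrightarrow> i div p = j div p"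
          using div[of i] div[of j] 4 False by auto
        ultimately show ?thesis using 4 ij x div(2)[of i] div(2)[of j] False by auto
      qed
    qed
  qed (use x in auto)
  finally show ?case .
qed

section \<open>The multiplicity of a homomorphism\<close>

lemma star_hom_matD:
  assumes f: "star_hom (matrix_algebra p) (matrix_algebra q) f"
  shows star_hom_mat_carrier: "x \<in> carrier_mat p p \<Longrightarrow> f x \<in> carrier_mat q q"
    and star_hom_mat_add: "x \<in> carrier_mat p p \<Longrightarrow> y \<in> carrier_mat p p \<Longrightarrow> f (x + y) = f x + f y"
    and star_hom_mat_mult: "x \<in> carrier_mat p p \<Longrightarrow> y \<in> carrier_mat p p \<Longrightarrow> f (x * y) = f x * f y"
    and star_hom_mat_smult: "x \<in> carrier_mat p p \<Longrightarrow> f (c \<cdot>\<^sub>m x) = c \<cdot>\<^sub>m f x"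
    and star_hom_mat_adjoint: "x \<in> carrier_mat p p \<Longrightarrow> f (mat_adjoint x) = mat_adjoint (f x)"
  using f by (auto simp: star_hom_def matrix_algebra_def)

lemma star_hom_mat_zero:
  assumes f: "star_hom (matrix_algebra p) (matrix_algebra q) f"
  shows "f (0\<^sub>m p p) = 0\<^sub>m q q"
proof -
  have "f (0 \<cdot>\<^sub>m 0\<^sub>m p p) = 0 \<cdot>\<^sub>m f (0\<^sub>m p p)" by (rule star_hom_mat_smult[OF f]) simp
  moreover have "0 \<cdot>\<^sub>m f (0\<^sub>m p p) = 0\<^sub>m q q"
    using star_hom_mat_carrier[OF f, of "0\<^sub>m p p"] by (intro eq_matI) auto
  ultimately show ?thesis by simp
qed

text \<open>The columns of the unitary are the images under \<open>f (unit_matrix p p i 0)\<close>, \<open>i < p\<close>, of an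
  orthonormal basis of the range of \<open>f (unit_matrix p p 0 0)\<close>, followed by an orthonormal basis of
  the range of \<open>1 - f 1\<close>.\<close>

theorem star_hom_has_multiplicity:
  assumes f: "star_hom (matrix_algebra p) (matrix_algebra q) f" and p: "0 < p"
  shows "\<exists>c. has_multiplicity p q f c"
proof -
  let ?E = "unit_matrix p p"
  note fc = star_hom_mat_carrier[OF f] and fm = star_hom_mat_mult[OF f]
    and fa = star_hom_mat_adjoint[OF f]
  \<comment> \<open>For \<open>i < p\<close> these are partial isometries from the range of
    \<open>P\<close> onto the ranges of the \<open>f (?E i i)\<close>, so \<open>F i * W\<close> is
    an orthonormal basis of the latter.\<close>
  define F where "F i = f (?E i 0)" for i
  have Fc: "F i \<in> carrier_mat q q" for i by (simp add: F_def fc)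
  define P where "P = f (?E 0 0)"
  have Pc: "P \<in> carrier_mat q q" by (simp add: P_def fc)
  have "projection_mat q P"
    using fm[of "?E 0 0" "?E 0 0"] fa[of "?E 0 0"] p Pc
    by (simp add: projection_mat_def P_def unit_matrix_mult unit_matrix_adjoint)
  then obtain c W where W: "isometry_mat q c W" and WP: "W * mat_adjoint W = P"
    by (rule projection_isometry)
  have Wc: "W \<in> carrier_mat q c" and WW: "mat_adjoint W * W = 1\<^sub>m c"
    using W by (auto simp: isometry_mat_def)
  have PW: "P * W = W"
    using WW Wc by (simp add: WP[symmetric] mat_assoc carrier_matD[OF Wc])
  have trP: "mat_tr P = of_nat c" using isometry_projection(2)[OF W] WP by simp
  define f1 where "f1 = f (1\<^sub>m p)"
  have f1c: "f1 \<in> carrier_mat q q" by (simp add: f1_def fc)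
  have f1: "f1 * f x = f x" "f x * f1 = f x" if "x \<in> carrier_mat p p" for x
    using fm[of "1\<^sub>m p" x] fm[of x "1\<^sub>m p"] that by (auto simp: f1_def)
  have proj1: "projection_mat q f1"
    using f1(1)[of "1\<^sub>m p"] fa[of "1\<^sub>m p"] f1c by (simp add: projection_mat_def f1_def)
  from projection_isometry[OF projection_mat_complement[OF this]]
  obtain c' V where V: "isometry_mat q c' V" and VP: "V * mat_adjoint V = 1\<^sub>m q - f1" by blast
  have Vc: "V \<in> carrier_mat q c'" and VV: "mat_adjoint V * V = 1\<^sub>m c'"
    using V by (auto simp: isometry_mat_def)
  have "f1 * (1\<^sub>m q - f1) = f1 * 1\<^sub>m q - f1 * f1"
    using f1c by (intro mult_minus_distrib_mat) auto
  then have "f1 * (V * mat_adjoint V) = 0\<^sub>m q q"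
    using f1c proj1 by (simp add: VP projection_mat_def)
  then have "f1 * (V * mat_adjoint V) * V = 0\<^sub>m q c'" using Vc by simp
  then have f1V: "f1 * V = 0\<^sub>m q c'"
    using VV Vc by (simp add: mat_assoc carrier_matD[OF Vc] carrier_matD[OF f1c])
  have fV: "f x * V = 0\<^sub>m q c'" if x: "x \<in> carrier_mat p p" for x
  proof -
    have "f x * V = f x * f1 * V" using f1(2)[OF x] by simp
    also have "\<dots> = f x * (f1 * V)" using fc[OF x] f1c Vc by (simp add: mat_assoc)
    finally show ?thesis using f1V fc[OF x] by simp
  qed
  have Fadj: "mat_adjoint (F i) * F j = (if i = j then P else 0\<^sub>m q q)" if "i < p" "j < p" for i j
    using fm[of "?E 0 i" "?E j 0"] fa[of "?E i 0"] that star_hom_mat_zero[OF f]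
    by (auto simp: F_def P_def unit_matrix_adjoint unit_matrix_mult)
  have FW: "mat_adjoint (F i * W) * (F j * W) = (if i = j then 1\<^sub>m c else 0\<^sub>m c c)"
    if "i < p" "j < p" for i j
  proof -
    have "mat_adjoint (F i * W) * (F j * W) = mat_adjoint W * ((mat_adjoint (F i) * F j) * W)"
      by (simp add: mat_adjoint_mult[OF Fc Wc] mat_assoc carrier_matD[OF Fc] carrier_matD[OF Wc])
    then show ?thesis using Wc by (simp add: Fadj[OF that] PW WW)
  qed
  have FV: "mat_adjoint (F i * W) * V = 0\<^sub>m c c'" if "i < p" for i
  proof -
    have "mat_adjoint (F i * W) * V = mat_adjoint W * (mat_adjoint (F i) * V)"
      by (simp add: mat_adjoint_mult[OF Fc Wc] mat_assoc carrier_matD[OF Fc] carrier_matD[OF Wc]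
          carrier_matD[OF Vc])
    moreover have "mat_adjoint (F i) * V = 0\<^sub>m q c'"
      using fV[of "?E 0 i"] fa[of "?E i 0"] by (simp add: F_def unit_matrix_adjoint)
    ultimately show ?thesis using Wc by simp
  qed
  have VF: "mat_adjoint V * (F i * W) = 0\<^sub>m c' c" if "i < p" for i
    using arg_cong[OF FV[OF that], of mat_adjoint]
      mat_adjoint_mult[OF mat_adjoint_carrier[OF mult_carrier_mat[OF Fc Wc]] Vc]
    by simp
  have trE: "mat_tr (f (?E i i)) = of_nat c" if "i < p" for i
  proof -
    have "mat_tr (f (?E i i)) = mat_tr (F i * mat_adjoint (F i))"
      using fm[of "?E i 0" "?E 0 i"] fa[of "?E i 0"] p that
      by (simp add: F_def unit_matrix_adjoint unit_matrix_mult)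
    also have "\<dots> = mat_tr (mat_adjoint (F i) * F i)"
      by (rule mat_tr_mult_commute) (auto simp: Fc)
    finally show ?thesis using Fadj[OF that that] trP by simp
  qed
  have tr_add: "mat_tr (x + y) = mat_tr x + mat_tr y" if "x \<in> carrier_mat q q" "y \<in> carrier_mat q q" for x y
    using that by (simp add: mat_tr_def sum.distrib)
  have tr_smult: "mat_tr (a \<cdot>\<^sub>m x) = a * mat_tr x" if "x \<in> carrier_mat q q" for a x
    using that by (simp add: mat_tr_def sum_distrib_left)
  \<comment> \<open>All \<open>f (?E i i)\<close> have trace \<open>c\<close>, so the image of the
    unit has trace \<open>p * c\<close>. The complement then has dimension \<open>q - p * c\<close>,
    which makes the matrix \<open>U\<close> below square.\<close>
  have "mat_tr f1 = (\<Sum>i<p. \<Sum>j<p. 1\<^sub>m p $$ (i, j) * mat_tr (f (?E i j)))"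
    unfolding f1_def
    by (rule mat_linear_expand[of p p "\<lambda>x. mat_tr (f x)"])
      (simp_all add: star_hom_mat_add[OF f] star_hom_mat_smult[OF f] tr_add tr_smult fc)
  also have "\<dots> = (\<Sum>i<p. \<Sum>j<p. if j = i then mat_tr (f (?E i i)) else 0)"
    by (intro sum.cong refl) auto
  also have "\<dots> = of_nat (p * c)" by (simp add: trE)
  finally have tr1: "mat_tr f1 = of_nat (p * c)" .
  have "(of_nat c' :: complex) = of_nat q - of_nat (p * c)"
    using isometry_projection(2)[OF V] f1c by (simp add: VP mat_tr_minus[of _ q] tr1)
  then have "(of_nat (c * p + c') :: complex) = of_nat q" by (simp add: mult.commute)
  then have q: "q = c * p + c'" using of_nat_eq_iff by metis
  \<comment> \<open>Column \<open>t < c * p\<close> is basis vector \<open>t div p\<close> moved by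
    \<open>F (t mod p)\<close>. This order puts the \<open>p\<close> images of one basis vector next
    to each other, as one diagonal copy of \<open>x\<close> requires.\<close>
  define U where "U = mat q q (\<lambda>(a, t). if t < c * p then (F (t mod p) * W) $$ (a, t div p) else V $$ (a, t - c * p))"
  have Uc: "U \<in> carrier_mat q q" by (simp add: U_def)
  have tdiv: "t div p < c" if "t < c * p" for t using that by (simp add: less_mult_imp_div_less)
  have tmod: "t mod p < p" for t using p by simp
  have FWc: "F i * W \<in> carrier_mat q c" for i by (rule mult_carrier_mat[OF Fc Wc])
  have Ue: "U $$ (a, t) = (if t < c * p then (F (t mod p) * W) $$ (a, t div p) else V $$ (a, t - c * p))"
    if "a < q" "t < q" for a t using that by (simp add: U_def)
  have inner: "(\<Sum>a<q. cnj (A $$ (a, s)) * B $$ (a, t)) = (mat_adjoint A * B) $$ (s, t)"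
    if "A \<in> carrier_mat q k" "B \<in> carrier_mat q l" "s < k" "t < l" for A B k l s t
  proof -
    have "(mat_adjoint A * B) $$ (s, t) = (\<Sum>a<q. mat_adjoint A $$ (s, a) * B $$ (a, t))"
      using that by (intro mult_mat_entry) auto
    then show ?thesis using that by simp
  qed
  have UU: "mat_adjoint U * U = 1\<^sub>m q"
  proof (rule eq_matI)
    fix s t assume "s < dim_row (1\<^sub>m q :: complex mat)" "t < dim_col (1\<^sub>m q :: complex mat)"
    then have st: "s < q" "t < q" by auto
    have "(mat_adjoint U * U) $$ (s, t) = (\<Sum>a<q. cnj (U $$ (a, s)) * U $$ (a, t))"
      using inner[OF Uc Uc st] by simp
    also have "\<dots> = of_bool (s = t)"
    proof -
      consider "s < c * p" "t < c * p" | "s < c * p" "\<not> t < c * p" | "\<not> s < c * p" "t < c * p"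
        | "\<not> s < c * p" "\<not> t < c * p" by blast
      then show ?thesis
      proof cases
        case 1
        then have "(\<Sum>a<q. cnj (U $$ (a, s)) * U $$ (a, t))
            = (mat_adjoint (F (s mod p) * W) * (F (t mod p) * W)) $$ (s div p, t div p)"
          using st by (subst inner[OF FWc FWc tdiv tdiv, symmetric]) (auto simp: Ue intro!: sum.cong)
        also have "\<dots> = of_bool (s mod p = t mod p \<and> s div p = t div p)"
          using 1 tdiv by (simp add: FW[OF tmod tmod])
        also have "s mod p = t mod p \<and> s div p = t div p \<longleftrightarrow> s = t"
          by (metis div_mult_mod_eq)
        finally show ?thesis .
      next
        case 2
        then have "(\<Sum>a<q. cnj (U $$ (a, s)) * U $$ (a, t))
            = (mat_adjoint (F (s mod p) * W) * V) $$ (s div p, t - c * p)"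
          using st q by (subst inner[OF FWc Vc tdiv, symmetric]) (auto simp: Ue intro!: sum.cong)
        then show ?thesis using 2 st q tdiv by (auto simp: FV[OF tmod])
      next
        case 3
        then have "(\<Sum>a<q. cnj (U $$ (a, s)) * U $$ (a, t))
            = (mat_adjoint V * (F (t mod p) * W)) $$ (s - c * p, t div p)"
          using st q by (subst inner[OF Vc FWc _ tdiv, symmetric]) (auto simp: Ue intro!: sum.cong)
        then show ?thesis using 3 st q tdiv by (auto simp: VF[OF tmod])
      next
        case 4
        then have "(\<Sum>a<q. cnj (U $$ (a, s)) * U $$ (a, t))
            = (mat_adjoint V * V) $$ (s - c * p, t - c * p)"
          using st q by (subst inner[OF Vc Vc, symmetric]) (auto simp: Ue intro!: sum.cong)
        then show ?thesis using 4 st q by (auto simp: VV)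
      qed
    qed
    finally show "(mat_adjoint U * U) $$ (s, t) = 1\<^sub>m q $$ (s, t)" using st by auto
  qed (use Uc in auto)
  have UU': "U * mat_adjoint U = 1\<^sub>m q"
    by (rule mat_mult_left_right_inverse[OF _ _ UU]) (use Uc in auto)
  have unitary: "unitary_mat q U" using Uc UU UU' by (simp add: unitary_mat_def)
  have "f x = U * diag_block_mat (replicate c x @ [0\<^sub>m (q - c * p) (q - c * p)]) * mat_adjoint U"
    if x: "x \<in> carrier_mat p p" for x
  proof -
    define D where "D = diag_block_mat (replicate c x @ [0\<^sub>m c' c'])"
    have D: "D = mat q q (\<lambda>(i, j). if i < c * p \<and> j < c * p \<and> i div p = j div p then x $$ (i mod p, j mod p) else 0)"
      unfolding D_def diag_block_replicate[OF x] q ..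
    then have Dc: "D \<in> carrier_mat q q" by simp
    have "f x * U = U * D"
    proof (rule eq_matI)
      fix a t assume "a < dim_row (U * D)" "t < dim_col (U * D)"
      then have at: "a < q" "t < q" using Uc Dc by auto
      have L: "(f x * U) $$ (a, t) = (\<Sum>b<q. f x $$ (a, b) * U $$ (b, t))"
        by (rule mult_mat_entry[OF fc[OF x] Uc at])
      have R: "(U * D) $$ (a, t) = (\<Sum>s<q. U $$ (a, s) * D $$ (s, t))"
        by (rule mult_mat_entry[OF Uc Dc at])
      show "(f x * U) $$ (a, t) = (U * D) $$ (a, t)"
      proof (cases "t < c * p")
        case True
        let ?s = "t div p" and ?i = "t mod p"
        have "(f x * U) $$ (a, t) = (f x * (F ?i * W)) $$ (a, ?s)"
          unfolding L mult_mat_entry[OF fc[OF x] FWc at(1) tdiv[OF True]]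
          using True at by (intro sum.cong) (auto simp: Ue)
        \<comment> \<open>Multiplying \<open>x\<close> by this matrix unit puts column
          \<open>?i\<close> of \<open>x\<close> into column 0. Hence \<open>f x\<close> sends column
          t of \<open>U\<close> to a combination of the columns with the same quotient
          \<open>t div p\<close>, just as \<open>D\<close> prescribes.\<close>
        also have "f x * (F ?i * W) = f (x * ?E ?i 0) * W"
          using fm[OF x, of "?E ?i 0"] fc[OF x] Fc Wc by (simp add: F_def mat_assoc carrier_matD[OF Fc[unfolded F_def]])
        also have "(f (x * ?E ?i 0) * W) $$ (a, ?s)
            = (\<Sum>k<p. \<Sum>l<p. (x * ?E ?i 0) $$ (k, l) * (f (?E k l) * W) $$ (a, ?s))"
        proof (rule mat_linear_expand[of p p "\<lambda>y. (f y * W) $$ (a, ?s)"])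
          fix y z :: "complex mat" assume yz: "y \<in> carrier_mat p p" "z \<in> carrier_mat p p"
          show "(f (y + z) * W) $$ (a, ?s) = (f y * W) $$ (a, ?s) + (f z * W) $$ (a, ?s)"
            using star_hom_mat_add[OF f yz] add_mult_distrib_mat[OF fc[OF yz(1)] fc[OF yz(2)] Wc]
              at tdiv[OF True] fc[OF yz(1)] fc[OF yz(2)] Wc by (simp del: index_mult_mat(1))
        next
          fix b and y :: "complex mat" assume y: "y \<in> carrier_mat p p"
          show "(f (b \<cdot>\<^sub>m y) * W) $$ (a, ?s) = b * (f y * W) $$ (a, ?s)"
            using star_hom_mat_smult[OF f y] mult_smult_assoc_mat[OF fc[OF y] Wc]
              at tdiv[OF True] fc[OF y] Wc by (simp del: index_mult_mat(1))
        qed (rule mult_carrier_mat[OF x unit_matrix_carrier])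
        also have "\<dots> = (\<Sum>k<p. \<Sum>l<p. if l = 0 then x $$ (k, ?i) * (F k * W) $$ (a, ?s) else 0)"
          using mult_unit_matrix_entry[OF x _ _ tmod]
          by (intro sum.cong refl) (auto simp: F_def simp del: index_mult_mat(1))
        also have "\<dots> = (\<Sum>k<p. x $$ (k, ?i) * (F k * W) $$ (a, ?s))"
          using p by simp
        finally have 1: "(f x * U) $$ (a, t) = (\<Sum>k<p. x $$ (k, ?i) * (F k * W) $$ (a, ?s))" .
        have lt: "?s * p + k < c * p" if "k < p" for k
        proof -
          have "?s * p + k < Suc ?s * p" using that by simp
          also have "\<dots> \<le> c * p" using tdiv[OF True] by (intro mult_right_mono) auto
          finally show ?thesis .
        qed
        have "(U * D) $$ (a, t) = (\<Sum>s\<in>(\<lambda>k. ?s * p + k) ` {..<p}. U $$ (a, s) * D $$ (s, t))"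
          unfolding R
        proof (rule sum.mono_neutral_right)
          show "(\<lambda>k. ?s * p + k) ` {..<p} \<subseteq> {..<q}" using lt q by fastforce
          show "\<forall>s\<in>{..<q} - (\<lambda>k. ?s * p + k) ` {..<p}. U $$ (a, s) * D $$ (s, t) = 0"
          proof
            fix s assume s: "s \<in> {..<q} - (\<lambda>k. ?s * p + k) ` {..<p}"
            have "s div p \<noteq> ?s"
            proof
              assume eq: "s div p = ?s"
              have "s = s div p * p + s mod p" by simp
              then have "s = ?s * p + s mod p" using eq by simp
              then have "s \<in> (\<lambda>k. ?s * p + k) ` {..<p}" using tmod[of s] by blast
              then show False using s by simp
            qed
            then show "U $$ (a, s) * D $$ (s, t) = 0" using s at by (simp add: D)
          qed
        qed simp
        also have "\<dots> = (\<Sum>k<p. U $$ (a, ?s * p + k) * D $$ (?s * p + k, t))"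
          by (subst sum.reindex) (auto simp: inj_on_def)
        also have "\<dots> = (\<Sum>k<p. x $$ (k, ?i) * (F k * W) $$ (a, ?s))"
        proof (intro sum.cong refl)
          fix k assume "k \<in> {..<p}"
          then have k: "k < p" by simp
          have kq: "?s * p + k < q" using lt[OF k] q by simp
          show "U $$ (a, ?s * p + k) * D $$ (?s * p + k, t) = x $$ (k, ?i) * (F k * W) $$ (a, ?s)"
            using Ue[OF at(1) kq] lt[OF k] k kq at True by (simp add: D)
        qed
        finally show ?thesis using 1 by simp
      next
        case False
        then have tc: "t - c * p < c'" using at q by simp
        have "(f x * U) $$ (a, t) = (f x * V) $$ (a, t - c * p)"
          unfolding L mult_mat_entry[OF fc[OF x] Vc at(1) tc]
          using False at by (intro sum.cong) (auto simp: Ue)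
        then have "(f x * U) $$ (a, t) = 0" using fV[OF x] at tc by simp
        moreover have "(U * D) $$ (a, t) = 0" unfolding R using at False by (intro sum.neutral) (simp add: D)
        ultimately show ?thesis by simp
      qed
    qed (use fc[OF x] Uc Dc in auto)
    then have "f x * U * mat_adjoint U = U * D * mat_adjoint U" by simp
    moreover have "f x * U * mat_adjoint U = f x"
      using fc[OF x] Uc UU' by (simp add: mat_assoc)
    ultimately show ?thesis using q by (simp add: D_def)
  qed
  then have "has_multiplicity p q f c"
    unfolding has_multiplicity_def using unitary q by auto
  then show ?thesis ..
qed

section \<open>Irreducible representations of *-subalgebras\<close>

definition star_subalgebra :: "'a::cstar_algebra set \<Rightarrow> bool" where
  "star_subalgebra B \<longleftrightarrow> complex_vector.subspace B \<and>
     (\<forall>x\<in>B. \<forall>y\<in>B. x * y \<in> B) \<and> (\<forall>x\<in>B. star x \<in> B)"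

definition subalgebra_on :: "'a::cstar_algebra set \<Rightarrow> 'a star_algebra" where
  "subalgebra_on B = whole_algebra\<lparr>elems := B\<rparr>"

lemma subalgebra_on_UNIV: "subalgebra_on UNIV = whole_algebra"
  by (simp add: subalgebra_on_def whole_algebra_def)

definition rep_on :: "'a::cstar_algebra set \<Rightarrow> nat \<Rightarrow> ('a \<Rightarrow> complex mat) \<Rightarrow> bool" where
  "rep_on B d \<pi> \<longleftrightarrow> star_hom (subalgebra_on B) (matrix_algebra d) \<pi>"

text \<open>By Burnside's theorem surjectivity is the same as irreducibility. The condition
  \<open>0 < d\<close> excludes the representation on the zero space, which is onto as well.\<close>

definition irrep_on :: "'a::cstar_algebra set \<Rightarrow> nat \<Rightarrow> ('a \<Rightarrow> complex mat) \<Rightarrow> bool" where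
  "irrep_on B d \<pi> \<longleftrightarrow> rep_on B d \<pi> \<and> 0 < d \<and> \<pi> ` B = carrier_mat d d"

lemma rep_on_iff:
  "rep_on B d \<pi> \<longleftrightarrow> (\<forall>x\<in>B. \<pi> x \<in> carrier_mat d d) \<and>
    (\<forall>x\<in>B. \<forall>y\<in>B. \<pi> (x + y) = \<pi> x + \<pi> y) \<and> (\<forall>x\<in>B. \<forall>y\<in>B. \<pi> (x * y) = \<pi> x * \<pi> y) \<and>
    (\<forall>c. \<forall>x\<in>B. \<pi> (c *\<^sub>C x) = c \<cdot>\<^sub>m \<pi> x) \<and> (\<forall>x\<in>B. \<pi> (star x) = mat_adjoint (\<pi> x))"
  by (simp add: rep_on_def star_hom_def subalgebra_on_def whole_algebra_def matrix_algebra_def)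

lemma rep_onD:
  assumes "rep_on B d \<pi>"
  shows rep_carrier: "x \<in> B \<Longrightarrow> \<pi> x \<in> carrier_mat d d"
    and rep_add: "x \<in> B \<Longrightarrow> y \<in> B \<Longrightarrow> \<pi> (x + y) = \<pi> x + \<pi> y"
    and rep_mult: "x \<in> B \<Longrightarrow> y \<in> B \<Longrightarrow> \<pi> (x * y) = \<pi> x * \<pi> y"
    and rep_scale: "x \<in> B \<Longrightarrow> \<pi> (c *\<^sub>C x) = c \<cdot>\<^sub>m \<pi> x"
    and rep_star: "x \<in> B \<Longrightarrow> \<pi> (star x) = mat_adjoint (\<pi> x)"
  using assms by (auto simp: rep_on_iff)

lemma rep_on_subset: "rep_on B d \<pi> \<Longrightarrow> C \<subseteq> B \<Longrightarrow> rep_on C d \<pi>"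
  by (auto simp: rep_on_iff subset_iff)

lemma star_subalgebraD:
  assumes "star_subalgebra B"
  shows star_subalgebra_subspace: "complex_vector.subspace B"
    and star_subalgebra_zero: "0 \<in> B"
    and star_subalgebra_add: "x \<in> B \<Longrightarrow> y \<in> B \<Longrightarrow> x + y \<in> B"
    and star_subalgebra_diff: "x \<in> B \<Longrightarrow> y \<in> B \<Longrightarrow> x - y \<in> B"
    and star_subalgebra_scale: "x \<in> B \<Longrightarrow> c *\<^sub>C x \<in> B"
    and star_subalgebra_mult: "x \<in> B \<Longrightarrow> y \<in> B \<Longrightarrow> x * y \<in> B"
    and star_subalgebra_star: "x \<in> B \<Longrightarrow> star x \<in> B"
  using assms complex_vector.subspace_diff[of B]
  by (auto simp: star_subalgebra_def complex_vector.subspace_def)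

lemma star_subalgebra_UNIV: "star_subalgebra UNIV"
  by (simp add: star_subalgebra_def)

lemma rep_zero:
  assumes "rep_on B d \<pi>" "star_subalgebra B"
  shows "\<pi> 0 = 0\<^sub>m d d"
proof -
  have "\<pi> (0 *\<^sub>C 0) = 0 \<cdot>\<^sub>m \<pi> 0" by (rule rep_scale[OF assms(1) star_subalgebra_zero[OF assms(2)]])
  also have "\<dots> = 0\<^sub>m d d"
    using rep_carrier[OF assms(1) star_subalgebra_zero[OF assms(2)]] by (intro eq_matI) auto
  finally show ?thesis by simp
qed

lemma rep_diff:
  assumes "rep_on B d \<pi>" "star_subalgebra B" "x \<in> B" "y \<in> B"
  shows "\<pi> (x - y) = \<pi> x - \<pi> y"
proof -
  have "\<pi> (x + (-1) *\<^sub>C y) = \<pi> x + (-1) \<cdot>\<^sub>m \<pi> y"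
    using rep_add[OF assms(1,3) star_subalgebra_scale[OF assms(2,4), of "-1"]]
      rep_scale[OF assms(1,4), of "-1"] by (simp del: complex_vector.scale_minus_left)
  also have "\<dots> = \<pi> x - \<pi> y"
    using rep_carrier[OF assms(1)] assms(3,4) by (intro eq_matI) auto
  also have "x + (-1) *\<^sub>C y = x - y" by (metis complex_vector.scale_minus_left complex_vector.scale_one diff_conv_add_uminus)
  finally show ?thesis .
qed

lemma rep_image_star_matrices:
  assumes "rep_on B d \<pi>" "star_subalgebra B"
  shows "star_matrices d (\<pi> ` B)"
  unfolding star_matrices_def
proof (intro conjI ballI allI)
  show "\<pi> ` B \<subseteq> carrier_mat d d" using rep_carrier[OF assms(1)] by auto
next
  fix x y assume "x \<in> \<pi> ` B" "y \<in> \<pi> ` B"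
  then obtain a b where "x = \<pi> a" "y = \<pi> b" and ab: "a \<in> B" "b \<in> B" by blast
  then show "x + y \<in> \<pi> ` B" "x * y \<in> \<pi> ` B"
    using star_subalgebra_add[OF assms(2) ab] star_subalgebra_mult[OF assms(2) ab]
    by (simp_all add: rep_add[OF assms(1) ab, symmetric] rep_mult[OF assms(1) ab, symmetric])
next
  fix c x assume "x \<in> \<pi> ` B"
  then obtain a where "x = \<pi> a" and a: "a \<in> B" by blast
  then show "c \<cdot>\<^sub>m x \<in> \<pi> ` B"
    using star_subalgebra_scale[OF assms(2) a] by (simp add: rep_scale[OF assms(1) a, symmetric])
next
  fix x assume "x \<in> \<pi> ` B"
  then obtain a where "x = \<pi> a" and a: "a \<in> B" by blast
  then show "mat_adjoint x \<in> \<pi> ` B"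
    using star_subalgebra_star[OF assms(2) a] by (simp add: rep_star[OF assms(1) a, symmetric])
qed

text \<open>The range of \<open>W\<close> is invariant, and the compression is the restriction to
  it. Multiplicativity is where commutation with the range projection enters.\<close>

lemma rep_compress:
  assumes \<pi>: "rep_on B d \<pi>" and B: "star_subalgebra B" and W: "isometry_mat d c W"
    and comm: "\<And>x. x \<in> B \<Longrightarrow> \<pi> x * (W * mat_adjoint W) = W * mat_adjoint W * \<pi> x"
  shows "rep_on B c (\<lambda>x. mat_adjoint W * \<pi> x * W)"
  unfolding rep_on_iff
proof (intro conjI ballI allI)
  have Wc: "W \<in> carrier_mat d c" and WW: "mat_adjoint W * W = 1\<^sub>m c"
    using W by (auto simp: isometry_mat_def)
  note Wa = mat_adjoint_carrier[OF Wc]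
  note \<pi>c = rep_carrier[OF \<pi>]
  fix x assume x: "x \<in> B"
  show "mat_adjoint W * \<pi> x * W \<in> carrier_mat c c"
    by (rule mult_carrier_mat[OF mult_carrier_mat[OF Wa \<pi>c[OF x]] Wc])
  show "mat_adjoint W * \<pi> (star x) * W = mat_adjoint (mat_adjoint W * \<pi> x * W)"
    using Wc \<pi>c[OF x] Wa mat_adjoint_mult[OF mult_carrier_mat[OF Wa \<pi>c[OF x]] Wc]
      mat_adjoint_mult[OF Wa \<pi>c[OF x]]
    by (simp add: rep_star[OF \<pi> x] mat_assoc)
  fix c show "mat_adjoint W * \<pi> (c *\<^sub>C x) * W = c \<cdot>\<^sub>m (mat_adjoint W * \<pi> x * W)"
    using mult_smult_distrib[OF Wa \<pi>c[OF x]]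
      mult_smult_assoc_mat[OF mult_carrier_mat[OF Wa \<pi>c[OF x]] Wc]
    by (simp add: rep_scale[OF \<pi> x])
next
  have Wc: "W \<in> carrier_mat d c" and WW: "mat_adjoint W * W = 1\<^sub>m c"
    using W by (auto simp: isometry_mat_def)
  note Wa = mat_adjoint_carrier[OF Wc]
  note \<pi>c = rep_carrier[OF \<pi>]
  fix x y assume xy: "x \<in> B" "y \<in> B"
  show "mat_adjoint W * \<pi> (x + y) * W = mat_adjoint W * \<pi> x * W + mat_adjoint W * \<pi> y * W"
    using mult_add_distrib_mat[OF Wa \<pi>c[OF xy(1)] \<pi>c[OF xy(2)]]
      add_mult_distrib_mat[OF mult_carrier_mat[OF Wa \<pi>c[OF xy(1)]] mult_carrier_mat[OF Wa \<pi>c[OF xy(2)]] Wc]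
    by (simp add: rep_add[OF \<pi> xy])
  have WW': "mat_adjoint W * (W * Z) = Z" if "dim_row Z = c" for Z
    using arg_cong[OF WW, of "\<lambda>M. M * Z"] that by (simp add: mat_assoc carrier_matD[OF Wc])
  have "mat_adjoint W * \<pi> x * W * (mat_adjoint W * \<pi> y * W)
      = mat_adjoint W * (\<pi> x * (W * mat_adjoint W)) * (\<pi> y * W)"
    by (simp add: mat_assoc carrier_matD[OF Wc] carrier_matD[OF \<pi>c[OF xy(1)]] carrier_matD[OF \<pi>c[OF xy(2)]])
  also have "\<dots> = mat_adjoint W * \<pi> (x * y) * W"
    unfolding comm[OF xy(1)] rep_mult[OF \<pi> xy]
    by (simp add: mat_assoc carrier_matD[OF Wc] carrier_matD[OF \<pi>c[OF xy(1)]]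
        carrier_matD[OF \<pi>c[OF xy(2)]] WW')
  finally show "mat_adjoint W * \<pi> (x * y) * W
      = mat_adjoint W * \<pi> x * W * (mat_adjoint W * \<pi> y * W)" ..
qed

lemma isometry_mat_empty: "isometry_mat n 0 W \<Longrightarrow> W * mat_adjoint W = 0\<^sub>m n n"
  by (intro eq_matI) (auto simp: isometry_mat_def scalar_prod_def)

text \<open>Strong induction on the size. A reducible image commutes with a nontrivial projection
  \<open>P\<close>; the compressions to the ranges of \<open>P\<close> and of its complement are
  smaller, and if both killed \<open>x\<close>, so would \<pi>.\<close>

lemma irrep_separates:
  assumes B: "star_subalgebra B" and x: "x \<in> B"
  shows "rep_on B k \<pi> \<Longrightarrow> \<pi> x \<noteq> 0\<^sub>m k k \<Longrightarrow> \<exists>d \<sigma>. irrep_on B d \<sigma> \<and> \<sigma> x \<noteq> 0\<^sub>m d d"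
proof (induction k arbitrary: \<pi> rule: less_induct)
  case (less k)
  note \<pi> = less.prems(1)
  note \<pi>c = rep_carrier[OF \<pi>]
  show ?case
  proof (cases "irreducible_matrices k (\<pi> ` B)")
    case True
    then have "\<pi> ` B = carrier_mat k k"
      using irreducible_star_matrices_full[OF rep_image_star_matrices[OF \<pi> B]] by blast
    moreover have "0 < k"
    proof (rule ccontr)
      assume "\<not> 0 < k"
      then have "\<pi> x = 0\<^sub>m k k" using \<pi>c[OF x] by (intro eq_matI) auto
      then show False using less.prems by simp
    qed
    ultimately show ?thesis using less.prems by (auto simp: irrep_on_def)
  next
    case False
    then obtain P where P: "projection_mat k P" and comm: "\<And>x. x \<in> B \<Longrightarrow> \<pi> x * P = P * \<pi> x"
      and P0: "P \<noteq> 0\<^sub>m k k" and P1: "P \<noteq> 1\<^sub>m k"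
      using less.prems x unfolding irreducible_matrices_def by blast
    have Pc: "P \<in> carrier_mat k k" using P by (simp add: projection_mat_def)
    define R where "R = 1\<^sub>m k - P"
    have Rc: "R \<in> carrier_mat k k" using Pc by (auto simp: R_def intro: minus_carrier_mat)
    have R: "projection_mat k R" unfolding R_def by (rule projection_mat_complement[OF P])
    have commR: "\<pi> x * R = R * \<pi> x" if "x \<in> B" for x
      using comm[OF that] \<pi>c[OF that] Pc mult_minus_distrib_mat[OF \<pi>c[OF that] one_carrier_mat Pc]
        minus_mult_distrib_mat[OF one_carrier_mat Pc \<pi>c[OF that]]
      by (simp add: R_def)
    obtain c W where W: "isometry_mat k c W" and WP: "W * mat_adjoint W = P"
      using projection_isometry[OF P] .
    obtain c' V where V: "isometry_mat k c' V" and VR: "V * mat_adjoint V = R"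
      using projection_isometry[OF R] .
    have "(of_nat c' :: complex) = of_nat k - of_nat c"
      using isometry_projection(2)[OF V] isometry_projection(2)[OF W] Pc
      by (simp add: VR WP) (simp add: R_def mat_tr_minus[of _ k])
    then have "(of_nat (c' + c) :: complex) = of_nat k" by simp
    then have cc: "c' + c = k" using of_nat_eq_iff by metis
    have "c \<noteq> 0" using isometry_mat_empty[of k W] W WP P0 by auto
    moreover have "c' \<noteq> 0"
    proof
      assume "c' = 0"
      then have "R = 0\<^sub>m k k" using isometry_mat_empty[of k V] V VR by auto
      have "P = 1\<^sub>m k"
      proof (rule eq_matI)
        fix i j assume "i < dim_row (1\<^sub>m k :: complex mat)" "j < dim_col (1\<^sub>m k :: complex mat)"
        then show "P $$ (i, j) = 1\<^sub>m k $$ (i, j)"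
          using arg_cong[OF \<open>R = 0\<^sub>m k k\<close>, of "\<lambda>M. M $$ (i, j)"] Pc by (simp add: R_def)
      qed (use Pc in auto)
      then show False using P1 by simp
    qed
    ultimately have lt: "c < k" "c' < k" using cc by auto
    have repW: "rep_on B c (\<lambda>x. mat_adjoint W * \<pi> x * W)"
      by (rule rep_compress[OF \<pi> B W]) (simp add: WP comm)
    have repV: "rep_on B c' (\<lambda>x. mat_adjoint V * \<pi> x * V)"
      by (rule rep_compress[OF \<pi> B V]) (simp add: VR commR)
    have "mat_adjoint W * \<pi> x * W \<noteq> 0\<^sub>m c c \<or> mat_adjoint V * \<pi> x * V \<noteq> 0\<^sub>m c' c'"
    proof (rule ccontr)
      assume "\<not> ?thesis"
      then have 0: "mat_adjoint W * \<pi> x * W = 0\<^sub>m c c" "mat_adjoint V * \<pi> x * V = 0\<^sub>m c' c'" by auto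
      have zero: "Q * \<pi> x = 0\<^sub>m k k"
        if U: "isometry_mat k e U" and UQ: "U * mat_adjoint U = Q" and Q: "projection_mat k Q"
          and cQ: "\<pi> x * Q = Q * \<pi> x" and z: "mat_adjoint U * \<pi> x * U = 0\<^sub>m e e" for Q U e
      proof -
        have Uc: "U \<in> carrier_mat k e" using U by (simp add: isometry_mat_def)
        have Qc: "Q \<in> carrier_mat k k" "Q * Q = Q" using Q by (auto simp: projection_mat_def)
        have "Q * \<pi> x = Q * Q * \<pi> x" using Qc by simp
        also have "\<dots> = Q * \<pi> x * Q"
          using Qc(1) \<pi>c[OF x] by (simp add: mat_assoc cQ carrier_matD[OF Qc(1)] carrier_matD[OF \<pi>c[OF x]])
        also have "\<dots> = U * (mat_adjoint U * \<pi> x * U) * mat_adjoint U"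
          unfolding UQ[symmetric] using Uc \<pi>c[OF x] by (simp add: mat_assoc)
        finally show ?thesis using z Uc by simp
      qed
      have "P * \<pi> x = 0\<^sub>m k k" using zero[OF W WP P comm[OF x] 0(1)] .
      moreover have "R * \<pi> x = 0\<^sub>m k k" using zero[OF V VR R commR[OF x] 0(2)] .
      moreover have "R * \<pi> x = 1\<^sub>m k * \<pi> x - P * \<pi> x"
        unfolding R_def by (rule minus_mult_distrib_mat[OF one_carrier_mat Pc \<pi>c[OF x]])
      moreover have "\<pi> x - 0\<^sub>m k k = \<pi> x" using \<pi>c[OF x] by (intro eq_matI) auto
      ultimately have "\<pi> x = 0\<^sub>m k k" using \<pi>c[OF x] by simp
      then show False using less.prems by simp
    qed
    then show ?thesis using less.IH[OF lt(1) repW] less.IH[OF lt(2) repV] by blast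
  qed
qed

text \<open>A representation of the whole algebra is restricted to \<open>B\<close> before it is
  decomposed. The result is irreducible on \<open>B\<close> and in general does not extend.\<close>

lemma rfd_irrep_separates:
  assumes "residually_finite_dimensional TYPE('a::cstar_algebra)"
    and B: "star_subalgebra (B :: 'a set)" and x: "x \<in> B" "x \<noteq> 0"
  shows "\<exists>d \<sigma>. irrep_on B d \<sigma> \<and> \<sigma> x \<noteq> 0\<^sub>m d d"
proof -
  obtain \<R> :: "(nat \<times> ('a \<Rightarrow> complex mat)) set" where
    R: "(\<forall>(k, \<pi>)\<in>\<R>. star_hom whole_algebra (matrix_algebra k) \<pi>) \<and>
      (\<forall>x y. x \<noteq> y \<longrightarrow> (\<exists>(k, \<pi>)\<in>\<R>. \<pi> x \<noteq> \<pi> y))"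
    using assms(1) unfolding residually_finite_dimensional_def by (rule exE)
  have "\<exists>(k, \<pi>)\<in>\<R>. \<pi> x \<noteq> \<pi> 0" using conjunct2[OF R, rule_format, OF x(2)] .
  then obtain k \<pi> where k: "(k, \<pi>) \<in> \<R>" "\<pi> x \<noteq> \<pi> 0" by auto
  then have \<pi>: "rep_on UNIV k \<pi>" using conjunct1[OF R] by (auto simp: rep_on_def subalgebra_on_UNIV)
  then have "\<pi> x \<noteq> 0\<^sub>m k k" using rep_zero[OF \<pi> star_subalgebra_UNIV] k(2) by simp
  then show ?thesis using irrep_separates[OF B x(1) rep_on_subset[OF \<pi>]] by blast
qed

text \<open>Joint surjectivity onto the product of the matrix algebras, which expresses pairwise
  inequivalence. Lists are used because a position will be the index of a summand.\<close>

definition independent_irreps ::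
  "'a::cstar_algebra set \<Rightarrow> (nat \<times> ('a \<Rightarrow> complex mat)) list \<Rightarrow> bool" where
  "independent_irreps B L \<longleftrightarrow> (\<forall>l<length L. rep_on B (fst (L ! l)) (snd (L ! l)) \<and> 0 < fst (L ! l)) \<and>
     (\<forall>y. (\<forall>l<length L. y l \<in> carrier_mat (fst (L ! l)) (fst (L ! l))) \<longrightarrow>
       (\<exists>b\<in>B. \<forall>l<length L. snd (L ! l) b = y l))"

lemma independent_irreps_Nil: "star_subalgebra B \<Longrightarrow> independent_irreps B []"
  unfolding independent_irreps_def using star_subalgebra_zero by (simp, blast)

text \<open>Isolates a single entry. It is behind the simplicity of matrix algebras, the continuity
  of irreducible representations and the comparison of norms.\<close>

lemma unit_matrix_sandwich:
  assumes X: "X \<in> carrier_mat d d" and "i < d" "s < d" "t < d" "j < d"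
  shows "unit_matrix d d i s * X * unit_matrix d d t j = X $$ (s, t) \<cdot>\<^sub>m unit_matrix d d i j"
proof (rule eq_matI)
  fix a b assume "a < dim_row (X $$ (s, t) \<cdot>\<^sub>m unit_matrix d d i j)"
    "b < dim_col (X $$ (s, t) \<cdot>\<^sub>m unit_matrix d d i j)"
  then have ab: "a < d" "b < d" by auto
  have "(unit_matrix d d i s * X) $$ (a, t) = (\<Sum>c<d. unit_matrix d d i s $$ (a, c) * X $$ (c, t))"
    using X assms ab by (intro mult_mat_entry) auto
  also have "\<dots> = (\<Sum>c<d. if c = s then of_bool (a = i) * X $$ (s, t) else 0)"
    using ab by (intro sum.cong) auto
  also have "\<dots> = of_bool (a = i) * X $$ (s, t)" using assms by simp
  finally have 1: "(unit_matrix d d i s * X) $$ (a, t) = of_bool (a = i) * X $$ (s, t)" .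
  have c: "unit_matrix d d i s * X \<in> carrier_mat d d"
    by (rule mult_carrier_mat[OF unit_matrix_carrier X])
  show "(unit_matrix d d i s * X * unit_matrix d d t j) $$ (a, b)
      = (X $$ (s, t) \<cdot>\<^sub>m unit_matrix d d i j) $$ (a, b)"
    using mult_unit_matrix_entry[OF c ab assms(4), of j] 1 ab by auto
qed (use X in auto)

text \<open>The common kernel \<open>K\<close> of the list is an ideal of \<open>B\<close> that
  contains \<open>x\<close>, so \<pi> maps it onto a nonzero ideal of a full matrix algebra, which
  is everything. The new coordinate can thus be corrected by elements of \<open>K\<close> without
  disturbing the others.\<close>

lemma independent_irreps_extend:
  assumes B: "star_subalgebra B" and L: "independent_irreps B L" and \<pi>: "irrep_on B d \<pi>"
    and x: "x \<in> B" and kill: "\<And>l. l < length L \<Longrightarrow> snd (L ! l) x = 0\<^sub>m (fst (L ! l)) (fst (L ! l))"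
    and x0: "\<pi> x \<noteq> 0\<^sub>m d d"
  shows "independent_irreps B (L @ [(d, \<pi>)])"
proof -
  have rep: "rep_on B d \<pi>" and d: "0 < d" and surj: "\<pi> ` B = carrier_mat d d"
    using \<pi> by (auto simp: irrep_on_def)
  have repL: "rep_on B (fst (L ! l)) (snd (L ! l))" if "l < length L" for l
    using L that by (auto simp: independent_irreps_def)
  note \<pi>c = rep_carrier[OF rep]
  define K where "K = {b\<in>B. \<forall>l<length L. snd (L ! l) b = 0\<^sub>m (fst (L ! l)) (fst (L ! l))}"
  have Kadd: "a + b \<in> K" if "a \<in> K" "b \<in> K" for a b
    using that star_subalgebra_add[OF B] rep_add[OF repL] by (auto simp: K_def)
  have Ksc: "c *\<^sub>C a \<in> K" if "a \<in> K" for a c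
    using that star_subalgebra_scale[OF B] rep_scale[OF repL] by (auto simp: K_def)
  have Kmult: "a * k * b \<in> K" if "a \<in> B" "k \<in> K" "b \<in> B" for a k b
  proof -
    have kB: "k \<in> B" and ak: "a * k \<in> B" and akb: "a * k * b \<in> B"
      using that star_subalgebra_mult[OF B] by (auto simp: K_def)
    have "snd (L ! l) (a * k * b) = 0\<^sub>m (fst (L ! l)) (fst (L ! l))" if l: "l < length L" for l
    proof -
      have "snd (L ! l) (a * k * b) = snd (L ! l) a * snd (L ! l) k * snd (L ! l) b"
        using rep_mult[OF repL[OF l] ak \<open>b \<in> B\<close>] rep_mult[OF repL[OF l] \<open>a \<in> B\<close> kB] by simp
      then show ?thesis
        using \<open>k \<in> K\<close> l rep_carrier[OF repL[OF l] \<open>a \<in> B\<close>] rep_carrier[OF repL[OF l] \<open>b \<in> B\<close>]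
        by (simp add: K_def)
    qed
    then show ?thesis using akb by (simp add: K_def)
  qed
  have zK: "0 \<in> K" using Ksc[of x 0] x kill by (auto simp: K_def)
  have xK: "x \<in> K" using x kill by (auto simp: K_def)
  obtain s t where st: "s < d" "t < d" "\<pi> x $$ (s, t) \<noteq> 0"
  proof (rule ccontr)
    assume "\<not> thesis"
    then have "\<pi> x = 0\<^sub>m d d" using that \<pi>c[OF x] by (intro eq_matI) auto
    then show False using x0 by simp
  qed
  have unit: "\<exists>k\<in>K. \<pi> k = unit_matrix d d i j" if ij: "i < d" "j < d" for i j
  proof -
    obtain a b where ab: "a \<in> B" "b \<in> B" "\<pi> a = unit_matrix d d i s" "\<pi> b = unit_matrix d d t j"
    proof -
      have "unit_matrix d d i s \<in> \<pi> ` B" "unit_matrix d d t j \<in> \<pi> ` B" by (simp_all add: surj)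
      then show ?thesis using that by (metis imageE)
    qed
    define k where "k = (1 / \<pi> x $$ (s, t)) *\<^sub>C (a * x * b)"
    have ax: "a * x \<in> B" "a * x * b \<in> B" using ab x star_subalgebra_mult[OF B] by auto
    have "\<pi> (a * x * b) = \<pi> x $$ (s, t) \<cdot>\<^sub>m unit_matrix d d i j"
      using rep_mult[OF rep ax(1) ab(2)] rep_mult[OF rep ab(1) x]
        unit_matrix_sandwich[OF \<pi>c[OF x] ij(1) st(1,2) ij(2)] by (simp add: ab)
    then have "\<pi> k = (1 / \<pi> x $$ (s, t)) \<cdot>\<^sub>m (\<pi> x $$ (s, t) \<cdot>\<^sub>m unit_matrix d d i j)"
      using rep_scale[OF rep ax(2)] by (simp add: k_def)
    also have "\<dots> = unit_matrix d d i j" using st(3) by (intro eq_matI) auto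
    finally show ?thesis using Ksc Kmult[OF ab(1) xK ab(2)] by (auto simp: k_def)
  qed
  have KB: "K \<subseteq> B" by (auto simp: K_def)
  have full: "\<exists>k\<in>K. \<pi> k = y" if "y \<in> carrier_mat d d" for y
  proof (rule mat_induct_units[OF _ _ that])
    show "\<exists>k\<in>K. \<pi> k = 0\<^sub>m d d" using zK rep_zero[OF rep B] by blast
    fix z c i j assume "z \<in> carrier_mat d d" "\<exists>k\<in>K. \<pi> k = z" "i < d" "j < d"
    then obtain k k' where k: "k \<in> K" "\<pi> k = z" "k' \<in> K" "\<pi> k' = unit_matrix d d i j"
      using unit by blast
    then have kB: "k \<in> B" "k' \<in> B" using KB by auto
    have "\<pi> (k + c *\<^sub>C k') = z + c \<cdot>\<^sub>m unit_matrix d d i j"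
      using rep_add[OF rep kB(1) star_subalgebra_scale[OF B kB(2)]] rep_scale[OF rep kB(2)] k by simp
    then show "\<exists>k\<in>K. \<pi> k = z + c \<cdot>\<^sub>m unit_matrix d d i j" using k Kadd Ksc by blast
  qed
  show ?thesis
    unfolding independent_irreps_def
  proof (intro conjI allI impI)
    fix l assume "l < length (L @ [(d, \<pi>)])"
    then show "rep_on B (fst ((L @ [(d, \<pi>)]) ! l)) (snd ((L @ [(d, \<pi>)]) ! l))"
      and "0 < fst ((L @ [(d, \<pi>)]) ! l)"
      using L rep d by (auto simp: independent_irreps_def nth_append)
  next
    fix y :: "nat \<Rightarrow> complex mat"
    assume y: "\<forall>l<length (L @ [(d, \<pi>)]). y l \<in> carrier_mat (fst ((L @ [(d, \<pi>)]) ! l)) (fst ((L @ [(d, \<pi>)]) ! l))"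
    then have "\<forall>l<length L. y l \<in> carrier_mat (fst (L ! l)) (fst (L ! l))"
      by (auto simp: nth_append split: if_splits)
    then obtain b where b: "b \<in> B" "\<And>l. l < length L \<Longrightarrow> snd (L ! l) b = y l"
      using L unfolding independent_irreps_def by blast
    have yd: "y (length L) \<in> carrier_mat d d" using y by (auto simp: nth_append)
    then have yb: "y (length L) - \<pi> b \<in> carrier_mat d d" using \<pi>c[OF b(1)] by auto
    obtain k where k: "k \<in> K" "\<pi> k = y (length L) - \<pi> b" using full[OF yb] by blast
    have kB: "k \<in> B" using k KB by auto
    have "snd (L ! l) (b + k) = y l" if "l < length L" for l
      using k that b rep_add[OF repL[OF that] b(1) kB] rep_carrier[OF repL[OF that] b(1)]
      by (auto simp: K_def)
    moreover have "\<pi> (b + k) = y (length L)"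
      using rep_add[OF rep b(1) kB] k(2) \<pi>c[OF b(1)] yd by (simp, intro eq_matI, auto)
    ultimately have "\<forall>l<length (L @ [(d, \<pi>)]). snd ((L @ [(d, \<pi>)]) ! l) (b + k) = y l"
      by (auto simp: nth_append less_Suc_eq)
    then show "\<exists>b\<in>B. \<forall>l<length (L @ [(d, \<pi>)]). snd ((L @ [(d, \<pi>)]) ! l) b = y l"
      using star_subalgebra_add[OF B b(1) kB] by blast
  qed
qed

lemma independent_irreps_rep:
  assumes "independent_irreps B L" "l < length L"
  shows "rep_on B (fst (L ! l)) (snd (L ! l))" "0 < fst (L ! l)"
  using assms by (auto simp: independent_irreps_def)

lemma independent_irreps_solve:
  assumes "independent_irreps B L"
    and "\<And>l. l < length L \<Longrightarrow> y l \<in> carrier_mat (fst (L ! l)) (fst (L ! l))"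
  shows "\<exists>b\<in>B. \<forall>l<length L. snd (L ! l) b = y l"
  using assms unfolding independent_irreps_def by simp

lemma independent_irreps_irrep:
  assumes L: "independent_irreps B L" and l: "l < length L"
  shows "irrep_on B (fst (L ! l)) (snd (L ! l))"
proof -
  let ?d = "fst (L ! l)"
  note rep = independent_irreps_rep[OF L l]
  have "Y \<in> snd (L ! l) ` B" if Y: "Y \<in> carrier_mat ?d ?d" for Y
  proof -
    have "\<exists>b\<in>B. \<forall>k<length L. snd (L ! k) b = (if k = l then Y else 0\<^sub>m (fst (L ! k)) (fst (L ! k)))"
      by (rule independent_irreps_solve[OF L]) (use Y in auto)
    then obtain b where b: "b \<in> B"
      "\<And>k. k < length L \<Longrightarrow> snd (L ! k) b = (if k = l then Y else 0\<^sub>m (fst (L ! k)) (fst (L ! k)))"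
      by blast
    then have "snd (L ! l) b = Y" using l by simp
    then show ?thesis using b(1) by blast
  qed
  then show ?thesis using rep rep_carrier[OF rep(1)] by (auto simp: irrep_on_def)
qed

definition faithful_irreps :: "'a::cstar_algebra set \<Rightarrow> (nat \<times> ('a \<Rightarrow> complex mat)) list \<Rightarrow> bool" where
  "faithful_irreps B L \<longleftrightarrow>
     (\<forall>x\<in>B. (\<forall>l<length L. snd (L ! l) x = 0\<^sub>m (fst (L ! l)) (fst (L ! l))) \<longrightarrow> x = 0)"

text \<open>An element killed by the whole list is just what allows one more representation, so the
  list grows at most once per element of \<open>X\<close>. That \<open>L\<close> survives as a
  prefix is essential for the identity blocks.\<close>

lemma independent_irreps_detect:
  assumes B: "star_subalgebra B"
    and sep: "\<And>x. x \<in> B \<Longrightarrow> x \<noteq> 0 \<Longrightarrow> \<exists>d \<sigma>. irrep_on B d \<sigma> \<and> \<sigma> x \<noteq> 0\<^sub>m d d"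
    and L: "independent_irreps B L"
  shows "finite X \<Longrightarrow> X \<subseteq> B - {0} \<Longrightarrow> \<exists>M. independent_irreps B (L @ M) \<and>
    (\<forall>x\<in>X. \<exists>l<length (L @ M). snd ((L @ M) ! l) x \<noteq> 0\<^sub>m (fst ((L @ M) ! l)) (fst ((L @ M) ! l)))"
proof (induction X rule: finite_induct)
  case empty
  then show ?case using L by (intro exI[of _ "[]"]) simp
next
  case (insert x X)
  then obtain M where M: "independent_irreps B (L @ M)"
    "\<And>x. x \<in> X \<Longrightarrow> \<exists>l<length (L @ M). snd ((L @ M) ! l) x \<noteq> 0\<^sub>m (fst ((L @ M) ! l)) (fst ((L @ M) ! l))"
    by auto
  show ?case
  proof (cases "\<exists>l<length (L @ M). snd ((L @ M) ! l) x \<noteq> 0\<^sub>m (fst ((L @ M) ! l)) (fst ((L @ M) ! l))")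
    case True
    then show ?thesis using M by (intro exI[of _ M]) auto
  next
    case False
    have x: "x \<in> B" "x \<noteq> 0" using insert.prems by auto
    obtain d \<sigma> where \<sigma>: "irrep_on B d \<sigma>" "\<sigma> x \<noteq> 0\<^sub>m d d" using sep[OF x] by blast
    let ?N = "M @ [(d, \<sigma>)]"
    have nth: "(L @ ?N) ! l = (L @ M) ! l" if "l < length (L @ M)" for l
      using that nth_append[of "L @ M" "[(d, \<sigma>)]" l] by simp
    have last: "(L @ ?N) ! length (L @ M) = (d, \<sigma>)" using nth_append[of "L @ M" "[(d, \<sigma>)]"] by simp
    have "independent_irreps B (L @ ?N)"
      using independent_irreps_extend[OF B M(1) \<sigma>(1) x(1) _ \<sigma>(2)] False by auto
    moreover have "\<exists>l<length (L @ ?N). snd ((L @ ?N) ! l) z \<noteq> 0\<^sub>m (fst ((L @ ?N) ! l)) (fst ((L @ ?N) ! l))"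
      if z: "z \<in> insert x X" for z
    proof (cases "z = x")
      case True
      then show ?thesis using last \<sigma>(2) by (intro exI[of _ "length (L @ M)"]) simp
    next
      case False
      then obtain l where "l < length (L @ M)" "snd ((L @ M) ! l) z \<noteq> 0\<^sub>m (fst ((L @ M) ! l)) (fst ((L @ M) ! l))"
        using M(2) z by auto
      then show ?thesis using nth[of l] by (intro exI[of _ l]) auto
    qed
    ultimately show ?thesis by blast
  qed
qed

text \<open>Preimages of the units of the single factors are linearly independent: representation
  \<open>r\<close> kills the first \<open>r\<close> of them but not the next one.\<close>

lemma independent_irreps_length:
  fixes B :: "'a::cstar_algebra set"
  assumes B: "star_subalgebra B" and F: "finite F" "B = complex_vector.span F"
    and L: "independent_irreps B L"
  shows "length L \<le> card F"
proof -
  let ?d = "\<lambda>l. fst (L ! l)"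
  have "\<exists>b\<in>B. \<forall>k<length L. snd (L ! k) b = (if k = l then 1\<^sub>m (?d k) else 0\<^sub>m (?d k) (?d k))" for l
    by (rule independent_irreps_solve[OF L]) auto
  then obtain a where a: "\<And>l. a l \<in> B"
    "\<And>k l. k < length L \<Longrightarrow> snd (L ! k) (a l) = (if k = l then 1\<^sub>m (?d k) else 0\<^sub>m (?d k) (?d k))"
    by metis
  have "complex_vector.independent (a ` {..<r}) \<and> card (a ` {..<r}) = r" if "r \<le> length L" for r
    using that
  proof (induction r)
    case 0
    show ?case by (simp add: complex_vector.independent_empty)
  next
    case (Suc r)
    then have r: "r < length L" by simp
    note rep = independent_irreps_rep[OF L r]
    let ?Z = "{x \<in> B. snd (L ! r) x = 0\<^sub>m (?d r) (?d r)}"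
    have "complex_vector.subspace ?Z"
      unfolding complex_vector.subspace_def
      using star_subalgebra_zero[OF B] star_subalgebra_add[OF B] star_subalgebra_scale[OF B]
        rep_zero[OF rep(1) B] rep_add[OF rep(1)] rep_scale[OF rep(1)]
      by auto
    moreover have "a ` {..<r} \<subseteq> ?Z" using a r by auto
    ultimately have "complex_vector.span (a ` {..<r}) \<subseteq> ?Z"
      by (intro complex_vector.span_minimal)
    moreover have "a r \<notin> ?Z"
    proof
      assume "a r \<in> ?Z"
      then have "(1\<^sub>m (?d r) :: complex mat) = 0\<^sub>m (?d r) (?d r)" using a(2)[OF r, of r] by simp
      then have "(1\<^sub>m (?d r) :: complex mat) $$ (0, 0) = 0\<^sub>m (?d r) (?d r) $$ (0, 0)" by simp
      then show False using rep(2) by simp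
    qed
    ultimately have "a r \<notin> complex_vector.span (a ` {..<r})" by blast
    then have "complex_vector.independent (insert (a r) (a ` {..<r}))" "a r \<notin> a ` {..<r}"
      using Suc complex_vector.independent_insertI complex_vector.span_base[of "a r"] by (auto simp del: image_iff)
    then show ?case using Suc by (simp add: lessThan_Suc)
  qed
  then have i: "complex_vector.independent (a ` {..<length L})" "card (a ` {..<length L}) = length L" by auto
  have "a ` {..<length L} \<subseteq> complex_vector.span F" using a F by auto
  then show ?thesis using complex_vector.independent_span_bound[OF F(1) i(1)] i(2) by simp
qed

text \<open>The dimension bounds the length, so a longest extension of \<open>L\<close> exists; an
  element that it kills would allow a longer one.\<close>

lemma independent_irreps_complete:
  fixes B :: "'a::cstar_algebra set"
  assumes B: "star_subalgebra B" and fin: "finite_dim B"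
    and sep: "\<And>x. x \<in> B \<Longrightarrow> x \<noteq> 0 \<Longrightarrow> \<exists>d \<sigma>. irrep_on B d \<sigma> \<and> \<sigma> x \<noteq> 0\<^sub>m d d"
    and L: "independent_irreps B L"
  obtains M where "independent_irreps B (L @ M)" "faithful_irreps B (L @ M)"
proof -
  obtain F where F: "finite F" "B = complex_vector.span F" using fin by (auto simp: finite_dim_def)
  have "length (L @ M) \<le> card F" if "independent_irreps B (L @ M)" for M
    by (rule independent_irreps_length[OF B F that])
  then have b: "length M < Suc (card F)" if "independent_irreps B (L @ M)" for M
    using that by (metis length_append add_leD2 less_Suc_eq_le)
  obtain M where M: "independent_irreps B (L @ M)"
    "\<And>M'. independent_irreps B (L @ M') \<Longrightarrow> length M' \<le> length M"
    using ex_has_greatest_nat[of "\<lambda>M. independent_irreps B (L @ M)" "[]" length "Suc (card F)"] L b by auto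
  have "faithful_irreps B (L @ M)"
    unfolding faithful_irreps_def
  proof (intro ballI impI, rule ccontr)
    fix x assume x: "x \<in> B" "x \<noteq> 0"
      and kill: "\<forall>l<length (L @ M). snd ((L @ M) ! l) x = 0\<^sub>m (fst ((L @ M) ! l)) (fst ((L @ M) ! l))"
    obtain d \<sigma> where \<sigma>: "irrep_on B d \<sigma>" "\<sigma> x \<noteq> 0\<^sub>m d d" using sep[OF x] by blast
    have "independent_irreps B (L @ M @ [(d, \<sigma>)])"
      using independent_irreps_extend[OF B M(1) \<sigma>(1) x(1) _ \<sigma>(2)] kill by auto
    then show False using M(2) by fastforce
  qed
  then show ?thesis using that M(1) by blast
qed

section \<open>Matrix coefficients and dual elements\<close>

definition coord_indices :: "(nat \<times> ('a \<Rightarrow> complex mat)) list \<Rightarrow> (nat \<times> nat \<times> nat) set" where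
  "coord_indices L = (SIGMA l:{..<length L}. {..<fst (L ! l)} \<times> {..<fst (L ! l)})"

definition coord :: "(nat \<times> ('a \<Rightarrow> complex mat)) list \<Rightarrow> nat \<times> nat \<times> nat \<Rightarrow> 'a \<Rightarrow> complex" where
  "coord L = (\<lambda>(l, i, j) x. snd (L ! l) x $$ (i, j))"

lemma finite_coord_indices [simp]: "finite (coord_indices L)"
  by (simp add: coord_indices_def)

lemma coord_eqI:
  assumes B: "independent_irreps B L" and "x \<in> B" "l < length L" "Y \<in> carrier_mat (fst (L ! l)) (fst (L ! l))"
    and "\<And>i j. i < fst (L ! l) \<Longrightarrow> j < fst (L ! l) \<Longrightarrow> coord L (l, i, j) x = Y $$ (i, j)"
  shows "snd (L ! l) x = Y"
proof (rule eq_matI)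
  have c: "snd (L ! l) x \<in> carrier_mat (fst (L ! l)) (fst (L ! l))"
    using rep_carrier[OF independent_irreps_rep(1)[OF B assms(3)] assms(2)] .
  show "dim_row (snd (L ! l) x) = dim_row Y" "dim_col (snd (L ! l) x) = dim_col Y" using c assms by auto
  fix i j assume "i < dim_row Y" "j < dim_col Y"
  then show "snd (L ! l) x $$ (i, j) = Y $$ (i, j)" using assms by (auto simp: coord_def)
qed

lemma coord_linear:
  assumes L: "independent_irreps B L" and B: "star_subalgebra B" and s: "s \<in> coord_indices L"
  shows coord_add: "x \<in> B \<Longrightarrow> y \<in> B \<Longrightarrow> coord L s (x + y) = coord L s x + coord L s y"
    and coord_scale: "x \<in> B \<Longrightarrow> coord L s (c *\<^sub>C x) = c * coord L s x"
    and coord_sum: "finite T \<Longrightarrow> (\<And>t. t \<in> T \<Longrightarrow> e t \<in> B) \<Longrightarrow>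
      (\<Sum>t\<in>T. c' t *\<^sub>C e t) \<in> B \<and>
      coord L s (\<Sum>t\<in>T. c' t *\<^sub>C e t) = (\<Sum>t\<in>T. c' t * coord L s (e t))"
proof -
  obtain l i j where s: "s = (l, i, j)" and l: "l < length L" and ij: "i < fst (L ! l)" "j < fst (L ! l)"
    using s by (auto simp: coord_indices_def)
  note rep = independent_irreps_rep(1)[OF L l]
  note c = rep_carrier[OF rep]
  show add: "coord L s (x + y) = coord L s x + coord L s y" if "x \<in> B" "y \<in> B" for x y
    using rep_add[OF rep that] c[OF that(1)] c[OF that(2)] ij by (simp add: coord_def s)
  show sc: "coord L s (c *\<^sub>C x) = c * coord L s x" if "x \<in> B" for x c
    using rep_scale[OF rep that] c[OF that] ij by (simp add: coord_def s)
  have z: "coord L s 0 = 0" using rep_zero[OF rep B] ij by (simp add: coord_def s)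
  show "(\<Sum>t\<in>T. c' t *\<^sub>C e t) \<in> B \<and> coord L s (\<Sum>t\<in>T. c' t *\<^sub>C e t) = (\<Sum>t\<in>T. c' t * coord L s (e t))"
    if "finite T" "\<And>t. t \<in> T \<Longrightarrow> e t \<in> B"
    using that
  proof (induction T rule: finite_induct)
    case empty
    show ?case using z star_subalgebra_zero[OF B] by simp
  next
    case (insert t T)
    then have 1: "c' t *\<^sub>C e t \<in> B" "(\<Sum>t\<in>T. c' t *\<^sub>C e t) \<in> B"
      "coord L s (\<Sum>t\<in>T. c' t *\<^sub>C e t) = (\<Sum>t\<in>T. c' t * coord L s (e t))"
      using star_subalgebra_scale[OF B] by auto
    then show ?case
      using insert.hyps insert.prems add[OF 1(1,2)] sc[of "e t"] star_subalgebra_add[OF B 1(1,2)] by simp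
  qed
qed

text \<open>Lifts of the matrix units, dual to the coordinate functionals. For a faithful list they
  form a basis.\<close>

lemma independent_irreps_units:
  assumes L: "independent_irreps B L"
  obtains e where "\<And>s. s \<in> coord_indices L \<Longrightarrow> e s \<in> B"
    "\<And>l i j k. (l, i, j) \<in> coord_indices L \<Longrightarrow> k < length L \<Longrightarrow> snd (L ! k) (e (l, i, j)) =
      (if k = l then unit_matrix (fst (L ! k)) (fst (L ! k)) i j else 0\<^sub>m (fst (L ! k)) (fst (L ! k)))"
    "\<And>s t. s \<in> coord_indices L \<Longrightarrow> t \<in> coord_indices L \<Longrightarrow> coord L t (e s) = of_bool (s = t)"
proof -
  let ?d = "\<lambda>l. fst (L ! l)"
  let ?y = "\<lambda>l i j k. if k = l then unit_matrix (?d k) (?d k) i j else 0\<^sub>m (?d k) (?d k)"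
  have "\<exists>b\<in>B. \<forall>k<length L. snd (L ! k) b = ?y l i j k" for l i j
    by (rule independent_irreps_solve[OF L]) auto
  then have "\<exists>e. \<forall>l i j. e l i j \<in> B \<and> (\<forall>k<length L. snd (L ! k) (e l i j) = ?y l i j k)"
    by metis
  then obtain e where e: "\<And>l i j. e l i j \<in> B"
    "\<And>l i j k. k < length L \<Longrightarrow> snd (L ! k) (e l i j) = ?y l i j k"
    by blast
  define e' where "e' = (\<lambda>(l, i, j). e l i j)"
  have 3: "coord L t (e' s) = of_bool (s = t)" if "s \<in> coord_indices L" "t \<in> coord_indices L" for s t
  proof -
    obtain l i j k a b where st: "s = (l, i, j)" "t = (k, a, b)" by (metis prod.exhaust)
    then have "k < length L" "a < ?d k" "b < ?d k" using that by (auto simp: coord_indices_def)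
    then show ?thesis using e(2)[of k l i j] by (auto simp: coord_def e'_def st)
  qed
  show ?thesis
    by (rule that[of e']) (use e 3 in \<open>auto simp: e'_def\<close>)
qed

lemma faithful_expand:
  assumes L: "independent_irreps B L" and B: "star_subalgebra B" and faith: "faithful_irreps B L"
    and e: "\<And>s. s \<in> coord_indices L \<Longrightarrow> e s \<in> B"
    and ee: "\<And>s t. s \<in> coord_indices L \<Longrightarrow> t \<in> coord_indices L \<Longrightarrow> coord L t (e s) = of_bool (s = t)"
    and x: "x \<in> B"
  shows "x = (\<Sum>s\<in>coord_indices L. coord L s x *\<^sub>C e s)"
proof -
  let ?S = "coord_indices L"
  define y where "y = (\<Sum>s\<in>?S. coord L s x *\<^sub>C e s)"
  show ?thesis
  \<comment> \<open>Sizes are positive, so an empty index set means an empty list; its faithfulness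
    leaves only the zero element.\<close>
  proof (cases "?S = {}")
    case True
    have "snd (L ! l) x = 0\<^sub>m (fst (L ! l)) (fst (L ! l))" if l: "l < length L" for l
      using True l independent_irreps_rep(2)[OF L l] by (force simp: coord_indices_def)
    then have "x = 0" using faith x by (auto simp: faithful_irreps_def)
    then show ?thesis using True by simp
  next
    case False
    then obtain s0 where s0: "s0 \<in> ?S" by blast
    have yB: "y \<in> B" unfolding y_def
      by (rule conjunct1[OF coord_sum[OF L B s0 finite_coord_indices]]) (rule e)
    have cy: "coord L t y = coord L t x" if t: "t \<in> ?S" for t
    proof -
      have "coord L t y = (\<Sum>s\<in>?S. coord L s x * coord L t (e s))"
        unfolding y_def by (rule conjunct2[OF coord_sum[OF L B t finite_coord_indices]]) (rule e)
      also have "\<dots> = (\<Sum>s\<in>?S. if s = t then coord L t x else 0)"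
        using t by (intro sum.cong refl) (auto simp: ee)
      finally show ?thesis using t by simp
    qed
    have "snd (L ! l) (x - y) = 0\<^sub>m (fst (L ! l)) (fst (L ! l))" if l: "l < length L" for l
    proof -
      note rep = independent_irreps_rep(1)[OF L l]
      have "snd (L ! l) y = snd (L ! l) x"
        by (rule coord_eqI[OF L yB l rep_carrier[OF rep x]])
          (use cy l in \<open>auto simp: coord_indices_def coord_def\<close>)
      then show ?thesis using rep_diff[OF rep B x yB] rep_carrier[OF rep x] by auto
    qed
    then have "x - y = 0" using faith star_subalgebra_diff[OF B x yB] by (auto simp: faithful_irreps_def)
    then show ?thesis by (simp add: y_def)
  qed
qed

text \<open>Faithfulness would make the finitely many lifted matrix units span the algebra. This is
  the only place where infinite dimension is turned into the strict growth of
  \<open>r\<close>.\<close>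

lemma infinite_dim_not_faithful:
  assumes inf: "\<not> finite_dim (UNIV :: 'a::cstar_algebra set)"
    and L: "independent_irreps (UNIV :: 'a set) L"
  shows "\<not> faithful_irreps UNIV L"
proof
  assume faith: "faithful_irreps UNIV L"
  obtain e where e: "\<And>s t. s \<in> coord_indices L \<Longrightarrow> t \<in> coord_indices L \<Longrightarrow> coord L t (e s) = of_bool (s = t)"
    using independent_irreps_units[OF L] by metis
  have "x \<in> complex_vector.span (e ` coord_indices L)" for x :: 'a
  proof -
    have "x = (\<Sum>s\<in>coord_indices L. coord L s x *\<^sub>C e s)"
      by (rule faithful_expand[OF L star_subalgebra_UNIV faith _ e]) auto
    then show ?thesis
      by (metis (no_types, lifting) complex_vector.span_base complex_vector.span_scale
          complex_vector.span_sum image_eqI)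
  qed
  then have "finite_dim (UNIV :: 'a set)"
    unfolding finite_dim_def by (intro exI[of _ "e ` coord_indices L"]) auto
  then show False using inf by simp
qed

section \<open>Automatic continuity and density\<close>

lemma bounded_linear_scaleC: "bounded_linear (\<lambda>x :: 'a::cstar_algebra. c *\<^sub>C x)"
  by (rule bounded_linear_intro[of _ "cmod c"])
    (simp_all add: scaleC_add_right norm_scaleC mult.commute scaleR_scaleC)

text \<open>The sum of the powers of \<open>y\<close> from the first on: the Neumann series,
  arranged so that no unit is required.\<close>

lemma quasi_inverse:
  fixes y :: "'a::{real_normed_algebra, banach}"
  assumes y: "norm y < 1"
  shows "\<exists>s. s = s * y + y"
proof -
  define p where "p n = ((\<lambda>z. z * y) ^^ n) y" for n
  have p: "p 0 = y" "p (Suc n) = p n * y" for n by (simp_all add: p_def)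
  have "norm (p n) \<le> norm y ^ n * norm y" for n
  proof (induction n)
    case (Suc n)
    have "norm (p (Suc n)) \<le> norm (p n) * norm y" by (simp add: p norm_mult_ineq)
    also have "\<dots> \<le> norm y ^ n * norm y * norm y" by (rule mult_right_mono[OF Suc]) simp
    finally show ?case by (simp add: mult_ac)
  qed (simp add: p)
  moreover have "summable (\<lambda>n. norm y ^ n * norm y)"
    using y by (intro summable_mult2 summable_geometric) simp
  ultimately have s: "summable p"
    by (intro summable_comparison_test[of p "\<lambda>n. norm y ^ n * norm y"]) auto
  have "suminf p = (\<Sum>n. p (Suc n)) + p 0" using suminf_split_head[OF s] by simp
  also have "(\<Sum>n. p (Suc n)) = suminf p * y" using suminf_mult2[OF s, of y] by (simp add: p)
  finally show ?thesis using p by metis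
qed

text \<open>If \<open>\<pi> z\<close> is a diagonal matrix unit then \<open>\<parallel>z\<parallel> \<ge> 1\<close>: otherwise \<open>z\<close> has a quasi-inverse,
  although its image has the eigenvalue 1.\<close>

lemma irrep_entry_bounded:
  fixes \<pi> :: "'a::cstar_algebra \<Rightarrow> complex mat"
  assumes \<pi>: "irrep_on UNIV d \<pi>" and ij: "i < d" "j < d"
  shows "\<exists>M. \<forall>x. cmod (\<pi> x $$ (i, j)) \<le> norm x * M"
proof -
  have rep: "rep_on UNIV d \<pi>" and d: "0 < d" and surj: "range \<pi> = carrier_mat d d"
    using \<pi> by (auto simp: irrep_on_def)
  have "unit_matrix d d 0 i \<in> range \<pi>" "unit_matrix d d j 0 \<in> range \<pi>" by (simp_all add: surj)
  then obtain a b where ab: "\<pi> a = unit_matrix d d 0 i" "\<pi> b = unit_matrix d d j 0"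
    by (metis imageE)
  have "cmod (\<pi> x $$ (i, j)) \<le> norm x * (norm a * norm b)" for x
  proof -
    let ?c = "\<pi> x $$ (i, j)"
    \<comment> \<open>The preimages of matrix units on both sides move the entry
      \<open>(i, j)\<close> to the corner, so the image of this element is that entry times a
      diagonal matrix unit.\<close>
    let ?y = "a * x * b"
    have xc: "\<pi> x \<in> carrier_mat d d" using rep_carrier[OF rep] by simp
    have \<pi>y: "\<pi> ?y = ?c \<cdot>\<^sub>m unit_matrix d d 0 0"
      using unit_matrix_sandwich[OF xc d ij d] by (simp add: rep_mult[OF rep] ab)
    have "cmod ?c \<le> norm ?y"
    proof (rule ccontr)
      assume "\<not> cmod ?c \<le> norm ?y"
      then have lt: "norm ?y < cmod ?c" by simp
      have c0: "cmod ?c > 0" using lt norm_ge_zero[of ?y] by linarith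
      then have cne: "?c \<noteq> 0" by simp
      define z where "z = (1 / ?c) *\<^sub>C ?y"
      have "norm z < 1" using lt c0 by (simp add: z_def norm_scaleC norm_divide field_simps)
      then obtain s where s: "s = s * z + z" using quasi_inverse by blast
      have "\<pi> z = (1 / ?c) \<cdot>\<^sub>m (?c \<cdot>\<^sub>m unit_matrix d d 0 0)"
        using rep_scale[OF rep] \<pi>y by (simp add: z_def)
      also have "\<dots> = unit_matrix d d 0 0" using cne by (intro eq_matI) auto
      finally have \<pi>z: "\<pi> z = unit_matrix d d 0 0" .
      have sc: "\<pi> s \<in> carrier_mat d d" using rep_carrier[OF rep] by simp
      have "\<pi> s = \<pi> (s * z) + \<pi> z" using s rep_add[OF rep, of "s * z" z] by simp
      \<comment> \<open>At position \<open>(0, 0)\<close> this reads t = t + 1.\<close>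
      then have "\<pi> s = \<pi> s * unit_matrix d d 0 0 + unit_matrix d d 0 0"
        using rep_mult[OF rep] \<pi>z by simp
      then have "\<pi> s $$ (0, 0) = (\<pi> s * unit_matrix d d 0 0 + unit_matrix d d 0 0) $$ (0, 0)"
        by (rule arg_cong)
      also have "\<dots> = (\<pi> s * unit_matrix d d 0 0) $$ (0, 0) + 1"
        using d sc by (simp del: index_mult_mat(1))
      also have "(\<pi> s * unit_matrix d d 0 0) $$ (0, 0) = \<pi> s $$ (0, 0)"
        using mult_unit_matrix_entry[OF sc d d d, of 0] by simp
      finally show False by simp
    qed
    also have "norm ?y \<le> norm a * norm x * norm b"
      using norm_mult_ineq[of "a * x" b] norm_mult_ineq[of a x]
      by (meson mult_right_mono norm_ge_zero order_trans)
    finally show ?thesis by (simp add: mult_ac)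
  qed
  then show ?thesis by blast
qed

text \<open>Induction on \<open>S\<close>. The map \<open>h\<close> removes the components along the
  dual elements already found; \<open>g u\<close> composed with \<open>h\<close> is continuous and
  equals 1 at \<open>e u\<close>, so it is nonzero at some point of \<open>D\<close>. That point is
  rescaled, and the earlier dual elements are corrected by it.\<close>

lemma dense_dual_elements:
  fixes D :: "'a::cstar_algebra set" and g :: "'i \<Rightarrow> 'a \<Rightarrow> complex"
  assumes D: "complex_vector.subspace D" "closure D = UNIV"
    and add: "\<And>s x y. s \<in> S \<Longrightarrow> g s (x + y) = g s x + g s y"
    and sc: "\<And>s c x. s \<in> S \<Longrightarrow> g s (c *\<^sub>C x) = c * g s x"
    and cont: "\<And>s. s \<in> S \<Longrightarrow> continuous_on UNIV (g s)"
    and e: "\<And>s t. s \<in> S \<Longrightarrow> t \<in> S \<Longrightarrow> g t (e s) = of_bool (s = t)"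
    and fin: "finite S"
  shows "\<exists>a. \<forall>s\<in>S. a s \<in> D \<and> (\<forall>t\<in>S. g t (a s) = of_bool (s = t))"
  using fin add sc cont e
proof (induction S rule: finite_induct)
  case (insert u S)
  have "\<exists>a. \<forall>s\<in>S. a s \<in> D \<and> (\<forall>t\<in>S. g t (a s) = of_bool (s = t))"
    by (rule insert.IH) (use insert.prems in auto)
  then obtain a where a: "\<And>s. s \<in> S \<Longrightarrow> a s \<in> D"
    "\<And>s t. s \<in> S \<Longrightarrow> t \<in> S \<Longrightarrow> g t (a s) = of_bool (s = t)" by blast
  have Dadd: "x + y \<in> D" and Dsc: "c *\<^sub>C x \<in> D" if "x \<in> D" "y \<in> D" for x y c
    using D(1) that by (auto simp: complex_vector.subspace_def)
  have Ddiff: "x - y \<in> D" if "x \<in> D" "y \<in> D" for x y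
    using complex_vector.subspace_diff[OF D(1)] that .
  have gdiff: "g s (x - y) = g s x - g s y" if "s \<in> insert u S" for s x y
    using insert.prems(1)[OF that, of "x - y" y] by simp
  have g0: "g s 0 = 0" if "s \<in> insert u S" for s using gdiff[OF that, of 0 0] by simp
  have gsum: "g s (\<Sum>t\<in>T. c t *\<^sub>C a t) = (\<Sum>t\<in>T. c t * g s (a t))"
    if "s \<in> insert u S" "finite T" for s T c
    using that(2)
    by (induction T rule: finite_induct)
      (simp_all add: g0[OF that(1)] insert.prems(1)[OF that(1)] insert.prems(2)[OF that(1)])
  define h where "h x = x - (\<Sum>t\<in>S. g t x *\<^sub>C a t)" for x
  have gh: "g s (h x) = g s x - (\<Sum>t\<in>S. g t x * g s (a t))" if "s \<in> insert u S" for s x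
    by (simp add: h_def gdiff[OF that] gsum[OF that insert.hyps(1)])
  have gh0: "g s (h x) = 0" if s: "s \<in> S" for s x
  proof -
    have "(\<Sum>t\<in>S. g t x * g s (a t)) = (\<Sum>t\<in>S. if t = s then g s x else 0)"
      using s by (intro sum.cong) (auto simp: a)
    then show ?thesis using gh[of s x] s insert.hyps by simp
  qed
  have "g u (h (e u)) = 1"
    using gh[of u "e u"] insert.prems(4)[of u] insert.hyps by (auto intro!: sum.neutral)
  moreover have "continuous_on UNIV (\<lambda>x. g u (h x))"
    unfolding gh[OF insertI1]
    by (intro continuous_intros insert.prems(3)) auto
  then have "open {x. g u (h x) \<noteq> 0}"
    using open_vimage[of "- {0}" "\<lambda>x. g u (h x)"] by (simp add: vimage_def open_Compl)
  ultimately have "{x. g u (h x) \<noteq> 0} \<inter> D \<noteq> {}"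
    using open_Int_closure_eq_empty[of "{x. g u (h x) \<noteq> 0}" D] D(2) by force
  then obtain x where x: "x \<in> D" "g u (h x) \<noteq> 0" by blast
  have "(\<Sum>t\<in>S. g t x *\<^sub>C a t) \<in> D"
    using a(1) by (intro complex_vector.subspace_sum[OF D(1)]) (auto intro: complex_vector.subspace_scale[OF D(1)])
  then have hD: "h x \<in> D" using x by (simp add: h_def Ddiff)
  define b where "b = (1 / g u (h x)) *\<^sub>C h x"
  have bD: "b \<in> D" using Dsc[OF hD hD] by (simp add: b_def)
  have gb: "g s b = of_bool (s = u)" if "s \<in> insert u S" for s
    using insert.prems(2)[OF that] gh0[of s x] x(2) that insert.hyps by (auto simp: b_def)
  define a' where "a' s = (if s = u then b else a s - g u (a s) *\<^sub>C b)" for s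
  have "a' s \<in> D" if "s \<in> insert u S" for s
    using that a(1) bD Ddiff Dsc[OF bD bD] by (auto simp: a'_def)
  moreover have "g t (a' s) = of_bool (s = t)" if st: "s \<in> insert u S" "t \<in> insert u S" for s t
  proof (cases "s = u")
    case True
    then show ?thesis using gb[OF st(2)] by (auto simp: a'_def)
  next
    case False
    then have s: "s \<in> S" using st by simp
    have "g t (a' s) = g t (a s) - g u (a s) * of_bool (t = u)"
      using False gdiff[OF st(2)] insert.prems(2)[OF st(2)] gb[OF st(2)] by (simp add: a'_def)
    then show ?thesis using False a(2)[OF s] st(2) by auto
  qed
  ultimately show ?case by blast
qed simp

text \<open>Dual elements to all matrix coefficients exist in the dense union. There are finitely
  many, so one stage contains them all, and their combinations realize every tuple of
  matrices.\<close>

lemma independent_irreps_dense: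
  fixes D :: "nat \<Rightarrow> 'a::cstar_algebra set"
  assumes D: "\<And>n. star_subalgebra (D n)" and mono: "incseq D" and dense: "closure (\<Union>n. D n) = UNIV"
    and L: "independent_irreps UNIV L"
  shows "\<exists>N. \<forall>n\<ge>N. independent_irreps (D n) L"
proof -
  let ?S = "coord_indices L"
  have sub: "complex_vector.subspace (\<Union>n. D n)"
    unfolding complex_vector.subspace_def
  proof (intro conjI ballI allI)
    show "0 \<in> (\<Union>n. D n)" using star_subalgebra_zero[OF D] by blast
    fix x y assume "x \<in> (\<Union>n. D n)" "y \<in> (\<Union>n. D n)"
    then obtain n m where "x \<in> D n" "y \<in> D m" by blast
    then have "x \<in> D (max n m)" "y \<in> D (max n m)" using monoD[OF mono] by (meson max.cobounded1 max.cobounded2 subsetD)+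
    then show "x + y \<in> (\<Union>n. D n)" using star_subalgebra_add[OF D] by blast
  next
    fix x c assume "x \<in> (\<Union>n. D n)"
    then show "c *\<^sub>C x \<in> (\<Union>n. D n)" using star_subalgebra_scale[OF D] by blast
  qed
  have cont: "continuous_on UNIV (coord L s)" if s: "s \<in> ?S" for s
  proof -
    obtain l i j where lij: "s = (l, i, j)" "l < length L" "i < fst (L ! l)" "j < fst (L ! l)"
      using s by (auto simp: coord_indices_def)
    obtain M where M: "\<And>x. cmod (coord L s x) \<le> norm x * M"
      using irrep_entry_bounded[OF independent_irreps_irrep[OF L lij(2)] lij(3,4)]
      by (auto simp: coord_def lij)
    have "bounded_linear (coord L s)"
      by (rule bounded_linear_intro[of _ M])
        (simp_all add: M coord_add[OF L star_subalgebra_UNIV s] scaleR_scaleC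
          coord_scale[OF L star_subalgebra_UNIV s] scaleR_conv_of_real)
    then show ?thesis by (intro linear_continuous_on)
  qed
  obtain e where e: "\<And>s t. s \<in> ?S \<Longrightarrow> t \<in> ?S \<Longrightarrow> coord L t (e s) = of_bool (s = t)"
    using independent_irreps_units[OF L] by metis
  have "\<exists>a. \<forall>s\<in>?S. a s \<in> (\<Union>n. D n) \<and> (\<forall>t\<in>?S. coord L t (a s) = of_bool (s = t))"
    by (rule dense_dual_elements[OF sub dense, where e = e])
      (simp_all add: coord_add[OF L star_subalgebra_UNIV] coord_scale[OF L star_subalgebra_UNIV] cont e)
  then obtain a where a: "\<And>s. s \<in> ?S \<Longrightarrow> a s \<in> (\<Union>n. D n)"
    "\<And>s t. s \<in> ?S \<Longrightarrow> t \<in> ?S \<Longrightarrow> coord L t (a s) = of_bool (s = t)" by blast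
  then have "\<forall>s\<in>?S. \<exists>n. a s \<in> D n" by blast
  then obtain f where f: "\<And>s. s \<in> ?S \<Longrightarrow> a s \<in> D (f s)" by metis
  \<comment> \<open>The sum is an upper bound of the finitely many stage indices that also makes
    sense for an empty index set.\<close>
  define N where "N = (\<Sum>s\<in>?S. f s)"
  have "independent_irreps (D n) L" if n: "N \<le> n" for n
  proof -
    have aD: "a s \<in> D n" if "s \<in> ?S" for s
    proof -
      have "f s \<le> N" unfolding N_def using that by (intro member_le_sum) auto
      then show ?thesis using f[OF that] monoD[OF mono, of "f s" n] n by auto
    qed
    show ?thesis
      unfolding independent_irreps_def
    proof (intro conjI allI impI)
      fix l assume l: "l < length L"
      show "rep_on (D n) (fst (L ! l)) (snd (L ! l))" "0 < fst (L ! l)"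
        using independent_irreps_rep[OF L l] rep_on_subset[OF _ subset_UNIV] by blast+
    next
      fix y :: "nat \<Rightarrow> complex mat"
      assume y: "\<forall>l<length L. y l \<in> carrier_mat (fst (L ! l)) (fst (L ! l))"
      define b where "b = (\<Sum>s\<in>?S. (case s of (l, i, j) \<Rightarrow> y l $$ (i, j)) *\<^sub>C a s)"
      have bD: "b \<in> D n" unfolding b_def
        using aD by (intro complex_vector.subspace_sum[OF star_subalgebra_subspace[OF D]])
          (auto intro: star_subalgebra_scale[OF D])
      have cb: "coord L t b = (case t of (l, i, j) \<Rightarrow> y l $$ (i, j))" if t: "t \<in> ?S" for t
      proof -
        have "coord L t b = (\<Sum>s\<in>?S. (case s of (l, i, j) \<Rightarrow> y l $$ (i, j)) * coord L t (a s))"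
          unfolding b_def
          by (rule conjunct2[OF coord_sum[OF L star_subalgebra_UNIV t finite_coord_indices]]) simp
        also have "\<dots> = (\<Sum>s\<in>?S. if s = t then (case t of (l, i, j) \<Rightarrow> y l $$ (i, j)) else 0)"
          using t by (intro sum.cong refl) (auto simp: a(2))
        finally show ?thesis using t by simp
      qed
      have "snd (L ! l) b = y l" if l: "l < length L" for l
        by (rule coord_eqI[OF L UNIV_I l]) (use y l cb in \<open>auto simp: coord_indices_def\<close>)
      then show "\<exists>b\<in>D n. \<forall>l<length L. snd (L ! l) b = y l" using bD by blast
    qed
  qed
  then show ?thesis by blast
qed

text \<open>A complete list identifies \<open>B\<close> with a product of matrix algebras, whose
  unit is pulled back.\<close>

lemma star_subalgebra_unit:
  fixes B :: "'a::cstar_algebra set"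
  assumes rfd: "residually_finite_dimensional TYPE('a)" and B: "star_subalgebra B" and fin: "finite_dim B"
  obtains q where "q \<in> B" "star q = q" "\<And>x. x \<in> B \<Longrightarrow> q * x = x" "\<And>x. x \<in> B \<Longrightarrow> x * q = x"
proof -
  obtain M where M: "independent_irreps B M" "faithful_irreps B M"
    using independent_irreps_complete[OF B fin rfd_irrep_separates[OF rfd B] independent_irreps_Nil[OF B]] by auto
  have "\<exists>q\<in>B. \<forall>l<length M. snd (M ! l) q = 1\<^sub>m (fst (M ! l))"
    by (rule independent_irreps_solve[OF M(1)]) auto
  then obtain q where q: "q \<in> B" "\<And>l. l < length M \<Longrightarrow> snd (M ! l) q = 1\<^sub>m (fst (M ! l))" by blast
  have eq: "x = y" if xy: "x \<in> B" "y \<in> B" "\<And>l. l < length M \<Longrightarrow> snd (M ! l) x = snd (M ! l) y" for x y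
  proof -
    have "snd (M ! l) (x - y) = 0\<^sub>m (fst (M ! l)) (fst (M ! l))" if l: "l < length M" for l
      using rep_diff[OF independent_irreps_rep(1)[OF M(1) l] B xy(1,2)] xy(3)[OF l]
        rep_carrier[OF independent_irreps_rep(1)[OF M(1) l] xy(2)] by auto
    then have "x - y = 0" using M(2) star_subalgebra_diff[OF B xy(1,2)] by (auto simp: faithful_irreps_def)
    then show ?thesis by simp
  qed
  have "q * x = x" if x: "x \<in> B" for x
  proof (rule eq[OF star_subalgebra_mult[OF B q(1) x] x])
    fix l assume l: "l < length M"
    note rep = independent_irreps_rep(1)[OF M(1) l]
    show "snd (M ! l) (q * x) = snd (M ! l) x"
      using rep_mult[OF rep q(1) x] q(2)[OF l] rep_carrier[OF rep x] by simp
  qed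
  moreover have "x * q = x" if x: "x \<in> B" for x
  proof (rule eq[OF star_subalgebra_mult[OF B x q(1)] x])
    fix l assume l: "l < length M"
    note rep = independent_irreps_rep(1)[OF M(1) l]
    show "snd (M ! l) (x * q) = snd (M ! l) x"
      using rep_mult[OF rep x q(1)] q(2)[OF l] rep_carrier[OF rep x] by simp
  qed
  moreover have "star q = q"
  proof (rule eq[OF star_subalgebra_star[OF B q(1)] q(1)])
    fix l assume l: "l < length M"
    show "snd (M ! l) (star q) = snd (M ! l) q"
      using rep_star[OF independent_irreps_rep(1)[OF M(1) l] q(1)] q(2)[OF l] by simp
  qed
  ultimately show ?thesis using that q(1) by blast
qed

lemma finite_dim_subspace:
  fixes V W :: "'a::cstar_algebra set"
  assumes V: "complex_vector.subspace V" and VW: "V \<subseteq> W" and W: "finite_dim W"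
  shows "finite_dim V"
proof -
  obtain F where F: "finite F" "W = complex_vector.span F" using W by (auto simp: finite_dim_def)
  obtain S where S: "S \<subseteq> V" "complex_vector.independent S" "V \<subseteq> complex_vector.span S"
    using complex_vector.maximal_independent_subset[of V] by metis
  have "S \<subseteq> complex_vector.span F" using S(1) VW F(2) by simp
  then have "finite S" using complex_vector.independent_span_bound[OF F(1) S(2)] by simp
  moreover have "complex_vector.span S = V"
    using S(3) complex_vector.span_minimal[OF S(1) V] by blast
  ultimately show ?thesis by (auto simp: finite_dim_def)
qed

section \<open>Exhausting sequences\<close>

text \<open>Stage \<open>Suc n\<close> is chosen by directedness so that it approximates the points
  0 to n of a dense sequence up to 1 / (n + 1). The start \<open>C\<close> is prescribed because it
  will have to contain an element close to a full projection.\<close>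

lemma AF_increasing_sequence:
  fixes \<B> :: "'a::cstar_algebra set set"
  assumes sep: "separable_space (euclidean :: 'a topology)"
    and directed: "\<And>B C. B \<in> \<B> \<Longrightarrow> C \<in> \<B> \<Longrightarrow> \<exists>D\<in>\<B>. B \<union> C \<subseteq> D"
    and dense: "closure (\<Union>\<B>) = UNIV" and C: "C \<in> \<B>"
  shows "\<exists>B. B 0 = C \<and> (\<forall>n. B n \<in> \<B>) \<and> (\<forall>n. B n \<subseteq> B (Suc n)) \<and> closure (\<Union>n. B n) = UNIV"
proof -
  obtain X :: "'a set" where X: "countable X" "closure X = UNIV"
    using sep by (auto simp: separable_space_def)
  have "X \<noteq> {}" using X(2) by auto
  define f where "f = from_nat_into X"
  have f: "X = range f" unfolding f_def using range_from_nat_into[OF \<open>X \<noteq> {}\<close> X(1)] by simp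
  have bound: "\<exists>D\<in>\<B>. B \<subseteq> D \<and> F \<subseteq> D" if "finite F" "F \<subseteq> \<Union>\<B>" "B \<in> \<B>" for F B
    using that
  proof (induction F rule: finite_induct)
    case empty
    then show ?case by blast
  next
    case (insert x F)
    then obtain D E where "D \<in> \<B>" "B \<subseteq> D" "F \<subseteq> D" "E \<in> \<B>" "x \<in> E" by blast
    moreover then obtain G where "G \<in> \<B>" "D \<union> E \<subseteq> G" using directed by blast
    ultimately show ?case by (intro bexI[of _ G]) auto
  qed
  have approx: "\<exists>b\<in>\<Union>\<B>. dist b x < e" if "0 < e" for x e
    using dense that closure_approachable[of x "\<Union>\<B>"] by auto
  have step: "\<exists>D. D \<in> \<B> \<and> B \<subseteq> D \<and> (\<forall>k\<le>n. \<exists>b\<in>D. dist b (f k) < 1 / real (Suc n))"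
    if B: "B \<in> \<B>" for B n
  proof -
    have "\<forall>k. \<exists>b\<in>\<Union>\<B>. dist b (f k) < 1 / real (Suc n)" using approx by simp
    then obtain b where b: "\<And>k. b k \<in> \<Union>\<B>" "\<And>k. dist (b k) (f k) < 1 / real (Suc n)" by metis
    have "\<exists>D\<in>\<B>. B \<subseteq> D \<and> b ` {..n} \<subseteq> D" by (rule bound) (use B b(1) in auto)
    then obtain D where "D \<in> \<B>" "B \<subseteq> D" "b ` {..n} \<subseteq> D" by blast
    then show ?thesis using b(2) by (intro exI[of _ D]) auto
  qed
  have "\<exists>B. \<forall>n. (B n \<in> \<B> \<and> (n = 0 \<longrightarrow> B n = C)) \<and>
    (B n \<subseteq> B (Suc n) \<and> (\<forall>k\<le>n. \<exists>b\<in>B (Suc n). dist b (f k) < 1 / real (Suc n)))"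
  proof (rule dependent_nat_choice)
    show "\<exists>D. D \<in> \<B> \<and> ((0::nat) = 0 \<longrightarrow> D = C)" using C by blast
    fix B and n :: nat assume "B \<in> \<B> \<and> (n = 0 \<longrightarrow> B = C)"
    then obtain D where "D \<in> \<B>" "B \<subseteq> D" "\<forall>k\<le>n. \<exists>b\<in>D. dist b (f k) < 1 / real (Suc n)"
      using step[of B n] by blast
    then show "\<exists>D. (D \<in> \<B> \<and> (Suc n = 0 \<longrightarrow> D = C)) \<and> B \<subseteq> D \<and>
        (\<forall>k\<le>n. \<exists>b\<in>D. dist b (f k) < 1 / real (Suc n))"
      by (intro exI[of _ D]) simp
  qed
  then obtain B where B': "\<forall>n. (B n \<in> \<B> \<and> (n = 0 \<longrightarrow> B n = C)) \<and>
    (B n \<subseteq> B (Suc n) \<and> (\<forall>k\<le>n. \<exists>b\<in>B (Suc n). dist b (f k) < 1 / real (Suc n)))"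
    by (rule exE)
  have B: "B n \<in> \<B>" "B 0 = C" "B n \<subseteq> B (Suc n)"
    "k \<le> n \<Longrightarrow> \<exists>b\<in>B (Suc n). dist b (f k) < 1 / real (Suc n)" for n k
    using spec[OF B', of n] spec[OF B', of 0] by simp_all
  have "f k \<in> closure (\<Union>n. B n)" for k
    unfolding closure_approachable
  proof (intro allI impI)
    fix e :: real assume "0 < e"
    then obtain n where n: "1 / real (Suc n) < e" using nat_approx_posE by blast
    define m where "m = max n k"
    have "\<exists>b\<in>B (Suc m). dist b (f k) < 1 / real (Suc m)" by (rule B(4)) (simp add: m_def)
    then obtain b where b: "b \<in> B (Suc m)" "dist b (f k) < 1 / real (Suc m)" by (rule bexE)
    have "1 / real (Suc m) \<le> 1 / real (Suc n)" by (simp add: m_def frac_le)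
    then show "\<exists>y\<in>\<Union>n. B n. dist y (f k) < e" using b n by (intro bexI[of _ b]) auto
  qed
  then have "X \<subseteq> closure (\<Union>n. B n)" by (auto simp: f)
  then have "closure X \<subseteq> closure (\<Union>n. B n)" by (simp add: closure_minimal)
  then have "closure (\<Union>n. B n) = UNIV" using X(2) by auto
  then show ?thesis using B(1,2,3) by blast
qed

text \<open>For an idempotent \<open>q\<close> of a subalgebra \<open>B\<close> this is the
  two-sided ideal of \<open>B\<close> generated by \<open>q\<close>; the products
  \<open>a * q * b\<close> already account for \<open>q\<close> itself.\<close>

definition corner_ideal :: "'a::cstar_algebra \<Rightarrow> 'a set \<Rightarrow> 'a set" where
  "corner_ideal q B = complex_vector.span {a * q * b | a b. a \<in> B \<and> b \<in> B}"

lemma corner_ideal_mono: "A \<subseteq> B \<Longrightarrow> corner_ideal q A \<subseteq> corner_ideal q B"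
  unfolding corner_ideal_def by (rule complex_vector.span_mono) (intro Collect_mono, auto)

lemma corner_ideal_props:
  fixes B :: "'a::cstar_algebra set"
  assumes B: "star_subalgebra B" and q: "q \<in> B" "q * q = q" "star q = q"
  shows "star_subalgebra (corner_ideal q B)" "corner_ideal q B \<subseteq> B"
    "\<And>x y. x \<in> B \<Longrightarrow> y \<in> corner_ideal q B \<Longrightarrow> x * y \<in> corner_ideal q B"
    "\<And>x y. x \<in> B \<Longrightarrow> y \<in> corner_ideal q B \<Longrightarrow> y * x \<in> corner_ideal q B"
    "q \<in> corner_ideal q B"
proof -
  let ?G = "{a * q * b | a b. a \<in> B \<and> b \<in> B}"
  have sp: "corner_ideal q B = complex_vector.span ?G" by (simp add: corner_ideal_def)
  note ss = complex_vector.subspace_span[of ?G]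
  have G: "?G \<subseteq> complex_vector.span ?G" by (rule complex_vector.span_superset)
  show sub: "corner_ideal q B \<subseteq> B"
    unfolding sp using star_subalgebra_mult[OF B] q(1)
    by (intro complex_vector.span_minimal star_subalgebra_subspace[OF B]) auto
  show left: "x * y \<in> corner_ideal q B" if x: "x \<in> B" and y: "y \<in> corner_ideal q B" for x y
  proof -
    have "complex_vector.subspace {y. x * y \<in> complex_vector.span ?G}"
      using ss by (auto simp: complex_vector.subspace_def ring_distribs mult_scaleC_right)
    moreover have "?G \<subseteq> {y. x * y \<in> complex_vector.span ?G}"
    proof clarsimp
      fix a b assume "a \<in> B" "b \<in> B"
      then have "(x * a) * q * b \<in> ?G" using star_subalgebra_mult[OF B x] by blast
      then show "x * (a * q * b) \<in> complex_vector.span ?G" using G by (auto simp: mult.assoc)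
    qed
    ultimately show ?thesis using complex_vector.span_minimal y unfolding sp by blast
  qed
  show right: "y * x \<in> corner_ideal q B" if x: "x \<in> B" and y: "y \<in> corner_ideal q B" for x y
  proof -
    have "complex_vector.subspace {y. y * x \<in> complex_vector.span ?G}"
      using ss by (auto simp: complex_vector.subspace_def ring_distribs mult_scaleC_left)
    moreover have "?G \<subseteq> {y. y * x \<in> complex_vector.span ?G}"
    proof clarsimp
      fix a b assume "a \<in> B" "b \<in> B"
      then have "a * q * (b * x) \<in> ?G" using star_subalgebra_mult[OF B _ x] by blast
      then show "a * q * b * x \<in> complex_vector.span ?G" using G by (auto simp: mult.assoc)
    qed
    ultimately show ?thesis using complex_vector.span_minimal y unfolding sp by blast
  qed
  show "q \<in> corner_ideal q B"
  proof -
    have "q * q * q \<in> ?G" using q(1) by blast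
    then show ?thesis using G q(2) unfolding sp by auto
  qed
  have star0: "star (0 :: 'a) = 0" using star_scaleC[of 0 "0::'a"] by simp
  have "star y \<in> corner_ideal q B" if y: "y \<in> corner_ideal q B" for y
  proof -
    have "complex_vector.subspace {y. star y \<in> complex_vector.span ?G}"
      using ss by (auto simp: complex_vector.subspace_def star_add star_scaleC star0)
    moreover have "?G \<subseteq> {y. star y \<in> complex_vector.span ?G}"
    proof clarsimp
      fix a b assume "a \<in> B" "b \<in> B"
      then have "star b * q * star a \<in> ?G" using star_subalgebra_star[OF B] by blast
      then show "star (a * q * b) \<in> complex_vector.span ?G" using G by (auto simp: mult.assoc star_mult q(3))
    qed
    ultimately show ?thesis using complex_vector.span_minimal y unfolding sp by blast
  qed
  then show "star_subalgebra (corner_ideal q B)"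
    unfolding star_subalgebra_def using ss left sub by (auto simp: sp)
qed

text \<open>Rewrite a q b as (a q) q (q b), where both outer factors lie in the ideal. So
  \<open>q\<close> also generates the ideal when the ideal is taken as the ambient algebra, the form
  in which nonzero rows are proved.\<close>

lemma corner_ideal_absorb:
  fixes B :: "'a::cstar_algebra set"
  assumes B: "star_subalgebra B" and q: "q \<in> B" "q * q = q" "star q = q"
  shows "corner_ideal q B \<subseteq> corner_ideal q (corner_ideal q B)"
  unfolding corner_ideal_def[of q B]
proof (rule complex_vector.span_minimal)
  show "{a * q * b |a b. a \<in> B \<and> b \<in> B} \<subseteq> corner_ideal q (complex_vector.span {a * q * b |a b. a \<in> B \<and> b \<in> B})"
  proof clarsimp
    fix a b assume ab: "a \<in> B" "b \<in> B"
    note pr = corner_ideal_props[OF B q]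
    have "a * q \<in> corner_ideal q B" "q * b \<in> corner_ideal q B" using pr(3,4,5) ab by auto
    moreover have "a * q * b = (a * q) * q * (q * b)" by (metis mult.assoc q(2))
    ultimately have "a * q * b \<in> {a * q * b |a b. a \<in> corner_ideal q B \<and> b \<in> corner_ideal q B}"
      by (simp only: mem_Collect_eq) metis
    then show "a * q * b \<in> corner_ideal q (complex_vector.span {a * q * b |a b. a \<in> B \<and> b \<in> B})"
      unfolding corner_ideal_def[of q B, symmetric] unfolding corner_ideal_def[of q "corner_ideal q B"]
      by (rule complex_vector.span_base)
  qed
qed (simp add: corner_ideal_def)

text \<open>If \<open>p\<close> is within distance less than 1 of a closed ideal \<open>J\<close> then \<open>p = p\<^sup>k \<in> J\<close>, since
  \<open>p\<^sup>k - (p - b)\<^sup>k \<in> J\<close> for \<open>b \<in> J\<close> and \<open>(p - b)\<^sup>k\<close> tends to 0.\<close>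

lemma idempotent_in_closed_ideal:
  fixes p :: "'a::cstar_algebra"
  assumes J: "complex_vector.subspace J" "closed J"
    and ideal: "\<And>x y. y \<in> J \<Longrightarrow> x * y \<in> J" "\<And>x y. y \<in> J \<Longrightarrow> y * x \<in> J"
    and p: "p * p = p" and b: "b \<in> J" "norm (p - b) < 1"
  shows "p \<in> J"
proof -
  \<comment> \<open>The power of \<open>p - b\<close> with exponent \<open>n + 1\<close>, formed
    without a unit.\<close>
  define y where "y n = ((\<lambda>z. (p - b) * z) ^^ n) (p - b)" for n
  have y: "y 0 = p - b" "y (Suc n) = (p - b) * y n" for n by (simp_all add: y_def)
  have "p - y n \<in> J" for n
  proof (induction n)
    case 0
    then show ?case using b by (simp add: y)
  next
    case (Suc n)
    have "p - y (Suc n) = p * (p - y n) + b * y n" by (simp add: y algebra_simps p)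
    moreover have "p * (p - y n) \<in> J" by (rule ideal(1)[OF Suc])
    moreover have "b * y n \<in> J" by (rule ideal(2)[OF b(1)])
    ultimately show ?case using complex_vector.subspace_add[OF J(1)] by simp
  qed
  moreover have "norm (y n) \<le> norm (p - b) ^ n * norm (p - b)" for n
  proof (induction n)
    case (Suc n)
    have "norm (y (Suc n)) \<le> norm (p - b) * norm (y n)" by (simp add: y norm_mult_ineq)
    also have "\<dots> \<le> norm (p - b) * (norm (p - b) ^ n * norm (p - b))" by (rule mult_left_mono[OF Suc]) simp
    finally show ?case by (simp add: mult_ac)
  qed (simp add: y)
  then have "y \<longlonglongrightarrow> 0"
  proof (intro Lim_null_comparison[of y "\<lambda>n. norm (p - b) ^ n * norm (p - b)"])
    show "(\<lambda>n. norm (p - b) ^ n * norm (p - b)) \<longlonglongrightarrow> 0"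
      using b(2) by (intro tendsto_mult_left_zero LIMSEQ_realpow_zero) auto
  qed auto
  then have "(\<lambda>n. p - y n) \<longlonglongrightarrow> p" using tendsto_diff[OF tendsto_const[of p], of y 0] by simp
  ultimately show ?thesis by (rule closed_sequentially[OF J(2)])
qed

text \<open>The closure \<open>J\<close> of the union is a closed two-sided ideal of the whole
  algebra. It contains \<open>q\<close>, hence \<open>b = q * b\<close>, hence the nearby idempotent
  \<open>p\<close>, and \<open>p\<close> generates everything.\<close>

lemma corner_ideal_dense:
  fixes B :: "nat \<Rightarrow> 'a::cstar_algebra set"
  assumes B: "\<And>n. star_subalgebra (B n)" "\<And>n. B n \<subseteq> B (Suc n)" "closure (\<Union>n. B n) = UNIV"
    and q: "q \<in> B 0" "\<And>x. x \<in> B 0 \<Longrightarrow> q * x = x" "star q = q"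
    and p: "full_projection p" and b: "b \<in> B 0" "norm (p - b) < 1"
  shows "closure (\<Union>n. corner_ideal q (B n)) = UNIV"
proof -
  have mono: "B n \<subseteq> B m" if "n \<le> m" for n m using lift_Suc_mono_le[of B, OF B(2) that] .
  have qB: "q \<in> B n" for n using q(1) mono[of 0 n] by auto
  have qq: "q * q = q" using q by simp
  note pr = corner_ideal_props[OF B(1) qB qq q(3)]
  define U where "U = (\<Union>n. corner_ideal q (B n))"
  have UI: "x \<in> U" if "x \<in> corner_ideal q (B n)" for x n using that by (auto simp: U_def)
  have UE: "\<exists>n. x \<in> corner_ideal q (B n)" if "x \<in> U" for x using that by (auto simp: U_def)
  have cmono: "corner_ideal q (B n) \<subseteq> corner_ideal q (B m)" if "n \<le> m" for n m
    by (rule corner_ideal_mono[OF mono[OF that]])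
  define J where "J = closure U"
  have Uadd: "x + y \<in> U" if xy: "x \<in> U" "y \<in> U" for x y
  proof -
    obtain n m where "x \<in> corner_ideal q (B n)" "y \<in> corner_ideal q (B m)"
      using UE[OF xy(1)] UE[OF xy(2)] by blast
    then have "x \<in> corner_ideal q (B (max n m))" "y \<in> corner_ideal q (B (max n m))"
      using cmono[of n "max n m"] cmono[of m "max n m"] by auto
    then show ?thesis by (rule UI[OF star_subalgebra_add[OF pr(1)]])
  qed
  have Usc: "c *\<^sub>C x \<in> U" if "x \<in> U" for x c
    using UE[OF that] UI star_subalgebra_scale[OF pr(1)] by blast
  have U_ideal: "x * y \<in> U" "y * x \<in> U" if xy: "x \<in> (\<Union>n. B n)" "y \<in> U" for x y
  proof -
    obtain n m where "x \<in> B n" "y \<in> corner_ideal q (B m)" using xy(1) UE[OF xy(2)] by blast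
    then have m: "x \<in> B (max n m)" "y \<in> corner_ideal q (B (max n m))"
      using mono[of n "max n m"] cmono[of m "max n m"] by auto
    show "x * y \<in> U" "y * x \<in> U" by (rule UI[OF pr(3)[OF m]], rule UI[OF pr(4)[OF m]])
  qed
  have Jseq: "\<exists>f. (\<forall>n. f n \<in> U) \<and> f \<longlonglongrightarrow> y" if "y \<in> J" for y
    using that unfolding J_def closure_sequential .
  have J_lim: "y \<in> J" if "\<forall>n. f n \<in> U" "f \<longlonglongrightarrow> y" for f y
    unfolding J_def closure_sequential using that by blast
  have Jsub: "complex_vector.subspace J"
    unfolding complex_vector.subspace_def
  proof (intro conjI ballI allI)
    have "0 \<in> U" by (rule UI[OF star_subalgebra_zero[OF pr(1)]])
    then show "0 \<in> J" unfolding J_def using closure_subset by blast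
    fix x y assume xy: "x \<in> J" "y \<in> J"
    obtain f where f: "\<forall>n. f n \<in> U" "f \<longlonglongrightarrow> x" using Jseq[OF xy(1)] by blast
    obtain g where g: "\<forall>n. g n \<in> U" "g \<longlonglongrightarrow> y" using Jseq[OF xy(2)] by blast
    show "x + y \<in> J"
      by (rule J_lim[OF _ tendsto_add[OF f(2) g(2)]]) (simp add: Uadd f(1) g(1))
  next
    fix c x assume x: "x \<in> J"
    obtain f where f: "\<forall>n. f n \<in> U" "f \<longlonglongrightarrow> x" using Jseq[OF x] by blast
    from bounded_linear.tendsto[OF bounded_linear_scaleC f(2)] show "c *\<^sub>C x \<in> J"
      by (rule J_lim[rotated]) (simp add: Usc f(1))
  qed
  have J_ideal: "x * y \<in> J" "y * x \<in> J" if y: "y \<in> J" for x y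
  proof -
    obtain f where f: "\<forall>n. f n \<in> U" "f \<longlonglongrightarrow> y" using Jseq[OF y] by blast
    have "x \<in> closure (\<Union>n. B n)" using B(3) by simp
    then obtain g where g: "\<forall>n. g n \<in> (\<Union>n. B n)" "g \<longlonglongrightarrow> x" unfolding closure_sequential by blast
    show "x * y \<in> J"
      by (rule J_lim[OF _ tendsto_mult[OF g(2) f(2)]]) (intro allI U_ideal(1) f(1)[rule_format] g(1)[rule_format])
    show "y * x \<in> J"
      by (rule J_lim[OF _ tendsto_mult[OF f(2) g(2)]]) (intro allI U_ideal(2) f(1)[rule_format] g(1)[rule_format])
  qed
  have qJ: "q \<in> J" unfolding J_def using UI[OF pr(5)] closure_subset by blast
  have "q * b \<in> J" by (rule J_ideal(2)[OF qJ])
  then have "b \<in> J" using q(2)[OF b(1)] by simp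
  then have "p \<in> J"
    using idempotent_in_closed_ideal[OF Jsub _ J_ideal _ _ b(2)] p
    by (auto simp: J_def full_projection_def)
  then have "{a * p * b | a b. True} \<subseteq> J" using J_ideal by blast
  then have "complex_vector.span {a * p * b | a b. True} \<subseteq> J"
    using complex_vector.span_minimal[OF _ Jsub] by blast
  then have "closure (complex_vector.span {a * p * b | a b. True}) \<subseteq> J"
    unfolding J_def by (rule closure_minimal) simp
  then show ?thesis using p by (auto simp: full_projection_def J_def U_def)
qed

lemma AF_sequence:
  fixes a :: "'a::cstar_algebra itself"
  assumes AF: "AF_algebra TYPE('a)" and sep: "separable_space (euclidean :: 'a topology)"
    and rfd: "residually_finite_dimensional TYPE('a)"
  obtains D :: "nat \<Rightarrow> 'a set" where "\<And>n. star_subalgebra (D n)" "\<And>n. finite_dim (D n)"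
    "incseq D" "closure (\<Union>n. D n) = UNIV"
    "(\<exists>p :: 'a. full_projection p) \<Longrightarrow> (\<exists>q\<in>D 0. \<forall>n. D n \<subseteq> corner_ideal q (D n))"
proof -
  obtain \<B> :: "'a set set" where \<B>': "\<B> \<noteq> {} \<and> (\<forall>B\<in>\<B>. cstar_subalgebra B \<and> finite_dim B) \<and>
     (\<forall>B\<in>\<B>. \<forall>C\<in>\<B>. \<exists>D\<in>\<B>. B \<union> C \<subseteq> D) \<and> closure (\<Union>\<B>) = UNIV"
    using AF unfolding AF_algebra_def by (rule exE)
  note \<B>1 = conjunct1[OF \<B>'] and \<B>2 = conjunct1[OF conjunct2[OF \<B>']]
    and \<B>3 = conjunct1[OF conjunct2[OF conjunct2[OF \<B>']]]
    and \<B>4 = conjunct2[OF conjunct2[OF conjunct2[OF \<B>']]]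
  have sub: "star_subalgebra B" "finite_dim B" if "B \<in> \<B>" for B
    using bspec[OF \<B>2 that] by (auto simp: cstar_subalgebra_def star_subalgebra_def)
  show ?thesis
  proof (cases "\<exists>p :: 'a. full_projection p")
    case False
    obtain C where "C \<in> \<B>" using \<B>1 by blast
    obtain B where B: "B 0 = C" "\<And>n. B n \<in> \<B>" "\<And>n. B n \<subseteq> B (Suc n)" "closure (\<Union>n. B n) = UNIV"
      using AF_increasing_sequence[OF sep \<B>3[rule_format] \<B>4 \<open>C \<in> \<B>\<close>] by auto
    show ?thesis
      by (rule that[of B]) (use False B sub in \<open>auto simp: incseq_Suc_iff\<close>)
  next
    case True
    then obtain p :: 'a where p: "full_projection p" ..
    have "p \<in> closure (\<Union>\<B>)" using \<B>4 by simp
    \<comment> \<open>Distance less than 1 is exactly what \<open>idempotent_in_closed_ideal\<close>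
      requires.\<close>
    then have "\<exists>b\<in>\<Union>\<B>. dist b p < 1" unfolding closure_approachable by simp
    then obtain b where b: "b \<in> \<Union>\<B>" "dist b p < 1" by (rule bexE)
    then obtain C where C: "C \<in> \<B>" "b \<in> C" by blast
    obtain B where B: "B 0 = C" "\<And>n. B n \<in> \<B>" "\<And>n. B n \<subseteq> B (Suc n)" "closure (\<Union>n. B n) = UNIV"
      using AF_increasing_sequence[OF sep \<B>3[rule_format] \<B>4 C(1)] by auto
    obtain q where q: "q \<in> C" "star q = q" "\<And>x. x \<in> C \<Longrightarrow> q * x = x"
      using star_subalgebra_unit[OF rfd sub[OF C(1)]] by metis
    have mono: "B n \<subseteq> B m" if "n \<le> m" for n m using lift_Suc_mono_le[of B, OF B(3) that] .
    have qB: "q \<in> B n" for n using q(1) mono[of 0 n] B(1) by auto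
    have qq: "q * q = q" using q by simp
    note Bs = sub[OF B(2)]
    note pr = corner_ideal_props[OF Bs(1) qB qq q(2)]
    show ?thesis
    proof (rule that[of "\<lambda>n. corner_ideal q (B n)"])
      show "star_subalgebra (corner_ideal q (B n))" for n by (rule pr(1))
      show "finite_dim (corner_ideal q (B n))" for n
        by (rule finite_dim_subspace[OF star_subalgebra_subspace[OF pr(1)] pr(2) Bs(2)])
      show "incseq (\<lambda>n. corner_ideal q (B n))"
        unfolding incseq_Suc_iff by (intro allI corner_ideal_mono B(3))
      show "closure (\<Union>n. corner_ideal q (B n)) = UNIV"
        by (rule corner_ideal_dense[OF Bs(1) B(3,4) _ _ q(2) p])
          (use q b C B(1) in \<open>auto simp: dist_norm norm_minus_commute\<close>)
      show "\<exists>q'\<in>corner_ideal q (B 0). \<forall>n. corner_ideal q (B n) \<subseteq> corner_ideal q' (corner_ideal q (B n))"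
        using pr(5) corner_ideal_absorb[OF Bs(1) qB qq q(2)] by blast
    qed
  qed
qed

section \<open>Finite dimensional *-subalgebras as direct sums\<close>

text \<open>Independence is surjectivity and faithfulness is injectivity of
  \<open>block_rep K\<close>, so \<open>D\<close> is identified with a direct sum of full matrix
  algebras.\<close>

definition block_system :: "'a::cstar_algebra set \<Rightarrow> (nat \<times> ('a \<Rightarrow> complex mat)) list \<Rightarrow> bool" where
  "block_system D K \<longleftrightarrow> star_subalgebra D \<and> independent_irreps D K \<and> faithful_irreps D K"

definition size_vec :: "(nat \<times> ('a \<Rightarrow> complex mat)) list \<Rightarrow> int vec" where
  "size_vec K = vec (length K) (\<lambda>i. int (fst (K ! i)))"

definition block_rep :: "(nat \<times> ('a \<Rightarrow> complex mat)) list \<Rightarrow> 'a \<Rightarrow> nat \<Rightarrow> complex mat" where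
  "block_rep K x = (\<lambda>i\<in>{..<length K}. snd (K ! i) x)"

definition block_elem :: "'a set \<Rightarrow> (nat \<times> ('a \<Rightarrow> complex mat)) list \<Rightarrow> (nat \<Rightarrow> complex mat) \<Rightarrow> 'a" where
  "block_elem D K = inv_into D (block_rep K)"

lemma size_vec_simps [simp]:
  "dim_vec (size_vec K) = length K" "i < length K \<Longrightarrow> size_vec K $ i = int (fst (K ! i))"
  "i < length K \<Longrightarrow> block_size (size_vec K) i = fst (K ! i)"
  by (simp_all add: size_vec_def block_size_def)

lemma direct_sum_elems:
  "elems (direct_sum_algebra (size_vec K)) = (\<Pi>\<^sub>E i\<in>{..<length K}. carrier_mat (fst (K ! i)) (fst (K ! i)))"
  by (auto simp: direct_sum_algebra_def intro!: PiE_cong)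

lemma block_system_rep:
  assumes "block_system D K" "i < length K"
  shows "rep_on D (fst (K ! i)) (snd (K ! i))" "0 < fst (K ! i)"
  using assms independent_irreps_rep by (auto simp: block_system_def)

lemma block_system_eqI:
  assumes D: "block_system D K" and xy: "x \<in> D" "y \<in> D"
    and eq: "\<And>i. i < length K \<Longrightarrow> snd (K ! i) x = snd (K ! i) y"
  shows "x = y"
proof -
  have B: "star_subalgebra D" using D by (simp add: block_system_def)
  have "snd (K ! i) (x - y) = 0\<^sub>m (fst (K ! i)) (fst (K ! i))" if i: "i < length K" for i
    using rep_diff[OF block_system_rep(1)[OF D i] B xy] eq[OF i]
      rep_carrier[OF block_system_rep(1)[OF D i] xy(2)] by auto
  then have "x - y = 0"
    using D star_subalgebra_diff[OF B xy] by (auto simp: block_system_def faithful_irreps_def)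
  then show ?thesis by simp
qed

lemma block_rep_bij:
  assumes D: "block_system D K"
  shows "bij_betw (block_rep K) D (elems (direct_sum_algebra (size_vec K)))"
  unfolding bij_betw_def
proof
  show "inj_on (block_rep K) D"
  proof (rule inj_onI)
    fix x y assume xy: "x \<in> D" "y \<in> D" "block_rep K x = block_rep K y"
    show "x = y"
    proof (rule block_system_eqI[OF D xy(1,2)])
      fix i assume "i < length K"
      then show "snd (K ! i) x = snd (K ! i) y"
        using fun_cong[OF xy(3), of i] by (simp add: block_rep_def)
    qed
  qed
  have "block_rep K x \<in> elems (direct_sum_algebra (size_vec K))" if "x \<in> D" for x
    using rep_carrier[OF block_system_rep(1)[OF D] that] by (auto simp: direct_sum_elems block_rep_def)
  moreover have "y \<in> block_rep K ` D" if y: "y \<in> elems (direct_sum_algebra (size_vec K))" for y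
  proof -
    have y': "y \<in> (\<Pi>\<^sub>E i\<in>{..<length K}. carrier_mat (fst (K ! i)) (fst (K ! i)))"
      using y by (simp add: direct_sum_elems)
    have ind: "independent_irreps D K" using D by (simp add: block_system_def)
    have "\<exists>b\<in>D. \<forall>i<length K. snd (K ! i) b = y i"
      by (rule independent_irreps_solve[OF ind]) (use y' in auto)
    then obtain b where b: "b \<in> D" "\<And>i. i < length K \<Longrightarrow> snd (K ! i) b = y i" by blast
    have "block_rep K b = y"
    proof (rule ext)
      fix i show "block_rep K b i = y i"
        using b(2)[of i] PiE_arb[OF y', of i] by (simp add: block_rep_def)
    qed
    then show ?thesis using b(1) by blast
  qed
  ultimately show "block_rep K ` D = elems (direct_sum_algebra (size_vec K))" by blast
qed

lemma block_elem_props: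
  assumes D: "block_system D K"
  shows block_elem_in: "a \<in> elems (direct_sum_algebra (size_vec K)) \<Longrightarrow> block_elem D K a \<in> D"
    and block_rep_elem: "a \<in> elems (direct_sum_algebra (size_vec K)) \<Longrightarrow> block_rep K (block_elem D K a) = a"
    and block_elem_rep: "x \<in> D \<Longrightarrow> block_elem D K (block_rep K x) = x"
    and block_rep_in: "x \<in> D \<Longrightarrow> block_rep K x \<in> elems (direct_sum_algebra (size_vec K))"
  using block_rep_bij[OF D] unfolding block_elem_def bij_betw_def
  by (auto intro: inv_into_into f_inv_into_f inv_into_f_f)

lemma block_rep_star_hom:
  assumes D: "block_system D K"
  shows "star_hom (subalgebra_on D) (direct_sum_algebra (size_vec K)) (block_rep K)"
  using block_rep_in[OF D] block_system_rep(1)[OF D]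
  by (auto simp: star_hom_def subalgebra_on_def whole_algebra_def direct_sum_algebra_def
      block_rep_def rep_on_iff restrict_def fun_eq_iff)

lemma block_elem_star_hom:
  assumes D: "block_system D K"
  shows "star_hom (direct_sum_algebra (size_vec K)) whole_algebra (block_elem D K)"
proof -
  let ?X = "direct_sum_algebra (size_vec K)"
  note hom = block_rep_star_hom[OF D]
  have B: "star_subalgebra D" using D by (simp add: block_system_def)
  note pr = block_elem_props[OF D]
  have hadd: "block_rep K (x + y) = add_op ?X (block_rep K x) (block_rep K y)"
    and hmult: "block_rep K (x * y) = mult_op ?X (block_rep K x) (block_rep K y)"
    and hsc: "block_rep K (c *\<^sub>C x) = scale_op ?X c (block_rep K x)"
    and hstar: "block_rep K (star x) = star_op ?X (block_rep K x)" if "x \<in> D" "y \<in> D" for x y c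
    using hom that by (auto simp: star_hom_def subalgebra_on_def whole_algebra_def)
  show ?thesis
    unfolding star_hom_def
  proof (intro conjI ballI allI)
    fix a assume a: "a \<in> elems ?X"
    note aD = pr(1)[OF a]
    show "block_elem D K a \<in> elems whole_algebra" by (simp add: whole_algebra_def)
    show "block_elem D K (star_op ?X a) = star_op whole_algebra (block_elem D K a)"
      using pr(3)[OF star_subalgebra_star[OF B aD]] hstar[OF aD aD] pr(2)[OF a]
      by (simp add: whole_algebra_def)
    fix c show "block_elem D K (scale_op ?X c a) = scale_op whole_algebra c (block_elem D K a)"
      using pr(3)[OF star_subalgebra_scale[OF B aD]] hsc[OF aD aD] pr(2)[OF a]
      by (simp add: whole_algebra_def)
  next
    fix a b assume a: "a \<in> elems ?X" and b: "b \<in> elems ?X"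
    note aD = pr(1)[OF a] and bD = pr(1)[OF b]
    show "block_elem D K (add_op ?X a b) = add_op whole_algebra (block_elem D K a) (block_elem D K b)"
      using pr(3)[OF star_subalgebra_add[OF B aD bD]] hadd[OF aD bD] pr(2)[OF a] pr(2)[OF b]
      by (simp add: whole_algebra_def)
    show "block_elem D K (mult_op ?X a b) = mult_op whole_algebra (block_elem D K a) (block_elem D K b)"
      using pr(3)[OF star_subalgebra_mult[OF B aD bD]] hmult[OF aD bD] pr(2)[OF a] pr(2)[OF b]
      by (simp add: whole_algebra_def)
  qed
qed

section \<open>Uniqueness of the C*-norm on a stage\<close>

lemma le_of_powers_le:
  fixes a b M :: real
  assumes a: "0 \<le> a" and b: "0 \<le> b" and le: "\<And>n. a ^ (2 ^ n) \<le> M * b ^ (2 ^ n)"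
  shows "a \<le> b"
proof (rule ccontr)
  assume "\<not> a \<le> b"
  then have ab: "b < a" by simp
  show False
  proof (cases "b = 0")
    case True
    then show False using le[of 0] ab by simp
  next
    case False
    then have b0: "0 < b" using b by simp
    have "1 < a / b" using ab b0 by simp
    then obtain n where n: "M < (a / b) ^ n" using real_arch_pow by blast
    \<comment> \<open>Only exponents that are powers of two are available, since they come from
      iterated squaring.\<close>
    have "(a / b) ^ n \<le> (a / b) ^ (2 ^ n)"
      using \<open>1 < a / b\<close> by (intro power_increasing) (auto intro: less_imp_le less_exp)
    also have "\<dots> \<le> M" using le[of n] b0 by (simp add: power_divide divide_le_eq)
    finally show False using n by simp
  qed
qed

text \<open>For the empty list this is a maximum over the empty set, which explains the condition
  \<open>K \<noteq> []\<close> in the results on this norm.\<close>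

definition block_norm :: "(nat \<times> ('a \<Rightarrow> complex mat)) list \<Rightarrow> 'a \<Rightarrow> real" where
  "block_norm K x = Max ((\<lambda>i. operator_norm (snd (K ! i) x)) ` {..<length K})"

lemma norm_op_block_rep:
  "norm_op (direct_sum_algebra (size_vec K)) (block_rep K x) = block_norm K x"
  by (auto simp: direct_sum_algebra_def block_norm_def block_rep_def intro!: arg_cong[of _ _ Max] image_cong)

lemma block_norm_ge: "i < length K \<Longrightarrow> operator_norm (snd (K ! i) x) \<le> block_norm K x"
  unfolding block_norm_def by (rule Max_ge) auto

lemma block_norm_attained:
  assumes "K \<noteq> []" obtains i where "i < length K" "block_norm K x = operator_norm (snd (K ! i) x)"
proof -
  have "block_norm K x \<in> (\<lambda>i. operator_norm (snd (K ! i) x)) ` {..<length K}"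
    unfolding block_norm_def using assms by (intro Max_in) (auto simp: lessThan_empty_iff)
  then show ?thesis using that by auto
qed

lemma block_norm_cstar:
  assumes D: "block_system D K" and K: "K \<noteq> []" and x: "x \<in> D"
  shows "block_norm K (star x * x) = (block_norm K x)\<^sup>2"
proof (rule antisym)
  have B: "star_subalgebra D" using D by (simp add: block_system_def)
  have eq: "operator_norm (snd (K ! i) (star x * x)) = (operator_norm (snd (K ! i) x))\<^sup>2"
    if i: "i < length K" for i
  proof -
    note rep = block_system_rep(1)[OF D i]
    show ?thesis
      using operator_norm_cstar[OF rep_carrier[OF rep x]]
      by (simp add: rep_mult[OF rep star_subalgebra_star[OF B x] x] rep_star[OF rep x])
  qed
  have nn: "0 \<le> operator_norm (snd (K ! i) x)" if i: "i < length K" for i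
    by (rule operator_norm_nonneg[OF rep_carrier[OF block_system_rep(1)[OF D i] x]])
  obtain i where i: "i < length K" "block_norm K (star x * x) = operator_norm (snd (K ! i) (star x * x))"
    using block_norm_attained[OF K] .
  show "block_norm K (star x * x) \<le> (block_norm K x)\<^sup>2"
    unfolding i(2) eq[OF i(1)] by (rule power_mono[OF block_norm_ge[OF i(1)] nn[OF i(1)]])
  obtain j where j: "j < length K" "block_norm K x = operator_norm (snd (K ! j) x)"
    using block_norm_attained[OF K] .
  show "(block_norm K x)\<^sup>2 \<le> block_norm K (star x * x)"
    unfolding j(2) eq[OF j(1), symmetric] by (rule block_norm_ge[OF j(1)])
qed

lemma block_norm_nonneg:
  assumes D: "block_system D K" and K: "K \<noteq> []" and x: "x \<in> D"
  shows "0 \<le> block_norm K x"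
proof -
  obtain i where i: "i < length K" "block_norm K x = operator_norm (snd (K ! i) x)"
    using block_norm_attained[OF K] .
  then show ?thesis
    using operator_norm_nonneg[OF rep_carrier[OF block_system_rep(1)[OF D i(1)] x]] by simp
qed

text \<open>One estimate expands \<open>x\<close> in the lifted matrix units \<open>e\<close>. The
  other uses that \<open>e (l, i, i) * x * e (l, j, j)\<close> is the entry \<open>(i, j)\<close> of
  block \<open>l\<close> times \<open>e (l, i, j)\<close>, which bounds every entry by the norm of
  \<open>x\<close>.\<close>

lemma block_norm_equivalent:
  assumes D: "block_system D K" and K: "K \<noteq> []"
  obtains M where "\<And>x. x \<in> D \<Longrightarrow> norm x \<le> M * block_norm K x"
    "\<And>x. x \<in> D \<Longrightarrow> block_norm K x \<le> M * norm x" "0 \<le> M"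
proof -
  have B: "star_subalgebra D" and ind: "independent_irreps D K" and faith: "faithful_irreps D K"
    using D by (auto simp: block_system_def)
  let ?S = "coord_indices K"
  obtain e where e: "\<And>s. s \<in> ?S \<Longrightarrow> e s \<in> D"
    and ek: "\<And>l i j k. (l, i, j) \<in> ?S \<Longrightarrow> k < length K \<Longrightarrow> snd (K ! k) (e (l, i, j)) =
      (if k = l then unit_matrix (fst (K ! k)) (fst (K ! k)) i j else 0\<^sub>m (fst (K ! k)) (fst (K ! k)))"
    and ee: "\<And>s t. s \<in> ?S \<Longrightarrow> t \<in> ?S \<Longrightarrow> coord K t (e s) = of_bool (s = t)"
    using independent_irreps_units[OF ind] by blast
  have idx: "l < length K" "i < fst (K ! l)" "j < fst (K ! l)" if "(l, i, j) \<in> ?S" for l i j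
    using that by (auto simp: coord_indices_def)
  have idxI: "(l, i, j) \<in> ?S" if "l < length K" "i < fst (K ! l)" "j < fst (K ! l)" for l i j
    using that by (auto simp: coord_indices_def)
  define M1 where "M1 = (\<Sum>s\<in>?S. norm (e s))"
  have le1: "norm x \<le> M1 * block_norm K x" if x: "x \<in> D" for x
  proof -
    have "norm x = norm (\<Sum>s\<in>?S. coord K s x *\<^sub>C e s)"
      using faithful_expand[OF ind B faith e ee x] by simp
    also have "\<dots> \<le> (\<Sum>s\<in>?S. norm (coord K s x *\<^sub>C e s))" by (rule norm_sum)
    also have "\<dots> \<le> (\<Sum>s\<in>?S. block_norm K x * norm (e s))"
    proof (rule sum_mono)
      fix s assume s: "s \<in> ?S"
      obtain l i j where lij: "s = (l, i, j)" by (metis prod.exhaust)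
      note ix = idx[OF s[unfolded lij]]
      have "cmod (coord K s x) \<le> operator_norm (snd (K ! l) x)"
        using entry_le_operator_norm[OF rep_carrier[OF block_system_rep(1)[OF D ix(1)] x] ix(2,3)]
        by (simp add: coord_def lij)
      also have "\<dots> \<le> block_norm K x" by (rule block_norm_ge[OF ix(1)])
      finally show "norm (coord K s x *\<^sub>C e s) \<le> block_norm K x * norm (e s)"
        by (simp add: norm_scaleC mult_right_mono)
    qed
    finally show ?thesis by (simp add: M1_def sum_distrib_left mult.commute)
  qed
  \<comment> \<open>The constant that submultiplicativity yields for the sandwich of
    \<open>x\<close> between two diagonal units. For valid indices the denominator is nonzero
    because \<open>e (l, i, j)\<close> has a coordinate equal to 1.\<close>
  define C where "C l i j = norm (e (l, i, i)) * norm (e (l, j, j)) / norm (e (l, i, j))" for l i j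
  have entry: "cmod (snd (K ! l) x $$ (i, j)) \<le> C l i j * norm x"
    if x: "x \<in> D" and l: "l < length K" and ij: "i < fst (K ! l)" "j < fst (K ! l)" for x l i j
  proof -
    let ?y = "e (l, i, i) * x * e (l, j, j)"
    note ii = e[OF idxI[OF l ij(1) ij(1)]] and jj = e[OF idxI[OF l ij(2) ij(2)]] and eij = e[OF idxI[OF l ij]]
    have ix: "e (l, i, i) * x \<in> D" and yD: "?y \<in> D" using star_subalgebra_mult[OF B] ii jj x by auto
    have "?y = snd (K ! l) x $$ (i, j) *\<^sub>C e (l, i, j)"
    proof (rule block_system_eqI[OF D yD star_subalgebra_scale[OF B eij]])
      fix k assume k: "k < length K"
      note rep = block_system_rep(1)[OF D k]
      note c = rep_carrier[OF rep x]
      have "snd (K ! k) ?y = snd (K ! k) (e (l, i, i)) * snd (K ! k) x * snd (K ! k) (e (l, j, j))"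
        by (simp add: rep_mult[OF rep ix jj] rep_mult[OF rep ii x])
      then show "snd (K ! k) ?y = snd (K ! k) (snd (K ! l) x $$ (i, j) *\<^sub>C e (l, i, j))"
        using unit_matrix_sandwich[of "snd (K ! l) x" "fst (K ! l)" i i j j] c ij k
        by (cases "k = l") (auto simp: ek idxI l ij rep_scale[OF rep eij]
            rep_scale[OF block_system_rep(1)[OF D l] eij])
    qed
    then have "cmod (snd (K ! l) x $$ (i, j)) * norm (e (l, i, j)) = norm ?y" by (simp add: norm_scaleC)
    also have "\<dots> \<le> norm (e (l, i, i)) * norm x * norm (e (l, j, j))"
      using norm_mult_ineq[of "e (l, i, i) * x" "e (l, j, j)"] norm_mult_ineq[of "e (l, i, i)" x]
      by (meson mult_right_mono norm_ge_zero order_trans)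
    finally have le: "cmod (snd (K ! l) x $$ (i, j)) * norm (e (l, i, j)) \<le> norm (e (l, i, i)) * norm x * norm (e (l, j, j))" .
    have "coord K (l, i, j) (e (l, i, j)) = 1" using ee idxI[OF l ij] by simp
    moreover have "coord K (l, i, j) 0 = 0"
      using rep_zero[OF block_system_rep(1)[OF D l] B] ij by (simp add: coord_def)
    ultimately have "e (l, i, j) \<noteq> 0" by force
    then show ?thesis using le by (simp add: C_def field_simps)
  qed
  define M2 where "M2 = (\<Sum>l<length K. \<Sum>i<fst (K ! l). \<Sum>j<fst (K ! l). C l i j)"
  have Cnn: "0 \<le> C l i j" for l i j by (simp add: C_def)
  have le2: "block_norm K x \<le> M2 * norm x" if x: "x \<in> D" for x
  proof -
    obtain l where l: "l < length K" "block_norm K x = operator_norm (snd (K ! l) x)"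
      using block_norm_attained[OF K] .
    have "block_norm K x \<le> (\<Sum>i<fst (K ! l). \<Sum>j<fst (K ! l). cmod (snd (K ! l) x $$ (i, j)))"
      unfolding l(2) by (rule operator_norm_le_entries[OF rep_carrier[OF block_system_rep(1)[OF D l(1)] x]])
    also have "\<dots> \<le> (\<Sum>i<fst (K ! l). \<Sum>j<fst (K ! l). C l i j * norm x)"
      using entry[OF x l(1)] by (intro sum_mono) auto
    also have "\<dots> = (\<Sum>i<fst (K ! l). \<Sum>j<fst (K ! l). C l i j) * norm x"
      by (simp add: sum_distrib_right)
    also have "\<dots> \<le> M2 * norm x"
      unfolding M2_def using l(1) Cnn
      by (intro mult_right_mono member_le_sum[of l "{..<length K}" "\<lambda>l. \<Sum>i<fst (K ! l). \<Sum>j<fst (K ! l). C l i j"]) (auto intro!: sum_nonneg)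
    finally show ?thesis .
  qed
  have M1: "0 \<le> M1" by (simp add: M1_def sum_nonneg)
  have M2: "0 \<le> M2" unfolding M2_def using Cnn by (intro sum_nonneg)
  show ?thesis
  proof (rule that[of "M1 + M2"])
    fix x assume x: "x \<in> D"
    have "0 \<le> M2 * block_norm K x" using M2 block_norm_nonneg[OF D K x] by simp
    then show "norm x \<le> (M1 + M2) * block_norm K x" using le1[OF x] by (simp add: distrib_right)
    have "0 \<le> M1 * norm x" using M1 by simp
    then show "block_norm K x \<le> (M1 + M2) * norm x" using le2[OF x] by (simp add: distrib_right)
  qed (use M1 M2 in simp)
qed

text \<open>Both norms satisfy \<open>\<parallel>h\<^sup>2\<parallel> = \<parallel>h\<parallel>\<^sup>2\<close> for self-adjoint \<open>h\<close>, so equivalence of the norms on the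
  iterated squares of \<open>h\<close> forces equality.\<close>

lemma block_norm_eq:
  assumes D: "block_system D K" and K: "K \<noteq> []" and x: "x \<in> D"
  shows "block_norm K x = norm x"
proof -
  have B: "star_subalgebra D" using D by (simp add: block_system_def)
  obtain M where M: "\<And>x. x \<in> D \<Longrightarrow> norm x \<le> M * block_norm K x"
    "\<And>x. x \<in> D \<Longrightarrow> block_norm K x \<le> M * norm x"
    using block_norm_equivalent[OF D K] by metis
  \<comment> \<open>A self-adjoint element; the C*-identities of both norms carry the equality from
    \<open>h\<close> back to \<open>x\<close>.\<close>
  define h where "h = star x * x"
  define p where "p n = ((\<lambda>z. z * z) ^^ n) h" for n
  have p: "p 0 = h" "p (Suc n) = p n * p n" for n by (simp_all add: p_def)
  have pD: "p n \<in> D \<and> star (p n) = p n" for n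
  proof (induction n)
    case 0
    then show ?case using star_subalgebra_mult[OF B star_subalgebra_star[OF B x] x]
      by (simp add: p h_def star_mult star_star)
  next
    case (Suc n)
    then show ?case using star_subalgebra_mult[OF B] by (simp add: p star_mult)
  qed
  have np: "norm (p n) = norm h ^ (2 ^ n)" for n
  proof (induction n)
    case (Suc n)
    have "norm (p (Suc n)) = (norm (p n))\<^sup>2"
      using cstar_identity[of "p n"] pD[of n] by (simp add: p)
    then show ?case using Suc by (simp add: power_mult[symmetric] mult.commute)
  qed (simp add: p)
  have bp: "block_norm K (p n) = block_norm K h ^ (2 ^ n)" for n
  proof (induction n)
    case (Suc n)
    have "block_norm K (p (Suc n)) = (block_norm K (p n))\<^sup>2"
      using block_norm_cstar[OF D K, of "p n"] pD[of n] by (simp add: p)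
    then show ?case using Suc by (simp add: power_mult[symmetric] mult.commute)
  qed (simp add: p)
  have hD: "h \<in> D" using pD[of 0] p by simp
  have nn: "0 \<le> block_norm K h" by (rule block_norm_nonneg[OF D K hD])
  have "norm h \<le> block_norm K h"
    by (rule le_of_powers_le[of _ _ M]) (use M(1) pD np bp nn in \<open>auto simp flip: np bp\<close>)
  moreover have "block_norm K h \<le> norm h"
    by (rule le_of_powers_le[of _ _ M]) (use M(2) pD np bp nn in \<open>auto simp flip: np bp\<close>)
  ultimately have "(norm x)\<^sup>2 = (block_norm K x)\<^sup>2"
    using cstar_identity[of x] block_norm_cstar[OF D K x] by (simp add: h_def)
  then show ?thesis using block_norm_nonneg[OF D K x] by (simp add: power2_eq_iff_nonneg)
qed

lemma norm_block_elem:
  assumes D: "block_system D K" and K: "K \<noteq> []" and a: "a \<in> elems (direct_sum_algebra (size_vec K))"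
  shows "norm_op (direct_sum_algebra (size_vec K)) a = norm (block_elem D K a)"
  using norm_op_block_rep[of K "block_elem D K a"] block_norm_eq[OF D K block_elem_in[OF D a]]
    block_rep_elem[OF D a] by simp

section \<open>Multiplicities of inclusions\<close>

definition part :: "'a set \<Rightarrow> (nat \<times> ('a \<Rightarrow> complex mat)) list \<Rightarrow> nat \<Rightarrow> complex mat \<Rightarrow> 'a" where
  "part D K k x = block_elem D K (summand_embedding (size_vec K) k x)"

lemma summand_embedding_in:
  assumes "k < length K" "x \<in> carrier_mat (fst (K ! k)) (fst (K ! k))"
  shows "summand_embedding (size_vec K) k x \<in> elems (direct_sum_algebra (size_vec K))"
  using assms by (auto simp: direct_sum_elems summand_embedding_def)

lemma part_props:
  assumes D: "block_system D K" and k: "k < length K" and x: "x \<in> carrier_mat (fst (K ! k)) (fst (K ! k))"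
  shows part_in: "part D K k x \<in> D"
    and rep_part: "i < length K \<Longrightarrow> snd (K ! i) (part D K k x) = (if i = k then x else 0\<^sub>m (fst (K ! i)) (fst (K ! i)))"
proof -
  note se = summand_embedding_in[OF k x]
  show "part D K k x \<in> D" unfolding part_def by (rule block_elem_in[OF D se])
  assume i: "i < length K"
  have "block_rep K (part D K k x) i = summand_embedding (size_vec K) k x i"
    unfolding part_def block_rep_elem[OF D se] ..
  then show "snd (K ! i) (part D K k x) = (if i = k then x else 0\<^sub>m (fst (K ! i)) (fst (K ! i)))"
    using i by (simp add: block_rep_def summand_embedding_def)
qed

text \<open>This element is the central projection of summand \<open>k\<close>. A later
  representation that does not kill it has nonzero multiplicity on that summand.\<close>

lemma part_one_nonzero:
  assumes D: "block_system D K" and k: "k < length K"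
  shows "part D K k (1\<^sub>m (fst (K ! k))) \<noteq> 0"
proof
  let ?one = "1\<^sub>m (fst (K ! k)) :: complex mat"
  have one: "?one \<in> carrier_mat (fst (K ! k)) (fst (K ! k))" by simp
  assume "part D K k ?one = 0"
  then have "snd (K ! k) 0 = ?one" using rep_part[OF D k one k] by simp
  moreover have "snd (K ! k) 0 = 0\<^sub>m (fst (K ! k)) (fst (K ! k))"
    using rep_zero[OF block_system_rep(1)[OF D k]] D by (simp add: block_system_def)
  ultimately have "?one $$ (0, 0) = 0\<^sub>m (fst (K ! k)) (fst (K ! k)) $$ (0, 0)" by simp
  then show False using block_system_rep(2)[OF D k] by simp
qed

lemma partial_map_star_hom:
  assumes D: "block_system D K" and k: "k < length K" and \<sigma>: "rep_on D e \<sigma>"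
  shows "star_hom (matrix_algebra (fst (K ! k))) (matrix_algebra e) (\<lambda>x. \<sigma> (part D K k x))"
proof -
  let ?d = "fst (K ! k)" and ?P = "part D K k"
  have B: "star_subalgebra D" using D by (simp add: block_system_def)
  note pin = part_in[OF D k] and rp = rep_part[OF D k]
  note rep = block_system_rep(1)[OF D]
  have add: "?P (x + y) = ?P x + ?P y" if x: "x \<in> carrier_mat ?d ?d" and y: "y \<in> carrier_mat ?d ?d" for x y
  proof (rule block_system_eqI[OF D pin star_subalgebra_add[OF B pin[OF x] pin[OF y]]])
    fix i assume i: "i < length K"
    show "snd (K ! i) (?P (x + y)) = snd (K ! i) (?P x + ?P y)"
      using x y i by (simp add: rep_add[OF rep[OF i] pin[OF x] pin[OF y]] rp)
  qed (use x y in auto)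
  have mult: "?P (x * y) = ?P x * ?P y" if x: "x \<in> carrier_mat ?d ?d" and y: "y \<in> carrier_mat ?d ?d" for x y
  proof (rule block_system_eqI[OF D pin star_subalgebra_mult[OF B pin[OF x] pin[OF y]]])
    fix i assume i: "i < length K"
    show "snd (K ! i) (?P (x * y)) = snd (K ! i) (?P x * ?P y)"
      using x y i mult_carrier_mat[OF x y] by (simp add: rep_mult[OF rep[OF i] pin[OF x] pin[OF y]] rp)
  qed (use x y in auto)
  have sc: "?P (c \<cdot>\<^sub>m x) = c *\<^sub>C ?P x" if x: "x \<in> carrier_mat ?d ?d" for c x
  proof (rule block_system_eqI[OF D pin star_subalgebra_scale[OF B pin[OF x]]])
    fix i assume i: "i < length K"
    show "snd (K ! i) (?P (c \<cdot>\<^sub>m x)) = snd (K ! i) (c *\<^sub>C ?P x)"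
      using x i by (simp add: rep_scale[OF rep[OF i] pin[OF x]] rp)
  qed (use x in auto)
  have st: "?P (mat_adjoint x) = star (?P x)" if x: "x \<in> carrier_mat ?d ?d" for x
  proof (rule block_system_eqI[OF D pin star_subalgebra_star[OF B pin[OF x]]])
    fix i assume i: "i < length K"
    show "snd (K ! i) (?P (mat_adjoint x)) = snd (K ! i) (star (?P x))"
      using x i by (simp add: rep_star[OF rep[OF i] pin[OF x]] rp)
  qed (use x in auto)
  show ?thesis
    unfolding star_hom_def matrix_algebra_def
    using rep_carrier[OF \<sigma> pin] rep_add[OF \<sigma> pin pin] rep_mult[OF \<sigma> pin pin] rep_scale[OF \<sigma> pin]
      rep_star[OF \<sigma> pin] by (simp add: add mult sc st)
qed

text \<open>The conjugation drops out of the trace, so a multiplicity can be read off from the image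
  of the unit.\<close>

lemma has_multiplicity_trace:
  assumes m: "has_multiplicity p q f c"
  shows "mat_tr (f (1\<^sub>m p)) = of_nat (c * p)"
proof -
  obtain U where U: "unitary_mat q U" and cq: "c * p \<le> q"
    and fx: "f (1\<^sub>m p) = U * diag_block_mat (replicate c (1\<^sub>m p) @ [0\<^sub>m (q - c * p) (q - c * p)]) * mat_adjoint U"
    using m by (auto simp: has_multiplicity_def)
  define E where "E = diag_block_mat (replicate c (1\<^sub>m p) @ [0\<^sub>m (q - c * p) (q - c * p)] :: complex mat list)"
  have E: "E = mat q q (\<lambda>(i, j). if i < c * p \<and> j < c * p \<and> i div p = j div p then 1\<^sub>m p $$ (i mod p, j mod p) else 0)"
    using cq unfolding E_def by (subst diag_block_replicate) auto
  then have Ec: "E \<in> carrier_mat q q" by simp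
  have Uc: "U \<in> carrier_mat q q" "mat_adjoint U * U = 1\<^sub>m q" using U by (auto simp: unitary_mat_def)
  have "mat_tr (f (1\<^sub>m p)) = mat_tr (mat_adjoint U * (U * E))"
    unfolding fx E_def[symmetric]
    by (rule mat_tr_mult_commute[OF mult_carrier_mat[OF Uc(1) Ec] mat_adjoint_carrier[OF Uc(1)]])
  also have "mat_adjoint U * (U * E) = (mat_adjoint U * U) * E"
    using Uc(1) Ec by (simp add: mat_assoc)
  also have "\<dots> = E" using Uc(2) Ec by simp
  also have "mat_tr E = (\<Sum>i<q. if i < c * p then 1 else 0)"
    unfolding mat_tr_def
  proof (rule sum.cong)
    fix i assume "i \<in> {..<q}"
    then show "E $$ (i, i) = (if i < c * p then 1 else 0)"
      by (cases "p = 0") (auto simp: E)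
  qed (use Ec in auto)
  also have "\<dots> = (\<Sum>i<c * p. 1)"
    using cq by (intro sum.mono_neutral_cong_right) auto
  finally show ?thesis by simp
qed

lemma has_multiplicity_zero:
  assumes "has_multiplicity p q f 0" "x \<in> carrier_mat p p"
  shows "f x = 0\<^sub>m q q"
  using assms by (auto simp: has_multiplicity_def unitary_mat_def)

text \<open>For the positive sizes of a block system the trace formula determines the number, so the
  choice is unambiguous.\<close>

definition multiplicity_of ::
  "'a set \<Rightarrow> (nat \<times> ('a \<Rightarrow> complex mat)) list \<Rightarrow> (nat \<times> ('a \<Rightarrow> complex mat)) list \<Rightarrow> nat \<Rightarrow> nat \<Rightarrow> nat" where
  "multiplicity_of D K K' l k =
     (SOME c. has_multiplicity (fst (K ! k)) (fst (K' ! l)) (\<lambda>x. snd (K' ! l) (part D K k x)) c)"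

definition transition_mat ::
  "'a set \<Rightarrow> (nat \<times> ('a \<Rightarrow> complex mat)) list \<Rightarrow> (nat \<times> ('a \<Rightarrow> complex mat)) list \<Rightarrow> int mat" where
  "transition_mat D K K' = mat (length K') (length K) (\<lambda>(l, k). int (multiplicity_of D K K' l k))"

context
  fixes D D' :: "'a::cstar_algebra set" and K K'
  assumes D: "block_system D K" and D': "block_system D' K'" and DD': "D \<subseteq> D'"
begin

lemma multiplicity_of_has:
  assumes "k < length K" "l < length K'"
  shows "has_multiplicity (fst (K ! k)) (fst (K' ! l)) (\<lambda>x. snd (K' ! l) (part D K k x)) (multiplicity_of D K K' l k)"
  unfolding multiplicity_of_def
  using star_hom_has_multiplicity[OF partial_map_star_hom[OF D assms(1)
        rep_on_subset[OF block_system_rep(1)[OF D' assms(2)] DD']] block_system_rep(2)[OF D assms(1)]]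
  by (rule someI_ex)

lemma multiplicity_of_eq_0:
  assumes "k < length K" "l < length K'" "multiplicity_of D K K' l k = 0" "x \<in> carrier_mat (fst (K ! k)) (fst (K ! k))"
  shows "snd (K' ! l) (part D K k x) = 0\<^sub>m (fst (K' ! l)) (fst (K' ! l))"
  using has_multiplicity_zero[of _ _ "\<lambda>x. snd (K' ! l) (part D K k x)"] multiplicity_of_has[OF assms(1,2)] assms(3,4)
  by simp

text \<open>Position \<open>l\<close> carries the same representation at both stages. It sends the
  unit of summand \<open>k\<close> to the identity or to zero; compare traces and cancel the
  size.\<close>

lemma multiplicity_of_shared:
  assumes k: "k < length K" and l: "l < length K" "l < length K'" "K' ! l = K ! l"
  shows "multiplicity_of D K K' l k = (if l = k then 1 else 0)"
proof -
  let ?c = "multiplicity_of D K K' l k" and ?d = "fst (K ! k)"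
  note m = multiplicity_of_has[OF k l(2)]
  have one: "(1\<^sub>m ?d :: complex mat) \<in> carrier_mat ?d ?d" by simp
  have "snd (K' ! l) (part D K k (1\<^sub>m ?d)) = (if l = k then 1\<^sub>m ?d else 0\<^sub>m (fst (K ! l)) (fst (K ! l)))"
    using rep_part[OF D k one l(1)] l(3) by simp
  then have "(of_nat (?c * ?d) :: complex) = mat_tr (if l = k then 1\<^sub>m ?d else 0\<^sub>m (fst (K ! l)) (fst (K ! l)))"
    using has_multiplicity_trace[OF m] by simp
  also have "\<dots> = of_nat (if l = k then ?d else 0)" by (simp add: mat_tr_def)
  finally have "?c * ?d = (if l = k then ?d else 0)" using of_nat_eq_iff by blast
  then show ?thesis using block_system_rep(2)[OF D k] by (auto split: if_splits)
qed

text \<open>If the whole column vanished, every representation of the later stage would kill the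
  nonzero central projection of summand \<open>k\<close>, against faithfulness.\<close>

lemma transition_column_nonzero:
  assumes k: "k < length K"
  shows "\<exists>l<length K'. multiplicity_of D K K' l k \<noteq> 0"
proof (rule ccontr)
  assume none: "\<not> ?thesis"
  let ?one = "1\<^sub>m (fst (K ! k)) :: complex mat"
  have B': "star_subalgebra D'" using D' by (simp add: block_system_def)
  have one: "?one \<in> carrier_mat (fst (K ! k)) (fst (K ! k))" by simp
  have "part D K k ?one = 0"
  proof (rule block_system_eqI[OF D'])
    show "part D K k ?one \<in> D'" using part_in[OF D k one] DD' by blast
    show "0 \<in> D'" by (rule star_subalgebra_zero[OF B'])
    fix l assume l: "l < length K'"
    show "snd (K' ! l) (part D K k ?one) = snd (K' ! l) 0"
      using multiplicity_of_eq_0[OF k l _ one] none l rep_zero[OF block_system_rep(1)[OF D' l] B'] by simp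
  qed
  then show False using part_one_nonzero[OF D k] by simp
qed

text \<open>\<open>q\<close> is the unit of the first \<open>m\<close> summands. Adding one summand
  adds one term to its trace under representation \<open>l\<close>.\<close>

lemma partial_units:
  assumes l: "l < length K'" and m: "m \<le> length K"
  shows "\<exists>q\<in>D. (\<forall>i<length K. snd (K ! i) q = (if i < m then 1\<^sub>m (fst (K ! i)) else 0\<^sub>m (fst (K ! i)) (fst (K ! i)))) \<and>
    mat_tr (snd (K' ! l) q) = of_nat (\<Sum>k<m. multiplicity_of D K K' l k * fst (K ! k))"
  using m
proof (induction m)
  case 0
  have B: "star_subalgebra D" using D by (simp add: block_system_def)
  show ?case
  proof (intro bexI[of _ 0] conjI allI impI)
    show "snd (K ! i) 0 = (if i < 0 then 1\<^sub>m (fst (K ! i)) else 0\<^sub>m (fst (K ! i)) (fst (K ! i)))" if "i < length K" for i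
      using rep_zero[OF block_system_rep(1)[OF D that] B] by simp
    show "mat_tr (snd (K' ! l) 0) = of_nat (\<Sum>k<0. multiplicity_of D K K' l k * fst (K ! k))"
      using rep_zero[OF block_system_rep(1)[OF D' l]] D' by (simp add: block_system_def mat_tr_def)
  qed (rule star_subalgebra_zero[OF B])
next
  case (Suc m)
  then obtain q where q: "q \<in> D"
    "\<And>i. i < length K \<Longrightarrow> snd (K ! i) q = (if i < m then 1\<^sub>m (fst (K ! i)) else 0\<^sub>m (fst (K ! i)) (fst (K ! i)))"
    "mat_tr (snd (K' ! l) q) = of_nat (\<Sum>k<m. multiplicity_of D K K' l k * fst (K ! k))"
    by auto
  have B: "star_subalgebra D" using D by (simp add: block_system_def)
  have mk: "m < length K" using Suc by simp
  let ?p = "part D K m (1\<^sub>m (fst (K ! m)))"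
  have one: "(1\<^sub>m (fst (K ! m)) :: complex mat) \<in> carrier_mat (fst (K ! m)) (fst (K ! m))" by simp
  note p = part_in[OF D mk one]
  have qp: "q \<in> D'" "?p \<in> D'" using q(1) p DD' by auto
  note rep' = block_system_rep(1)[OF D' l]
  show ?case
  proof (intro bexI[of _ "q + ?p"] conjI allI impI)
    fix i assume i: "i < length K"
    show "snd (K ! i) (q + ?p) = (if i < Suc m then 1\<^sub>m (fst (K ! i)) else 0\<^sub>m (fst (K ! i)) (fst (K ! i)))"
      using rep_add[OF block_system_rep(1)[OF D i] q(1) p] q(2)[OF i] rep_part[OF D mk one i] by auto
  next
    have "mat_tr (snd (K' ! l) (q + ?p)) = mat_tr (snd (K' ! l) q) + mat_tr (snd (K' ! l) ?p)"
      using rep_add[OF rep' qp] rep_carrier[OF rep' qp(1)] rep_carrier[OF rep' qp(2)]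
      by (simp add: mat_tr_def sum.distrib)
    also have "mat_tr (snd (K' ! l) ?p) = of_nat (multiplicity_of D K K' l m * fst (K ! m))"
      using has_multiplicity_trace[OF multiplicity_of_has[OF mk l]] by simp
    finally show "mat_tr (snd (K' ! l) (q + ?p))
        = of_nat (\<Sum>k<Suc m. multiplicity_of D K K' l k * fst (K ! k))"
      using q(3) by simp
  qed (rule star_subalgebra_add[OF B q(1) p])
qed

text \<open>The left side is the trace of the image of the unit of \<open>D\<close>, which is a
  projection in a matrix algebra of size \<open>fst (K' ! l)\<close>.\<close>

lemma multiplicity_sum_le:
  assumes l: "l < length K'"
  shows "(\<Sum>k<length K. multiplicity_of D K K' l k * fst (K ! k)) \<le> fst (K' ! l)"
proof -
  have B: "star_subalgebra D" using D by (simp add: block_system_def)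
  obtain q where q: "q \<in> D" "\<And>i. i < length K \<Longrightarrow> snd (K ! i) q = 1\<^sub>m (fst (K ! i))"
    "mat_tr (snd (K' ! l) q) = of_nat (\<Sum>k<length K. multiplicity_of D K K' l k * fst (K ! k))"
    using partial_units[OF l order_refl] by auto
  have qq: "q * q = q"
    by (rule block_system_eqI[OF D star_subalgebra_mult[OF B q(1) q(1)] q(1)])
      (simp add: rep_mult[OF block_system_rep(1)[OF D] q(1) q(1)] q(2))
  have qs: "star q = q"
    by (rule block_system_eqI[OF D star_subalgebra_star[OF B q(1)] q(1)])
      (simp add: rep_star[OF block_system_rep(1)[OF D] q(1)] q(2))
  have qD': "q \<in> D'" using q(1) DD' by blast
  note rep' = block_system_rep(1)[OF D' l]
  have "projection_mat (fst (K' ! l)) (snd (K' ! l) q)"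
    using rep_carrier[OF rep' qD'] rep_mult[OF rep' qD' qD'] rep_star[OF rep' qD'] qq qs
    by (simp add: projection_mat_def)
  from projection_mat_tr_le[OF this] have "real (\<Sum>k<length K. multiplicity_of D K K' l k * fst (K ! k)) \<le> fst (K' ! l)"
    unfolding q(3) by simp
  then show ?thesis using of_nat_le_iff by blast
qed

lemma rep_zero_of_multiplicity_zero:
  assumes l: "l < length K'" and zero: "\<And>k. k < length K \<Longrightarrow> multiplicity_of D K K' l k = 0"
    and y: "y \<in> D"
  shows "snd (K' ! l) y = 0\<^sub>m (fst (K' ! l)) (fst (K' ! l))"
proof -
  have B: "star_subalgebra D" and B': "star_subalgebra D'" using D D' by (auto simp: block_system_def)
  note rep' = block_system_rep(1)[OF D' l]
  \<comment> \<open>Generalized to elements supported on the first \<open>m\<close> summands; each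
    step peels off the last of them, on which the multiplicity vanishes.\<close>
  have "snd (K' ! l) y = 0\<^sub>m (fst (K' ! l)) (fst (K' ! l))"
    if "m \<le> length K" "y \<in> D" "\<And>i. i < length K \<Longrightarrow> m \<le> i \<Longrightarrow> snd (K ! i) y = 0\<^sub>m (fst (K ! i)) (fst (K ! i))" for m y
    using that
  proof (induction m arbitrary: y)
    case 0
    have "y = 0"
      by (rule block_system_eqI[OF D 0(2) star_subalgebra_zero[OF B]])
        (use 0(3) rep_zero[OF block_system_rep(1)[OF D] B] in simp)
    then show ?case using rep_zero[OF rep' B'] by simp
  next
    case (Suc m)
    have mk: "m < length K" using Suc by simp
    note c = rep_carrier[OF block_system_rep(1)[OF D mk] Suc.prems(2)]
    let ?p = "part D K m (snd (K ! m) y)"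
    note p = part_in[OF D mk c]
    have d: "y - ?p \<in> D" by (rule star_subalgebra_diff[OF B Suc.prems(2) p])
    have "snd (K' ! l) (y - ?p) = 0\<^sub>m (fst (K' ! l)) (fst (K' ! l))"
    proof (rule Suc.IH[OF _ d])
      fix i assume i: "i < length K" "m \<le> i"
      note ci = rep_carrier[OF block_system_rep(1)[OF D i(1)] Suc.prems(2)]
      show "snd (K ! i) (y - ?p) = 0\<^sub>m (fst (K ! i)) (fst (K ! i))"
        using rep_diff[OF block_system_rep(1)[OF D i(1)] B Suc.prems(2) p] rep_part[OF D mk c i(1)]
          Suc.prems(3)[OF i(1)] i(2) ci c by (cases "i = m") auto
    qed (use mk in simp)
    moreover have "snd (K' ! l) ?p = 0\<^sub>m (fst (K' ! l)) (fst (K' ! l))"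
      by (rule multiplicity_of_eq_0[OF mk l zero[OF mk] c])
    moreover have "snd (K' ! l) y = snd (K' ! l) (y - ?p) + snd (K' ! l) ?p"
      using rep_add[OF rep', of "y - ?p" ?p] d p DD' by auto
    ultimately show ?case by simp
  qed
  from this[OF order_refl y] show ?thesis by simp
qed

text \<open>With a zero row, representation \<open>l\<close> would kill \<open>D\<close>, hence
  \<open>q\<close>, hence the ideal that \<open>q\<close> generates in \<open>D'\<close>. That ideal
  is all of \<open>D'\<close>, on which the representation is onto a nonzero matrix algebra.\<close>

lemma transition_row_nonzero:
  assumes l: "l < length K'" and q: "q \<in> D" and full: "D' \<subseteq> corner_ideal q D'"
  shows "\<exists>k<length K. multiplicity_of D K K' l k \<noteq> 0"
proof (rule ccontr)
  assume "\<not> ?thesis"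
  then have "\<And>k. k < length K \<Longrightarrow> multiplicity_of D K K' l k = 0" by blast
  from rep_zero_of_multiplicity_zero[OF l this q]
  have q0: "snd (K' ! l) q = 0\<^sub>m (fst (K' ! l)) (fst (K' ! l))" by simp
  have B': "star_subalgebra D'" using D' by (simp add: block_system_def)
  note rep' = block_system_rep(1)[OF D' l]
  let ?d = "fst (K' ! l)"
  let ?Z = "{x \<in> D'. snd (K' ! l) x = 0\<^sub>m ?d ?d}"
  have sub: "complex_vector.subspace ?Z"
    unfolding complex_vector.subspace_def
    using star_subalgebra_zero[OF B'] star_subalgebra_add[OF B'] star_subalgebra_scale[OF B']
      rep_zero[OF rep' B'] rep_add[OF rep'] rep_scale[OF rep']
    by auto
  have "a * q * b \<in> ?Z" if ab: "a \<in> D'" "b \<in> D'" for a b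
  proof -
    have qD': "q \<in> D'" using q DD' by blast
    have aq: "a * q \<in> D'" by (rule star_subalgebra_mult[OF B' ab(1) qD'])
    have "snd (K' ! l) (a * q * b) = snd (K' ! l) a * snd (K' ! l) q * snd (K' ! l) b"
      by (simp add: rep_mult[OF rep' aq ab(2)] rep_mult[OF rep' ab(1) qD'])
    then have "snd (K' ! l) (a * q * b) = 0\<^sub>m ?d ?d"
      using q0 rep_carrier[OF rep' ab(1)] rep_carrier[OF rep' ab(2)] by simp
    then show ?thesis using star_subalgebra_mult[OF B' aq ab(2)] by simp
  qed
  then have "corner_ideal q D' \<subseteq> ?Z"
    unfolding corner_ideal_def by (intro complex_vector.span_minimal[OF _ sub]) auto
  then have "D' \<subseteq> ?Z" using full by blast
  moreover have "irrep_on D' ?d (snd (K' ! l))"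
    using independent_irreps_irrep[OF _ l] D' by (auto simp: block_system_def)
  then have "1\<^sub>m ?d \<in> snd (K' ! l) ` D'" by (simp add: irrep_on_def)
  ultimately have "(1\<^sub>m ?d :: complex mat) = 0\<^sub>m ?d ?d" by auto
  then have "(1\<^sub>m ?d :: complex mat) $$ (0, 0) = 0\<^sub>m ?d ?d $$ (0, 0)" by simp
  then show False using block_system_rep(2)[OF D' l] by simp
qed

lemma transition_mat_entry:
  "l < length K' \<Longrightarrow> k < length K \<Longrightarrow> transition_mat D K K' $$ (l, k) = int (multiplicity_of D K K' l k)"
  by (simp add: transition_mat_def)

lemma transition_has_multiplicity_matrix:
  "has_multiplicity_matrix (size_vec K) (size_vec K') (\<lambda>a. block_rep K' (block_elem D K a)) (transition_mat D K K')"
  unfolding has_multiplicity_matrix_def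
proof (intro allI impI)
  fix k l assume "k < dim_vec (size_vec K)" "l < dim_vec (size_vec K')"
  then have kl: "k < length K" "l < length K'" by auto
  have "(\<lambda>x. block_rep K' (block_elem D K (summand_embedding (size_vec K) k x)) l)
      = (\<lambda>x. snd (K' ! l) (part D K k x))"
    using kl by (simp add: block_rep_def part_def fun_eq_iff)
  then show "has_multiplicity (block_size (size_vec K) k) (block_size (size_vec K') l)
      (\<lambda>x. block_rep K' (block_elem D K (summand_embedding (size_vec K) k x)) l)
      (nat (transition_mat D K K' $$ (l, k)))"
    using multiplicity_of_has[OF kl] kl by (simp add: transition_mat_entry)
qed

lemma transition_order_unit: "transition_mat D K K' *\<^sub>v size_vec K \<le> size_vec K'"
  unfolding less_eq_vec_def
proof (intro conjI allI impI)
  show "dim_vec (transition_mat D K K' *\<^sub>v size_vec K) = dim_vec (size_vec K')"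
    by (simp add: transition_mat_def)
  fix l assume "l < dim_vec (size_vec K')"
  then have l: "l < length K'" by simp
  have T: "transition_mat D K K' \<in> carrier_mat (length K') (length K)" by (simp add: transition_mat_def)
  have "(transition_mat D K K' *\<^sub>v size_vec K) $ l = (\<Sum>k<length K. transition_mat D K K' $$ (l, k) * size_vec K $ k)"
    using l by (intro mult_mat_vec_entry[OF T]) (auto intro!: carrier_vecI)
  also have "\<dots> = int (\<Sum>k<length K. multiplicity_of D K K' l k * fst (K ! k))"
    using l by (simp add: transition_mat_entry)
  also have "\<dots> \<le> int (fst (K' ! l))" using multiplicity_sum_le[OF l] by (simp only: of_nat_le_iff)
  finally show "(transition_mat D K K' *\<^sub>v size_vec K) $ l \<le> size_vec K' $ l" using l by simp
qed

end

section \<open>Realization by simplicial sequences\<close>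

definition detects :: "(nat \<times> ('a \<Rightarrow> complex mat)) list \<Rightarrow> 'a \<Rightarrow> bool" where
  "detects L x \<longleftrightarrow> (\<exists>l<length L. snd (L ! l) x \<noteq> 0\<^sub>m (fst (L ! l)) (fst (L ! l)))"

text \<open>An element \<open>x0\<close> killed by \<open>L\<close> forces at least one new
  representation. \<open>L @ M\<close> consists of representations of the whole algebra that stay
  independent on a late stage, whereas the completion \<open>R\<close> consists of representations
  of that stage alone.\<close>

lemma next_stage:
  fixes D :: "nat \<Rightarrow> 'a::cstar_algebra set"
  assumes rfd: "residually_finite_dimensional TYPE('a)" and inf: "\<not> finite_dim (UNIV :: 'a set)"
    and D: "\<And>n. star_subalgebra (D n)" "\<And>n. finite_dim (D n)" "incseq D" "closure (\<Union>n. D n) = UNIV"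
    and L: "independent_irreps UNIV L" and X: "finite X" "0 \<notin> X"
  shows "\<exists>N\<ge>N0. \<exists>M R. M \<noteq> [] \<and> independent_irreps UNIV (L @ M) \<and> (\<forall>x\<in>X. detects (L @ M) x) \<and>
    block_system (D N) ((L @ M) @ R)"
proof -
  have "\<not> faithful_irreps UNIV L" by (rule infinite_dim_not_faithful[OF inf L])
  then obtain x0 where x0: "x0 \<noteq> 0" "\<not> detects L x0" by (auto simp: faithful_irreps_def detects_def)
  have "\<exists>M. independent_irreps UNIV (L @ M) \<and> (\<forall>x\<in>insert x0 X. \<exists>l<length (L @ M).
      snd ((L @ M) ! l) x \<noteq> 0\<^sub>m (fst ((L @ M) ! l)) (fst ((L @ M) ! l)))"
    by (rule independent_irreps_detect[OF star_subalgebra_UNIV rfd_irrep_separates[OF rfd star_subalgebra_UNIV] L])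
      (use X x0 in auto)
  then obtain M where M: "independent_irreps UNIV (L @ M)" "\<And>x. x \<in> insert x0 X \<Longrightarrow> detects (L @ M) x"
    unfolding detects_def by blast
  have "M \<noteq> []" using M(2)[of x0] x0(2) by auto
  obtain N1 where N1: "\<And>n. N1 \<le> n \<Longrightarrow> independent_irreps (D n) (L @ M)"
    using independent_irreps_dense[OF D(1,3,4) M(1)] by blast
  define N where "N = max N0 N1"
  have "independent_irreps (D N) (L @ M)" by (rule N1) (simp add: N_def)
  then obtain R where "independent_irreps (D N) ((L @ M) @ R)" "faithful_irreps (D N) ((L @ M) @ R)"
    using independent_irreps_complete[OF D(1,2) rfd_irrep_separates[OF rfd D(1)]] by metis
  then have "block_system (D N) ((L @ M) @ R)" using D(1) by (simp add: block_system_def)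
  then show ?thesis
    using M \<open>M \<noteq> []\<close> by (intro exI[of _ N] conjI exI[of _ M] exI[of _ R]) (auto simp: N_def)
qed

text \<open>At each step the elements to be detected are the central projections of all summands of
  the current stage. This will give the nonzero columns of the middle block.\<close>

lemma stages_exist:
  fixes D :: "nat \<Rightarrow> 'a::cstar_algebra set"
  assumes rfd: "residually_finite_dimensional TYPE('a)" and inf: "\<not> finite_dim (UNIV :: 'a set)"
    and D: "\<And>n. star_subalgebra (D n)" "\<And>n. finite_dim (D n)" "incseq D" "closure (\<Union>n. D n) = UNIV"
  shows "\<exists>(N :: nat \<Rightarrow> nat) L R. \<forall>n. n \<le> N n \<and> N n \<le> N (Suc n) \<and> L n \<noteq> [] \<and>
    block_system (D (N n)) (L n @ R n) \<and> (\<exists>M. M \<noteq> [] \<and> L (Suc n) = L n @ M) \<and>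
    (\<forall>k<length (L n @ R n). detects (L (Suc n)) (part (D (N n)) (L n @ R n) k (1\<^sub>m (fst ((L n @ R n) ! k)))))"
proof -
  \<comment> \<open>The condition \<open>n \<le> N\<close> keeps the chosen stages cofinal, so their
    union is still dense.\<close>
  define P where "P n s \<longleftrightarrow> (case s of (N, L, R) \<Rightarrow> n \<le> N \<and> L \<noteq> [] \<and> independent_irreps UNIV L \<and>
    block_system (D N) (L @ R))" for n :: nat and s :: "nat \<times> (nat \<times> ('a \<Rightarrow> complex mat)) list \<times> (nat \<times> ('a \<Rightarrow> complex mat)) list"
  define Q where "Q s t \<longleftrightarrow> (case s of (N, L, R) \<Rightarrow> case t of (N', L', R') \<Rightarrow> N \<le> N' \<and>
    (\<exists>M. M \<noteq> [] \<and> L' = L @ M) \<and>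
    (\<forall>k<length (L @ R). detects L' (part (D N) (L @ R) k (1\<^sub>m (fst ((L @ R) ! k))))))"
    for s t :: "nat \<times> (nat \<times> ('a \<Rightarrow> complex mat)) list \<times> (nat \<times> ('a \<Rightarrow> complex mat)) list"
  have "\<exists>f. \<forall>n. P n (f n) \<and> Q (f n) (f (Suc n))"
  proof (rule dependent_nat_choice)
    obtain N M R where "M \<noteq> []" "independent_irreps UNIV ([] @ M)" "block_system (D N) (([] @ M) @ R)"
      using next_stage[OF rfd inf D independent_irreps_Nil[OF star_subalgebra_UNIV], of "{}" 0] by auto
    then have "P 0 (N, M, R)" by (simp add: P_def)
    then show "\<exists>s. P 0 s" by blast
  next
    fix s n assume s: "P n s"
    obtain N L R where NLR: "s = (N, L, R)" by (metis prod.exhaust)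
    have L: "n \<le> N" "L \<noteq> []" "independent_irreps UNIV L" "block_system (D N) (L @ R)"
      using s by (auto simp: P_def NLR)
    let ?X = "(\<lambda>k. part (D N) (L @ R) k (1\<^sub>m (fst ((L @ R) ! k)))) ` {..<length (L @ R)}"
    have "0 \<notin> ?X" using part_one_nonzero[OF L(4)] by (metis (no_types, lifting) imageE lessThan_iff)
    then obtain N' M R' where N': "Suc N \<le> N'" "M \<noteq> []" "independent_irreps UNIV (L @ M)"
      "\<forall>x\<in>?X. detects (L @ M) x" "block_system (D N') ((L @ M) @ R')"
      using next_stage[OF rfd inf D L(3) _ \<open>0 \<notin> ?X\<close>, of "Suc N"] by auto
    have "P (Suc n) (N', L @ M, R')" using N' L by (simp add: P_def)
    moreover have "Q s (N', L @ M, R')" using N' by (auto simp: Q_def NLR)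
    ultimately show "\<exists>t. P (Suc n) t \<and> Q s t" by blast
  qed
  then obtain f where f: "\<And>n. P n (f n)" "\<And>n. Q (f n) (f (Suc n))" by blast
  show ?thesis
  proof (rule exI[of _ "\<lambda>n. fst (f n)"], rule exI[of _ "\<lambda>n. fst (snd (f n))"],
      rule exI[of _ "\<lambda>n. snd (snd (f n))"], rule allI)
    fix n
    obtain N L R where 1: "f n = (N, L, R)" by (metis prod.exhaust)
    obtain N' L' R' where 2: "f (Suc n) = (N', L', R')" by (metis prod.exhaust)
    show "n \<le> fst (f n) \<and> fst (f n) \<le> fst (f (Suc n)) \<and> fst (snd (f n)) \<noteq> [] \<and>
      block_system (D (fst (f n))) (fst (snd (f n)) @ snd (snd (f n))) \<and>
      (\<exists>M. M \<noteq> [] \<and> fst (snd (f (Suc n))) = fst (snd (f n)) @ M) \<and>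
      (\<forall>k<length (fst (snd (f n)) @ snd (snd (f n))). detects (fst (snd (f (Suc n))))
        (part (D (fst (f n))) (fst (snd (f n)) @ snd (snd (f n))) k
          (1\<^sub>m (fst ((fst (snd (f n)) @ snd (snd (f n))) ! k)))))"
      using f(1)[of n] f(2)[of n] unfolding P_def Q_def 1 2 by simp
  qed
qed

text \<open>Only the first \<open>r\<close> rows are prescribed, and only the middle right block
  must have nonzero columns; the lower blocks are cut out of \<open>A\<close> as they are.\<close>

lemma blocks_of_matrix:
  fixes A :: "int mat"
  assumes A: "A \<in> carrier_mat m' m" and r: "r \<le> r'" "r \<le> m" "r' \<le> m'"
    and top: "\<And>i j. i < r \<Longrightarrow> j < m \<Longrightarrow> A $$ (i, j) = of_bool (i = j)"
    and nz: "\<And>k. r \<le> k \<Longrightarrow> k < m \<Longrightarrow> \<exists>l. r \<le> l \<and> l < r' \<and> A $$ (l, k) \<noteq> 0"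
  shows "\<exists>A21 A22 A31 A32. A21 \<in> carrier_mat (r' - r) r \<and> A22 \<in> carrier_mat (r' - r) (m - r) \<and>
    A31 \<in> carrier_mat (m' - r') r \<and> A32 \<in> carrier_mat (m' - r') (m - r) \<and>
    A = four_block_mat (1\<^sub>m r) (0\<^sub>m r (m - r)) (A21 @\<^sub>r A31) (A22 @\<^sub>r A32) \<and>
    (\<forall>j<m - r. col A22 j \<noteq> 0\<^sub>v (r' - r))"
proof -
  define A21 where "A21 = mat (r' - r) r (\<lambda>(i, j). A $$ (r + i, j))"
  define A22 where "A22 = mat (r' - r) (m - r) (\<lambda>(i, j). A $$ (r + i, r + j))"
  define A31 where "A31 = mat (m' - r') r (\<lambda>(i, j). A $$ (r' + i, j))"
  define A32 where "A32 = mat (m' - r') (m - r) (\<lambda>(i, j). A $$ (r' + i, r + j))"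
  note defs = A21_def A22_def A31_def A32_def
  have "A = four_block_mat (1\<^sub>m r) (0\<^sub>m r (m - r)) (A21 @\<^sub>r A31) (A22 @\<^sub>r A32)" (is "_ = ?F")
  proof (rule eq_matI)
    have d22: "dim_row (A22 @\<^sub>r A32) = (r' - r) + (m' - r')" "dim_col (A22 @\<^sub>r A32) = m - r"
      by (simp_all add: append_rows_def defs)
    have dims: "dim_row ?F = r + ((r' - r) + (m' - r'))" "dim_col ?F = r + (m - r)"
      by (simp_all add: d22)
    show "dim_row A = dim_row ?F" "dim_col A = dim_col ?F" using A r by (auto simp: d22)
    fix i j assume "i < dim_row ?F" "j < dim_col ?F"
    then have ij: "i < m'" "j < m" using r by (auto simp: d22)
    show "A $$ (i, j) = ?F $$ (i, j)"
    proof (cases "i < r")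
      case True
      then show ?thesis using ij r top[OF True ij(2)] by (auto simp: append_rows_def defs)
    next
      case False
      have "r + (i - r) = i" "r + (j - r) = j" if "\<not> j < r" using False that by auto
      moreover have "r' + (i - r - (r' - r)) = i" if "\<not> i < r'" using that r by auto
      ultimately show ?thesis using ij r False by (auto simp: append_rows_def defs)
    qed
  qed
  moreover have "col A22 j \<noteq> 0\<^sub>v (r' - r)" if j: "j < m - r" for j
  proof
    assume c: "col A22 j = 0\<^sub>v (r' - r)"
    obtain l where l: "r \<le> l" "l < r'" "A $$ (l, r + j) \<noteq> 0" using nz[of "r + j"] j by (auto simp: less_diff_conv add.commute)
    have "r + (l - r) = l" using l by simp
    then have "col A22 j $ (l - r) = A $$ (l, r + j)" using l j by (simp add: A22_def)
    then show False using c l by simp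
  qed
  ultimately show ?thesis
    by (intro exI[of _ A21] exI[of _ A22] exI[of _ A31] exI[of _ A32]) (simp add: defs)
qed

text \<open>The stages are the subalgebras \<open>D (N n)\<close> with the lists
  \<open>L n @ R n\<close>. The connecting maps are the inclusions and the maps to the limit the
  embeddings, both transported to direct sums of matrix algebras.\<close>

theorem rfd_AF_realization:
  assumes AF: "AF_algebra TYPE('a::cstar_algebra)" and sep: "separable_space (euclidean :: 'a topology)"
    and inf: "\<not> finite_dim (UNIV :: 'a set)" and rfd: "residually_finite_dimensional TYPE('a)"
  shows "\<exists>m u A. simplicial_sequence m u A \<and> property_RFD m u A \<and>
    associated_AF_algebra TYPE('a) u A \<and> ((\<exists>p :: 'a. full_projection p) \<longrightarrow> nonzero_rows m A)"
proof -
  obtain D :: "nat \<Rightarrow> 'a set" where D: "\<And>n. star_subalgebra (D n)" "\<And>n. finite_dim (D n)"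
    "incseq D" "closure (\<Union>n. D n) = UNIV"
    and full: "(\<exists>p :: 'a. full_projection p) \<Longrightarrow> (\<exists>q\<in>D 0. \<forall>n. D n \<subseteq> corner_ideal q (D n))"
    using AF_sequence[OF AF sep rfd] by blast
  obtain N L R where NLR: "\<forall>n. n \<le> N n \<and> N n \<le> N (Suc n) \<and> L n \<noteq> [] \<and>
    block_system (D (N n)) (L n @ R n) \<and> (\<exists>M. M \<noteq> [] \<and> L (Suc n) = L n @ M) \<and>
    (\<forall>k<length (L n @ R n). detects (L (Suc n)) (part (D (N n)) (L n @ R n) k (1\<^sub>m (fst ((L n @ R n) ! k)))))"
    using stages_exist[OF rfd inf D] by (elim exE)
  define C where "C n = D (N n)" for n
  define K where "K n = L n @ R n" for n
  have Nn: "n \<le> N n" and Nmono: "N n \<le> N (Suc n)" and Ln: "L n \<noteq> []"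
    and bs: "block_system (C n) (K n)" and ext: "\<exists>M. M \<noteq> [] \<and> L (Suc n) = L n @ M"
    and det: "k < length (K n) \<Longrightarrow> detects (L (Suc n)) (part (C n) (K n) k (1\<^sub>m (fst (K n ! k))))" for n k
    using spec[OF NLR, of n] by (auto simp: C_def K_def)
  have CC: "C n \<subseteq> C (Suc n)" for n using monoD[OF D(3) Nmono] by (simp add: C_def)
  have Kne: "K n \<noteq> []" for n using Ln by (simp add: K_def)
  define m where "m n = length (K n)" for n
  define u where "u n = size_vec (K n)" for n
  define A where "A n = transition_mat (C n) (K n) (K (Suc n))" for n
  define r where "r n = length (L n)" for n
  define \<phi> where "\<phi> n a = block_rep (K (Suc n)) (block_elem (C n) (K n) a)" for n a
  define \<mu> where "\<mu> n = block_elem (C n) (K n)" for n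
  let ?c = "\<lambda>n. multiplicity_of (C n) (K n) (K (Suc n))"
  note stage = bs bs CC
  have rm: "r n \<le> m n" for n by (simp add: r_def m_def K_def)
  have rr: "r n < r (Suc n)" for n using ext[of n] by (auto simp: r_def)
  have r1: "1 \<le> r n" for n using Ln[of n] by (simp add: r_def Suc_le_eq)
  have Ac: "A n \<in> carrier_mat (m (Suc n)) (m n)" for n by (simp add: A_def m_def transition_mat_def)
  have Ae: "A n $$ (l, k) = int (?c n l k)" if "l < m (Suc n)" "k < m n" for n l k
    using that transition_mat_entry[OF stage] by (simp add: A_def m_def)
  have KL: "K n ! l = L n ! l" if "l < r n" for n l using that by (simp add: K_def r_def nth_append)
  have LS: "L (Suc n) ! l = L n ! l" if "l < r n" for n l
    using ext[of n] that by (auto simp: r_def nth_append)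
  have shared: "l < length (K n)" "l < length (K (Suc n))" "K (Suc n) ! l = K n ! l" if "l < r n" for n l
    using that rm[of n] rm[of "Suc n"] rr[of n] KL[OF that] KL[of l "Suc n"] LS[OF that] by (auto simp: m_def)
  have top: "A n $$ (l, k) = of_bool (l = k)" if l: "l < r n" and k: "k < m n" for n l k
  proof -
    have "A n $$ (l, k) = int (?c n l k)" using Ae k shared[OF l] by (simp add: m_def)
    then show ?thesis
      using multiplicity_of_shared[OF stage _ shared[OF l], of k] k by (simp add: m_def)
  qed
  have simplicial: "simplicial_sequence m u A"
    unfolding simplicial_sequence_def
  proof (intro allI conjI impI)
    fix n
    show "1 \<le> m n" using r1[of n] rm[of n] by simp
    show "u n \<in> carrier_vec (m n)" by (auto simp: u_def m_def intro: carrier_vecI)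
    show "A n \<in> carrier_mat (m (Suc n)) (m n)" by (rule Ac)
    show "0 < u n $ i" if "i < m n" for i
      using that block_system_rep(2)[OF bs, of i n] by (simp add: u_def m_def)
    show "0 \<le> A n $$ (i, j)" if "i < m (Suc n)" "j < m n" for i j using Ae[OF that] by simp
    show "col (A n) j \<noteq> 0\<^sub>v (m (Suc n))" if j: "j < m n" for j
    proof
      assume c: "col (A n) j = 0\<^sub>v (m (Suc n))"
      obtain l where l: "l < length (K (Suc n))" "?c n l j \<noteq> 0"
        using transition_column_nonzero[OF stage, of j n] j by (auto simp: m_def)
      have "col (A n) j $ l = A n $$ (l, j)" using l j Ac[of n] by (simp add: m_def)
      then show False using c l Ae[of l n j] j by (simp add: m_def)
    qed
    show "A n *\<^sub>v u n \<le> u (Suc n)"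
      unfolding A_def u_def by (rule transition_order_unit[OF stage])
  qed
  \<comment> \<open>Detection of the central projection of summand \<open>k\<close> gives a nonzero
    multiplicity at some \<open>l < r (Suc n)\<close>. An index below \<open>r n\<close> is
    impossible, since there column \<open>k\<close> meets the zero block.\<close>
  have det22: "\<exists>l. r n \<le> l \<and> l < r (Suc n) \<and> A n $$ (l, k) \<noteq> 0" if k: "r n \<le> k" "k < m n" for n k
  proof -
    let ?one = "1\<^sub>m (fst (K n ! k)) :: complex mat"
    have kK: "k < length (K n)" using k by (simp add: m_def)
    have one: "?one \<in> carrier_mat (fst (K n ! k)) (fst (K n ! k))" by simp
    obtain l where l: "l < r (Suc n)"
      "snd (L (Suc n) ! l) (part (C n) (K n) k ?one) \<noteq> 0\<^sub>m (fst (L (Suc n) ! l)) (fst (L (Suc n) ! l))"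
      using det[OF kK] by (auto simp: detects_def r_def)
    have lK: "l < length (K (Suc n))" using l(1) rm[of "Suc n"] by (simp add: m_def)
    have c: "?c n l k \<noteq> 0"
      using multiplicity_of_eq_0[OF stage kK lK _ one] l KL[OF l(1)] by auto
    have "r n \<le> l"
    proof (rule ccontr)
      assume "\<not> r n \<le> l"
      then have "l < r n" by simp
      then show False using multiplicity_of_shared[OF stage kK shared[of l n]] c k by auto
    qed
    moreover have "A n $$ (l, k) \<noteq> 0" using c Ae[of l n k] lK k by (simp add: m_def)
    ultimately show ?thesis using l by blast
  qed
  have rfd_prop: "property_RFD m u A"
    unfolding property_RFD_def
  proof (intro exI[of _ r] conjI allI impI)
    show "strict_mono r" using rr by (simp add: strict_mono_Suc_iff)
    fix n
    show "1 \<le> r n" "r n \<le> m n" by (rule r1, rule rm)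
    show "\<exists>A21 A22 A31 A32. A21 \<in> carrier_mat (r (Suc n) - r n) (r n) \<and>
        A22 \<in> carrier_mat (r (Suc n) - r n) (m n - r n) \<and>
        A31 \<in> carrier_mat (m (Suc n) - r (Suc n)) (r n) \<and>
        A32 \<in> carrier_mat (m (Suc n) - r (Suc n)) (m n - r n) \<and>
        A n = four_block_mat (1\<^sub>m (r n)) (0\<^sub>m (r n) (m n - r n)) (A21 @\<^sub>r A31) (A22 @\<^sub>r A32) \<and>
        (\<forall>j<m n - r n. col A22 j \<noteq> 0\<^sub>v (r (Suc n) - r n))"
      by (rule blocks_of_matrix[OF Ac less_imp_le[OF rr] rm rm top det22])
    show "u (Suc n) $ j = u n $ j" if "j < r n" for j
      using shared[OF that] by (simp add: u_def)
  qed
  have hom\<phi>: "star_hom (direct_sum_algebra (u n)) (direct_sum_algebra (u (Suc n))) (\<phi> n)" for n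
  proof -
    have h1: "star_hom (direct_sum_algebra (u n)) whole_algebra (\<mu> n)"
      unfolding u_def \<mu>_def by (rule block_elem_star_hom[OF bs])
    have h2: "star_hom (subalgebra_on (C (Suc n))) (direct_sum_algebra (u (Suc n))) (block_rep (K (Suc n)))"
      unfolding u_def by (rule block_rep_star_hom[OF bs])
    have memC: "\<mu> n a \<in> C (Suc n)" if "a \<in> elems (direct_sum_algebra (u n))" for a
      using block_elem_in[OF bs] that CC[of n] by (auto simp: u_def \<mu>_def)
    have eq: "\<phi> n = (\<lambda>a. block_rep (K (Suc n)) (\<mu> n a))" by (simp add: \<phi>_def \<mu>_def fun_eq_iff)
    show ?thesis
      using h1 h2 memC unfolding eq star_hom_def subalgebra_on_def whole_algebra_def by simp
  qed
  have \<phi>in: "\<phi> n a \<in> elems (direct_sum_algebra (u (Suc n)))" if "a \<in> elems (direct_sum_algebra (u n))" for n a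
    using hom\<phi>[of n] that by (simp add: star_hom_def)
  have \<mu>\<phi>: "\<mu> (Suc n) (\<phi> n a) = \<mu> n a" if "a \<in> elems (direct_sum_algebra (u n))" for n a
  proof -
    have "\<mu> n a \<in> C (Suc n)" using block_elem_in[OF bs] that CC[of n] by (auto simp: u_def \<mu>_def)
    from block_elem_rep[OF bs this] show ?thesis by (simp add: \<mu>_def \<phi>_def)
  qed
  have conn: "connecting_map \<phi> n k a \<in> elems (direct_sum_algebra (u (n + k))) \<and> \<mu> (n + k) (connecting_map \<phi> n k a) = \<mu> n a"
    if "a \<in> elems (direct_sum_algebra (u n))" for n k a
    using that by (induction k) (simp_all add: \<phi>in \<mu>\<phi>)
  have lim: "inductive_limit (\<lambda>n. direct_sum_algebra (u n)) \<phi> \<mu>"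
    unfolding inductive_limit_def
  proof (intro conjI allI ballI)
    fix n
    show "star_hom (direct_sum_algebra (u n)) (direct_sum_algebra (u (Suc n))) (\<phi> n)" by (rule hom\<phi>)
    show "star_hom (direct_sum_algebra (u n)) whole_algebra (\<mu> n)"
      unfolding u_def \<mu>_def by (rule block_elem_star_hom[OF bs])
    fix a assume a: "a \<in> elems (direct_sum_algebra (u n))"
    show "\<mu> (Suc n) (\<phi> n a) = \<mu> n a" by (rule \<mu>\<phi>[OF a])
    \<comment> \<open>Each stage already carries the norm of the whole algebra, so the sequence of
      norms is constant.\<close>
    have "norm_op (direct_sum_algebra (u (n + k))) (connecting_map \<phi> n k a) = norm (\<mu> n a)" for k
      using norm_block_elem[OF bs Kne] conn[OF a, of k] by (simp add: u_def \<mu>_def)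
    then show "(\<lambda>k. norm_op (direct_sum_algebra (u (n + k))) (connecting_map \<phi> n k a)) \<longlonglongrightarrow> norm (\<mu> n a)"
      by simp
  next
    have "D n \<subseteq> (\<Union>n. \<mu> n ` elems (direct_sum_algebra (u n)))" for n
    proof
      fix x assume "x \<in> D n"
      then have x: "x \<in> C n" using monoD[OF D(3) Nn] by (auto simp: C_def)
      have "x = \<mu> n (block_rep (K n) x)" unfolding \<mu>_def by (rule block_elem_rep[OF bs x, symmetric])
      moreover have "block_rep (K n) x \<in> elems (direct_sum_algebra (u n))"
        unfolding u_def by (rule block_rep_in[OF bs x])
      ultimately show "x \<in> (\<Union>n. \<mu> n ` elems (direct_sum_algebra (u n)))" by blast
    qed
    then have "closure (\<Union>n. D n) \<subseteq> closure (\<Union>n. \<mu> n ` elems (direct_sum_algebra (u n)))"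
      by (intro closure_mono) blast
    then show "closure (\<Union>n. \<mu> n ` elems (direct_sum_algebra (u n))) = UNIV" using D(4) by auto
  qed
  have "has_multiplicity_matrix (u n) (u (Suc n)) (\<phi> n) (A n)" for n
  proof -
    have "\<phi> n = (\<lambda>a. block_rep (K (Suc n)) (block_elem (C n) (K n) a))" by (simp add: \<phi>_def fun_eq_iff)
    then show ?thesis unfolding u_def A_def using transition_has_multiplicity_matrix[OF stage] by simp
  qed
  then have assoc: "associated_AF_algebra TYPE('a) u A"
    unfolding associated_AF_algebra_def using lim by blast
  have rows: "nonzero_rows m A" if p: "\<exists>p :: 'a. full_projection p"
  proof -
    obtain q where q: "q \<in> D 0" "\<forall>n. D n \<subseteq> corner_ideal q (D n)" using full[OF p] by blast
    show ?thesis
      unfolding nonzero_rows_def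
    proof (intro allI impI)
      fix n l assume l: "l < m (Suc n)"
      have qC: "q \<in> C n" using q(1) monoD[OF D(3), of 0 "N n"] by (auto simp: C_def)
      have fC: "C (Suc n) \<subseteq> corner_ideal q (C (Suc n))" using q(2) by (simp add: C_def)
      obtain k where k: "k < length (K n)" "?c n l k \<noteq> 0"
        using transition_row_nonzero[OF stage _ qC fC, of l] l by (auto simp: m_def)
      have "row (A n) l $ k = A n $$ (l, k)" using l k Ac[of n] by (simp add: m_def)
      then show "row (A n) l \<noteq> 0\<^sub>v (m n)" using k Ae[OF l, of k] by (auto simp: m_def)
    qed
  qed
  show ?thesis using simplicial rfd_prop assoc rows by blast
qed

section \<open>Residual finite dimensionality of the limit\<close>

text \<open>Each matrix entry of \<open>g\<close> is Lipschitz on \<open>B\<close> and extends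
  continuously to the closure. The algebraic identities and the norm bound then pass to limits of
  sequences from \<open>B\<close>, entry by entry or vector by vector.\<close>

lemma extend_contractive_rep:
  fixes B :: "'a::cstar_algebra set"
  assumes B: "star_subalgebra B" and dense: "closure B = UNIV" and g: "rep_on B d g"
    and contr: "\<And>y. y \<in> B \<Longrightarrow> operator_norm (g y) \<le> norm y"
  shows "\<exists>\<pi>. rep_on UNIV d \<pi> \<and> (\<forall>y\<in>B. \<pi> y = g y) \<and> (\<forall>y. operator_norm (\<pi> y) \<le> norm y)"
proof -
  note gc = rep_carrier[OF g]
  have "\<exists>h. continuous_on UNIV h \<and> (\<forall>y\<in>B. h y = g y $$ (i, j))" if ij: "i < d" "j < d" for i j
  proof -
    have "uniformly_continuous_on B (\<lambda>y. g y $$ (i, j))"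
      unfolding uniformly_continuous_on_def
    proof (intro allI impI)
      fix e :: real assume e: "0 < e"
      have "dist (g y' $$ (i, j)) (g y $$ (i, j)) < e" if y: "y \<in> B" "y' \<in> B" "dist y' y < e" for y y'
      proof -
        have d: "y' - y \<in> B" by (rule star_subalgebra_diff[OF B y(2,1)])
        have "g y' $$ (i, j) - g y $$ (i, j) = g (y' - y) $$ (i, j)"
          using rep_diff[OF g B y(2,1)] gc[OF y(1)] gc[OF y(2)] ij by simp
        then have "dist (g y' $$ (i, j)) (g y $$ (i, j)) \<le> operator_norm (g (y' - y))"
          using entry_le_operator_norm[OF gc[OF d] ij] by (simp add: dist_norm)
        also have "\<dots> \<le> norm (y' - y)" by (rule contr[OF d])
        finally show ?thesis using y(3) by (simp add: dist_norm)
      qed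
      then show "\<exists>\<delta>>0. \<forall>y\<in>B. \<forall>y'\<in>B. dist y' y < \<delta> \<longrightarrow> dist (g y' $$ (i, j)) (g y $$ (i, j)) < e"
        using e by blast
    qed
    then obtain h where "uniformly_continuous_on (closure B) h" "\<And>y. y \<in> B \<Longrightarrow> g y $$ (i, j) = h y"
      by (rule uniformly_continuous_on_extension_on_closure) blast
    then show ?thesis using dense uniformly_continuous_imp_continuous by metis
  qed
  then obtain h where h: "\<And>i j. i < d \<Longrightarrow> j < d \<Longrightarrow> continuous_on UNIV (h i j)"
    "\<And>i j y. i < d \<Longrightarrow> j < d \<Longrightarrow> y \<in> B \<Longrightarrow> h i j y = g y $$ (i, j)"
    by metis
  define \<pi> where "\<pi> y = mat d d (\<lambda>(i, j). h i j y)" for y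
  have \<pi>c: "\<pi> y \<in> carrier_mat d d" for y by (simp add: \<pi>_def)
  have \<pi>e: "\<pi> y $$ (i, j) = h i j y" if "i < d" "j < d" for i j y using that by (simp add: \<pi>_def)
  have \<pi>g: "\<pi> y = g y" if "y \<in> B" for y
    using gc[OF that] h(2) that by (intro eq_matI) (auto simp: \<pi>_def)
  have seq: "\<exists>s. (\<forall>n. s n \<in> B) \<and> s \<longlonglongrightarrow> y" for y
    using dense closure_sequential[of y B] by auto
  have lim: "(\<lambda>n. \<pi> (s n) $$ (i, j)) \<longlonglongrightarrow> \<pi> y $$ (i, j)" if "s \<longlonglongrightarrow> y" "i < d" "j < d" for s y i j
    using continuous_on_tendsto_compose[OF h(1)[OF that(2,3)] that(1)] that by (simp add: \<pi>e)
  have eqI: "M = M'" if M: "M \<in> carrier_mat d d" "M' \<in> carrier_mat d d" and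
    l1: "\<And>i j. i < d \<Longrightarrow> j < d \<Longrightarrow> (\<lambda>n. f n i j) \<longlonglongrightarrow> M $$ (i, j)" and
    l2: "\<And>i j. i < d \<Longrightarrow> j < d \<Longrightarrow> (\<lambda>n. f n i j) \<longlonglongrightarrow> M' $$ (i, j)" for M M' :: "complex mat" and f
    using M LIMSEQ_unique[OF l1 l2] by (intro eq_matI) auto
  note Bm = star_subalgebra_mult[OF B] star_subalgebra_add[OF B] star_subalgebra_scale[OF B] star_subalgebra_star[OF B]
  have rep: "rep_on UNIV d \<pi>"
    unfolding rep_on_iff
  proof (intro conjI ballI allI)
    fix x :: 'a show "\<pi> x \<in> carrier_mat d d" by (rule \<pi>c)
    obtain s where s: "\<forall>n. s n \<in> B" "s \<longlonglongrightarrow> x" using seq by blast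
    show "\<pi> (star x) = mat_adjoint (\<pi> x)"
    proof (rule eqI[OF \<pi>c mat_adjoint_carrier[OF \<pi>c]])
      fix i j assume ij: "i < d" "j < d"
      \<comment> \<open>A consequence of the C*-identity and submultiplicativity; it supplies the
        continuity of the involution.\<close>
      have "norm (star y) = norm y" for y :: 'a
      proof -
        have le: "norm z \<le> norm (star z)" for z :: 'a
        proof (cases "norm z = 0")
          case False
          then have "0 < norm z" by simp
          moreover have "norm z * norm z \<le> norm (star z) * norm z"
            using norm_mult_ineq[of "star z" z] by (simp add: cstar_identity power2_eq_square)
          ultimately show ?thesis by simp
        qed simp
        show ?thesis using le[of y] le[of "star y"] by (simp add: star_star)
      qed
      then have "bounded_linear (star :: 'a \<Rightarrow> 'a)"
        by (intro bounded_linear_intro[of _ 1]) (simp_all add: star_add scaleR_scaleC star_scaleC)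
      from lim[OF bounded_linear.tendsto[OF this s(2)] ij]
      show "(\<lambda>n. \<pi> (star (s n)) $$ (i, j)) \<longlonglongrightarrow> \<pi> (star x) $$ (i, j)" .
      have "\<pi> (star (s n)) $$ (i, j) = cnj (\<pi> (s n) $$ (j, i))" for n
        using s(1) ij gc[of "s n"] Bm(4)[of "s n"] by (simp add: \<pi>g rep_star[OF g])
      moreover have "(\<lambda>n. cnj (\<pi> (s n) $$ (j, i))) \<longlonglongrightarrow> cnj (\<pi> x $$ (j, i))"
        by (intro tendsto_cnj lim[OF s(2)] ij)
      ultimately show "(\<lambda>n. \<pi> (star (s n)) $$ (i, j)) \<longlonglongrightarrow> mat_adjoint (\<pi> x) $$ (i, j)"
        using ij \<pi>c[of x] by simp
    qed
    fix c
    show "\<pi> (c *\<^sub>C x) = c \<cdot>\<^sub>m \<pi> x"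
    proof (rule eqI[OF \<pi>c])
      fix i j assume ij: "i < d" "j < d"
      from lim[OF bounded_linear.tendsto[OF bounded_linear_scaleC s(2)] ij]
      show "(\<lambda>n. \<pi> (c *\<^sub>C s n) $$ (i, j)) \<longlonglongrightarrow> \<pi> (c *\<^sub>C x) $$ (i, j)" .
      have "\<pi> (c *\<^sub>C s n) $$ (i, j) = c * \<pi> (s n) $$ (i, j)" for n
        using s(1) ij gc[of "s n"] Bm(3)[of "s n"] by (simp add: \<pi>g rep_scale[OF g])
      moreover have "(\<lambda>n. c * \<pi> (s n) $$ (i, j)) \<longlonglongrightarrow> c * \<pi> x $$ (i, j)"
        by (intro tendsto_mult tendsto_const lim[OF s(2)] ij)
      ultimately show "(\<lambda>n. \<pi> (c *\<^sub>C s n) $$ (i, j)) \<longlonglongrightarrow> (c \<cdot>\<^sub>m \<pi> x) $$ (i, j)"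
        using ij \<pi>c[of x] by simp
    qed (use \<pi>c in auto)
  next
    fix x y :: 'a
    obtain s where s: "\<forall>n. s n \<in> B" "s \<longlonglongrightarrow> x" using seq by blast
    obtain t where t: "\<forall>n. t n \<in> B" "t \<longlonglongrightarrow> y" using seq by blast
    show "\<pi> (x + y) = \<pi> x + \<pi> y"
    proof (rule eqI[OF \<pi>c])
      fix i j assume ij: "i < d" "j < d"
      from lim[OF tendsto_add[OF s(2) t(2)] ij]
      show "(\<lambda>n. \<pi> (s n + t n) $$ (i, j)) \<longlonglongrightarrow> \<pi> (x + y) $$ (i, j)" .
      have "\<pi> (s n + t n) $$ (i, j) = \<pi> (s n) $$ (i, j) + \<pi> (t n) $$ (i, j)" for n
        using s(1) t(1) ij gc[of "s n"] gc[of "t n"] Bm(2)[of "s n" "t n"] by (simp add: \<pi>g rep_add[OF g])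
      moreover have "(\<lambda>n. \<pi> (s n) $$ (i, j) + \<pi> (t n) $$ (i, j)) \<longlonglongrightarrow> \<pi> x $$ (i, j) + \<pi> y $$ (i, j)"
        by (intro tendsto_add lim[OF s(2)] lim[OF t(2)] ij)
      ultimately show "(\<lambda>n. \<pi> (s n + t n) $$ (i, j)) \<longlonglongrightarrow> (\<pi> x + \<pi> y) $$ (i, j)"
        using ij \<pi>c[of x] \<pi>c[of y] by simp
    qed (use \<pi>c in auto)
    show "\<pi> (x * y) = \<pi> x * \<pi> y"
    proof (rule eqI[OF \<pi>c mult_carrier_mat[OF \<pi>c \<pi>c]])
      fix i j assume ij: "i < d" "j < d"
      from lim[OF tendsto_mult[OF s(2) t(2)] ij]
      show "(\<lambda>n. \<pi> (s n * t n) $$ (i, j)) \<longlonglongrightarrow> \<pi> (x * y) $$ (i, j)" .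
      have "\<pi> (s n * t n) $$ (i, j) = (\<Sum>k<d. \<pi> (s n) $$ (i, k) * \<pi> (t n) $$ (k, j))" for n
        using s(1) t(1) Bm(1)[of "s n" "t n"] mult_mat_entry[OF gc gc ij, of "s n" "t n"]
        by (simp add: \<pi>g rep_mult[OF g])
      moreover have "(\<lambda>n. \<Sum>k<d. \<pi> (s n) $$ (i, k) * \<pi> (t n) $$ (k, j)) \<longlonglongrightarrow> (\<Sum>k<d. \<pi> x $$ (i, k) * \<pi> y $$ (k, j))"
        by (intro tendsto_sum tendsto_mult lim[OF s(2)] lim[OF t(2)] ij) auto
      ultimately show "(\<lambda>n. \<pi> (s n * t n) $$ (i, j)) \<longlonglongrightarrow> (\<pi> x * \<pi> y) $$ (i, j)"
        by (simp add: mult_mat_entry[OF \<pi>c \<pi>c ij])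
    qed
  qed
  have "operator_norm (\<pi> y) \<le> norm y" for y
  proof (rule operator_norm_leI[OF \<pi>c])
    fix v :: "complex vec" assume v: "v \<in> carrier_vec d"
    obtain s where s: "\<forall>n. s n \<in> B" "s \<longlonglongrightarrow> y" using seq by blast
    have l2: "l2_norm_vec (\<pi> z *\<^sub>v v) = sqrt (\<Sum>i<d. (cmod (\<Sum>j<d. \<pi> z $$ (i, j) * v $ j))\<^sup>2)" for z
    proof -
      have "dim_vec (\<pi> z *\<^sub>v v) = d" using \<pi>c[of z] by simp
      then show ?thesis
        unfolding l2_norm_vec_def by (simp add: mult_mat_vec_entry[OF \<pi>c v] del: index_mult_mat_vec)
    qed
    have "(\<lambda>n. l2_norm_vec (\<pi> (s n) *\<^sub>v v)) \<longlonglongrightarrow> l2_norm_vec (\<pi> y *\<^sub>v v)"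
      unfolding l2
      by (intro tendsto_real_sqrt tendsto_sum tendsto_power tendsto_norm tendsto_mult tendsto_const lim[OF s(2)]) auto
    moreover have "(\<lambda>n. norm (s n) * l2_norm_vec v) \<longlonglongrightarrow> norm y * l2_norm_vec v"
      by (intro tendsto_mult tendsto_norm s(2) tendsto_const)
    moreover have "l2_norm_vec (\<pi> (s n) *\<^sub>v v) \<le> norm (s n) * l2_norm_vec v" for n
    proof -
      have "l2_norm_vec (\<pi> (s n) *\<^sub>v v) \<le> operator_norm (\<pi> (s n)) * l2_norm_vec v"
        by (rule operator_norm_bound[OF \<pi>c v])
      also have "\<dots> \<le> norm (s n) * l2_norm_vec v"
        using contr[of "s n"] s(1) by (intro mult_right_mono) (auto simp: \<pi>g)
      finally show ?thesis .
    qed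
    ultimately show "l2_norm_vec (\<pi> y *\<^sub>v v) \<le> norm y * l2_norm_vec v"
      by (intro LIMSEQ_le) auto
  qed simp
  then show ?thesis using rep \<pi>g by blast
qed

text \<open>By the C*-identity the norm of a projection equals its own square, so it is 0 or
  1.\<close>

lemma projection_operator_norm_le:
  assumes P: "projection_mat n P" shows "operator_norm P \<le> 1"
proof -
  have Pc: "P \<in> carrier_mat n n" and PP: "mat_adjoint P * P = P" using P by (auto simp: projection_mat_def)
  have "operator_norm P = (operator_norm P)\<^sup>2" using operator_norm_cstar[OF Pc] PP by simp
  then have "operator_norm P = 0 \<or> operator_norm P = 1" by (simp add: power2_eq_square)
  then show ?thesis by auto
qed

text \<open>Pad \<open>v\<close> with zeros: the first \<open>p\<close> coordinates of the image
  under \<open>M\<close> are those of \<open>x\<close> applied to \<open>v\<close>, and dropping the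
  others only shortens the vector.\<close>

lemma operator_norm_corner_le:
  assumes x: "x \<in> carrier_mat p p" and M: "M \<in> carrier_mat q q" and pq: "p \<le> q"
    and corner: "\<And>i j. i < p \<Longrightarrow> j < p \<Longrightarrow> M $$ (i, j) = x $$ (i, j)"
  shows "operator_norm x \<le> operator_norm M"
proof (rule operator_norm_leI[OF x operator_norm_nonneg[OF M]])
  fix v :: "complex vec" assume v: "v \<in> carrier_vec p"
  define w where "w = vec q (\<lambda>i. if i < p then v $ i else 0)"
  have w: "w \<in> carrier_vec q" by (simp add: w_def)
  have "(\<Sum>i<q. (cmod (w $ i))\<^sup>2) = (\<Sum>i<p. (cmod (v $ i))\<^sup>2)"
    using pq by (intro sum.mono_neutral_cong_right) (auto simp: w_def)
  then have lw: "l2_norm_vec w = l2_norm_vec v" using v by (simp add: l2_norm_vec_def w_def)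
  have e: "(M *\<^sub>v w) $ i = (x *\<^sub>v v) $ i" if i: "i < p" for i
  proof -
    have "(M *\<^sub>v w) $ i = (\<Sum>j<q. M $$ (i, j) * w $ j)"
      using i pq by (intro mult_mat_vec_entry[OF M w]) simp
    also have "\<dots> = (\<Sum>j<p. x $$ (i, j) * v $ j)"
      using pq i by (intro sum.mono_neutral_cong_right) (auto simp: w_def corner)
    finally show ?thesis using mult_mat_vec_entry[OF x v i] by simp
  qed
  have "(\<Sum>i<p. (cmod ((x *\<^sub>v v) $ i))\<^sup>2) = (\<Sum>i<p. (cmod ((M *\<^sub>v w) $ i))\<^sup>2)"
    by (intro sum.cong refl) (simp add: e del: index_mult_mat_vec)
  also have "\<dots> \<le> (\<Sum>i<q. (cmod ((M *\<^sub>v w) $ i))\<^sup>2)"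
    using pq by (intro sum_mono2) auto
  finally have "l2_norm_vec (x *\<^sub>v v) \<le> l2_norm_vec (M *\<^sub>v w)"
    using x M unfolding l2_norm_vec_def by (simp del: index_mult_mat_vec)
  also have "\<dots> \<le> operator_norm M * l2_norm_vec w" by (rule operator_norm_bound[OF M w])
  finally show "l2_norm_vec (x *\<^sub>v v) \<le> operator_norm M * l2_norm_vec v" by (simp add: lw)
qed

section \<open>Amplifications and entries of block matrices\<close>

definition amplification :: "nat \<Rightarrow> nat \<Rightarrow> nat \<Rightarrow> complex mat \<Rightarrow> complex mat" where
  "amplification p q c x = mat q q (\<lambda>(i, j).
     if i < c * p \<and> j < c * p \<and> i div p = j div p then x $$ (i mod p, j mod p) else 0)"

lemma has_multiplicity_form:
  assumes m: "has_multiplicity p q f c"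
  shows "\<exists>U. unitary_mat q U \<and> c * p \<le> q \<and>
    (\<forall>x\<in>carrier_mat p p. f x = U * amplification p q c x * mat_adjoint U)"
proof -
  obtain U where U: "unitary_mat q U" and cq: "c * p \<le> q"
    and fx: "\<forall>x\<in>carrier_mat p p. f x = U * diag_block_mat (replicate c x @ [0\<^sub>m (q - c * p) (q - c * p)]) * mat_adjoint U"
    using m by (auto simp: has_multiplicity_def)
  have "c * p + (q - c * p) = q" using cq by simp
  then have "f x = U * amplification p q c x * mat_adjoint U" if "x \<in> carrier_mat p p" for x
    using fx that diag_block_replicate[OF that, of c "q - c * p"] by (simp add: amplification_def)
  then show ?thesis using U cq by blast
qed

lemma amplification_carrier [simp]: "amplification p q c x \<in> carrier_mat q q"
  by (simp add: amplification_def)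

lemma amplification_entry:
  assumes "1 \<le> c" "c * p \<le> q" "i < p" "j < p"
  shows "amplification p q c x $$ (i, j) = x $$ (i, j)"
proof -
  have "p \<le> c * p" using assms(1) by simp
  then have "i < c * p" "j < c * p" "i < q" "j < q" using assms by linarith+
  then show ?thesis using assms by (simp add: amplification_def)
qed

lemma amplification_one: "x \<in> carrier_mat p p \<Longrightarrow> amplification p p 1 x = x"
  by (intro eq_matI) (auto simp: amplification_def)

lemma entries_of_blocks:
  fixes A :: "int mat"
  assumes r: "r \<le> r'" "r \<le> m" "r' \<le> m'"
    and c: "A21 \<in> carrier_mat (r' - r) r" "A22 \<in> carrier_mat (r' - r) (m - r)"
      "A31 \<in> carrier_mat (m' - r') r" "A32 \<in> carrier_mat (m' - r') (m - r)"
    and A: "A = four_block_mat (1\<^sub>m r) (0\<^sub>m r (m - r)) (A21 @\<^sub>r A31) (A22 @\<^sub>r A32)"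
    and col: "\<And>j. j < m - r \<Longrightarrow> col A22 j \<noteq> 0\<^sub>v (r' - r)"
  shows "i < r \<Longrightarrow> A $$ (i, i) = 1"
    and "r \<le> k \<Longrightarrow> k < m \<Longrightarrow> \<exists>l. r \<le> l \<and> l < r' \<and> A $$ (l, k) \<noteq> 0"
proof -
  have d: "dim_row (A22 @\<^sub>r A32) = (r' - r) + (m' - r')" "dim_col (A22 @\<^sub>r A32) = m - r"
    using c by (simp_all add: append_rows_def)
  show "A $$ (i, i) = 1" if "i < r" using that by (simp add: A d)
  assume k: "r \<le> k" "k < m"
  have "\<exists>i<r' - r. A22 $$ (i, k - r) \<noteq> 0"
  proof (rule ccontr)
    assume "\<not> ?thesis"
    then have "col A22 (k - r) = 0\<^sub>v (r' - r)" using c k by (intro eq_vecI) auto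
    then show False using col[of "k - r"] k by simp
  qed
  then obtain i where i: "i < r' - r" "A22 $$ (i, k - r) \<noteq> 0" by blast
  have "A $$ (r + i, k) = A22 $$ (i, k - r)"
    using i k c r by (simp add: A d) (simp add: append_rows_def)
  then show "\<exists>l. r \<le> l \<and> l < r' \<and> A $$ (l, k) \<noteq> 0"
    using i by (intro exI[of _ "r + i"]) auto
qed

context
  fixes m r :: "nat \<Rightarrow> nat" and u :: "nat \<Rightarrow> int vec" and A :: "nat \<Rightarrow> int mat"
    and \<phi> :: "nat \<Rightarrow> (nat \<Rightarrow> complex mat) \<Rightarrow> (nat \<Rightarrow> complex mat)"
    and \<mu> :: "nat \<Rightarrow> (nat \<Rightarrow> complex mat) \<Rightarrow> 'a::cstar_algebra"
  assumes sim: "simplicial_sequence m u A"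
    and rmono: "strict_mono r" and r1: "\<And>n. 1 \<le> r n" and rm: "\<And>n. r n \<le> m n"
    and diag: "\<And>n j. j < r n \<Longrightarrow> A n $$ (j, j) = 1"
    and nz: "\<And>n k. r n \<le> k \<Longrightarrow> k < m n \<Longrightarrow> \<exists>l. r n \<le> l \<and> l < r (Suc n) \<and> A n $$ (l, k) \<noteq> 0"
    and ueq: "\<And>n j. j < r n \<Longrightarrow> u (Suc n) $ j = u n $ j"
    and hm: "\<And>n. has_multiplicity_matrix (u n) (u (Suc n)) (\<phi> n) (A n)"
    and lim: "inductive_limit (\<lambda>n. direct_sum_algebra (u n)) \<phi> \<mu>"
begin

section \<open>Connecting maps on single summands\<close>

abbreviation "Elt n \<equiv> elems (direct_sum_algebra (u n))"
abbreviation "sz n i \<equiv> block_size (u n) i"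

lemma dim_u [simp]: "dim_vec (u n) = m n"
  using sim by (auto simp: simplicial_sequence_def)

lemma Elt_iff: "x \<in> Elt n \<longleftrightarrow> x \<in> (\<Pi>\<^sub>E i\<in>{..<m n}. carrier_mat (sz n i) (sz n i))"
  by (simp add: direct_sum_algebra_def)

lemma Elt_carrier: "x \<in> Elt n \<Longrightarrow> i < m n \<Longrightarrow> x i \<in> carrier_mat (sz n i) (sz n i)"
  by (auto simp: Elt_iff)

lemma r_less_Suc: "r n < r (Suc n)" using rmono by (simp add: strict_mono_Suc_iff)

lemma shared_index: "j < r n \<Longrightarrow> j < m n" "j < r n \<Longrightarrow> j < m (Suc n)" "j < r n \<Longrightarrow> j < r (Suc n)"
  using rm[of n] rm[of "Suc n"] r_less_Suc[of n] by auto

lemma shared_size: "j < r n \<Longrightarrow> sz (Suc n) j = sz n j"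
  by (simp add: block_size_def ueq)

lemma \<phi>_hom: "star_hom (direct_sum_algebra (u n)) (direct_sum_algebra (u (Suc n))) (\<phi> n)"
  using lim by (simp add: inductive_limit_def)

lemma \<mu>_hom: "star_hom (direct_sum_algebra (u n)) whole_algebra (\<mu> n)"
  using lim by (simp add: inductive_limit_def)

lemma Elt_closed:
  assumes "x \<in> Elt n" "y \<in> Elt n"
  shows "add_op (direct_sum_algebra (u n)) x y \<in> Elt n" "mult_op (direct_sum_algebra (u n)) x y \<in> Elt n"
    "scale_op (direct_sum_algebra (u n)) c x \<in> Elt n" "star_op (direct_sum_algebra (u n)) x \<in> Elt n"
  using Elt_carrier[OF assms(1)] mult_carrier_mat[OF Elt_carrier[OF assms(1)] Elt_carrier[OF assms(2)]]
    Elt_carrier[OF assms(2)]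
  by (auto simp: direct_sum_algebra_def)

lemma embed_in: "k < m n \<Longrightarrow> y \<in> carrier_mat (sz n k) (sz n k) \<Longrightarrow> summand_embedding (u n) k y \<in> Elt n"
  by (auto simp: Elt_iff summand_embedding_def)

lemma \<phi>_in: "x \<in> Elt n \<Longrightarrow> \<phi> n x \<in> Elt (Suc n)"
  using \<phi>_hom by (auto simp: star_hom_def)

text \<open>Multiplying by the central projection of summand \<open>k\<close> before applying the
  connecting map retains only coordinate \<open>k\<close>. This reduces the full map to its partial
  maps.\<close>

lemma \<phi>_compress:
  assumes x: "x \<in> Elt n" and k: "k < m n" and l: "l < m (Suc n)"
  shows "\<phi> n x l * \<phi> n (summand_embedding (u n) k (1\<^sub>m (sz n k))) l = \<phi> n (summand_embedding (u n) k (x k)) l"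
proof -
  let ?one = "1\<^sub>m (sz n k) :: complex mat"
  let ?e = "summand_embedding (u n) k ?one"
  have e: "?e \<in> Elt n" by (rule embed_in[OF k]) simp
  have "mult_op (direct_sum_algebra (u n)) x ?e = summand_embedding (u n) k (x k)"
  proof (rule ext)
    fix i show "mult_op (direct_sum_algebra (u n)) x ?e i = summand_embedding (u n) k (x k) i"
      using Elt_carrier[OF x, of i] by (auto simp: direct_sum_algebra_def summand_embedding_def)
  qed
  moreover have "\<phi> n (mult_op (direct_sum_algebra (u n)) x ?e) = mult_op (direct_sum_algebra (u (Suc n))) (\<phi> n x) (\<phi> n ?e)"
    using \<phi>_hom[of n] x e by (simp add: star_hom_def)
  ultimately have "\<phi> n (summand_embedding (u n) k (x k)) = mult_op (direct_sum_algebra (u (Suc n))) (\<phi> n x) (\<phi> n ?e)"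
    by simp
  then show ?thesis using l by (simp add: direct_sum_algebra_def)
qed

text \<open>Multiplicity one into a summand of the same size sends the unit of summand
  \<open>j\<close> to the identity. So the compression above loses nothing, and coordinate
  \<open>j\<close> of the image depends on \<open>x j\<close> alone.\<close>

lemma \<phi>_shared:
  assumes j: "j < r n"
  shows "\<exists>V. unitary_mat (sz n j) V \<and> (\<forall>x\<in>Elt n. \<phi> n x j = V * x j * mat_adjoint V)"
proof -
  note sj = shared_index[OF j]
  have "has_multiplicity (sz n j) (sz (Suc n) j) (\<lambda>y. \<phi> n (summand_embedding (u n) j y) j) (nat (A n $$ (j, j)))"
    using hm[of n] sj by (simp add: has_multiplicity_matrix_def)
  then have "has_multiplicity (sz n j) (sz n j) (\<lambda>y. \<phi> n (summand_embedding (u n) j y) j) 1"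
    by (simp add: diag[OF j] shared_size[OF j])
  then obtain V where V: "unitary_mat (sz n j) V" and
    f: "\<forall>y\<in>carrier_mat (sz n j) (sz n j). \<phi> n (summand_embedding (u n) j y) j
      = V * amplification (sz n j) (sz n j) 1 y * mat_adjoint V"
    using has_multiplicity_form by blast
  have f': "\<phi> n (summand_embedding (u n) j y) j = V * y * mat_adjoint V" if y: "y \<in> carrier_mat (sz n j) (sz n j)" for y
    using bspec[OF f y] amplification_one[OF y] by simp
  have Vc: "V \<in> carrier_mat (sz n j) (sz n j)" "V * mat_adjoint V = 1\<^sub>m (sz n j)"
    using V by (auto simp: unitary_mat_def)
  have "\<phi> n x j = V * x j * mat_adjoint V" if x: "x \<in> Elt n" for x
  proof -
    have "\<phi> n x j * \<phi> n (summand_embedding (u n) j (1\<^sub>m (sz n j))) j = \<phi> n (summand_embedding (u n) j (x j)) j"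
      by (rule \<phi>_compress[OF x sj(1,2)])
    moreover have "\<phi> n (summand_embedding (u n) j (1\<^sub>m (sz n j))) j = 1\<^sub>m (sz n j)"
      using f'[of "1\<^sub>m (sz n j)"] Vc by simp
    moreover have "\<phi> n x j \<in> carrier_mat (sz n j) (sz n j)"
      using Elt_carrier[OF \<phi>_in[OF x] sj(2)] shared_size[OF j] by simp
    ultimately show ?thesis using f'[OF Elt_carrier[OF x sj(1)]] by simp
  qed
  then show ?thesis using V by blast
qed

text \<open>A positive multiplicity puts \<open>x k\<close>, up to a unitary, in the upper left
  corner of the compressed image. The compression is a product with a projection, which does not
  increase the norm.\<close>

lemma \<phi>_norm_ge:
  assumes x: "x \<in> Elt n" and k: "k < m n" and l: "l < m (Suc n)" and A0: "A n $$ (l, k) \<noteq> 0"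
  shows "operator_norm (x k) \<le> operator_norm (\<phi> n x l)"
proof -
  let ?p = "sz n k" and ?q = "sz (Suc n) l"
  define c where "c = nat (A n $$ (l, k))"
  have "0 \<le> A n $$ (l, k)" using sim k l by (auto simp: simplicial_sequence_def)
  then have c: "1 \<le> c" using A0 by (simp add: c_def)
  have "has_multiplicity ?p ?q (\<lambda>y. \<phi> n (summand_embedding (u n) k y) l) c"
    using hm[of n] k l by (simp add: has_multiplicity_matrix_def c_def)
  then obtain U where U: "unitary_mat ?q U" and cpq: "c * ?p \<le> ?q" and
    f: "\<forall>y\<in>carrier_mat ?p ?p. \<phi> n (summand_embedding (u n) k y) l = U * amplification ?p ?q c y * mat_adjoint U"
    using has_multiplicity_form by blast
  have pc: "?p \<le> c * ?p" using c by simp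
  let ?M = "amplification ?p ?q c (x k)"
  note xk = Elt_carrier[OF x k]
  have "operator_norm (x k) \<le> operator_norm ?M"
    by (rule operator_norm_corner_le[OF xk amplification_carrier order_trans[OF pc cpq] amplification_entry[OF c cpq]])
  also have "\<dots> = operator_norm (U * ?M * mat_adjoint U)"
    by (rule operator_norm_unitary_conj[OF U, symmetric]) simp
  also have "\<dots> = operator_norm (\<phi> n x l * \<phi> n (summand_embedding (u n) k (1\<^sub>m ?p)) l)"
    by (simp add: \<phi>_compress[OF x k l] bspec[OF f xk])
  also have "\<dots> \<le> operator_norm (\<phi> n x l) * 1"
  proof -
    let ?e = "summand_embedding (u n) k (1\<^sub>m ?p)"
    let ?P = "\<phi> n ?e l"
    have e: "?e \<in> Elt n" by (rule embed_in[OF k]) simp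
    note c1 = Elt_carrier[OF \<phi>_in[OF x] l] and c2 = Elt_carrier[OF \<phi>_in[OF e] l]
    have ss: "star_op (direct_sum_algebra (u n)) ?e = ?e"
      by (rule ext) (auto simp: direct_sum_algebra_def summand_embedding_def)
    have "\<phi> n (star_op (direct_sum_algebra (u n)) ?e) = star_op (direct_sum_algebra (u (Suc n))) (\<phi> n ?e)"
      using \<phi>_hom[of n] e by (simp add: star_hom_def)
    then have "star_op (direct_sum_algebra (u (Suc n))) (\<phi> n ?e) l = ?P" using ss by simp
    then have "mat_adjoint ?P = ?P" using l by (simp add: direct_sum_algebra_def)
    moreover have "?P * ?P = ?P"
      using \<phi>_compress[OF e k l] k by (simp add: summand_embedding_def)
    ultimately have "projection_mat ?q ?P" using c2 by (simp add: projection_mat_def)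
    then have "operator_norm ?P \<le> 1" by (rule projection_operator_norm_le)
    then have "operator_norm (\<phi> n x l) * operator_norm ?P \<le> operator_norm (\<phi> n x l) * 1"
      by (intro mult_left_mono operator_norm_nonneg[OF c1])
    then show ?thesis using operator_norm_mult_le[OF c1 c2] by simp
  qed
  finally show ?thesis by simp
qed

section \<open>Coordinates corrected by unitaries\<close>

definition shared_unitary :: "nat \<Rightarrow> nat \<Rightarrow> complex mat" where
  "shared_unitary n j = (SOME V. unitary_mat (sz n j) V \<and> (\<forall>x\<in>Elt n. \<phi> n x j = V * x j * mat_adjoint V))"

lemma shared_unitary:
  assumes j: "j < r n"
  shows "unitary_mat (sz n j) (shared_unitary n j)"
    "x \<in> Elt n \<Longrightarrow> \<phi> n x j = shared_unitary n j * x j * mat_adjoint (shared_unitary n j)"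
proof -
  have V: "unitary_mat (sz n j) (shared_unitary n j) \<and>
      (\<forall>x\<in>Elt n. \<phi> n x j = shared_unitary n j * x j * mat_adjoint (shared_unitary n j))"
    unfolding shared_unitary_def by (rule someI_ex[OF \<phi>_shared[OF j]])
  show "unitary_mat (sz n j) (shared_unitary n j)" by (rule conjunct1[OF V])
  show "\<phi> n x j = shared_unitary n j * x j * mat_adjoint (shared_unitary n j)" if "x \<in> Elt n"
    by (rule bspec[OF conjunct2[OF V] that])
qed

text \<open>The accumulated product of the adjoints of the unitaries, so that conjugation undoes all
  connecting maps passed since \<open>j\<close> became a shared index. Until then it is the
  identity.\<close>

primrec frame :: "nat \<Rightarrow> nat \<Rightarrow> complex mat" where
  "frame j 0 = 1\<^sub>m (sz 0 j)"
| "frame j (Suc n) = (if j < r n then frame j n * mat_adjoint (shared_unitary n j) else 1\<^sub>m (sz (Suc n) j))"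

lemma frame_unitary: "unitary_mat (sz n j) (frame j n)"
proof (induction n)
  case 0
  then show ?case by (simp add: unitary_mat_def)
next
  case (Suc n)
  show ?case
  proof (cases "j < r n")
    case True
    have W: "frame j n \<in> carrier_mat (sz n j) (sz n j)"
      "mat_adjoint (frame j n) * frame j n = 1\<^sub>m (sz n j)" "frame j n * mat_adjoint (frame j n) = 1\<^sub>m (sz n j)"
      using Suc by (auto simp: unitary_mat_def)
    have V: "shared_unitary n j \<in> carrier_mat (sz n j) (sz n j)"
      "mat_adjoint (shared_unitary n j) * shared_unitary n j = 1\<^sub>m (sz n j)"
      "shared_unitary n j * mat_adjoint (shared_unitary n j) = 1\<^sub>m (sz n j)"
      using shared_unitary(1)[OF True] by (auto simp: unitary_mat_def)
    let ?W = "frame j n" and ?V = "shared_unitary n j"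
    have c: "?W * mat_adjoint ?V \<in> carrier_mat (sz n j) (sz n j)"
      by (rule mult_carrier_mat[OF W(1) mat_adjoint_carrier[OF V(1)]])
    have a: "mat_adjoint (?W * mat_adjoint ?V) = ?V * mat_adjoint ?W"
      using mat_adjoint_mult[OF W(1) mat_adjoint_carrier[OF V(1)]] by simp
    have "?V * mat_adjoint ?W * (?W * mat_adjoint ?V) = ?V * (mat_adjoint ?W * ?W) * mat_adjoint ?V"
      by (simp add: mat_assoc carrier_matD[OF W(1)] carrier_matD[OF V(1)])
    also have "\<dots> = 1\<^sub>m (sz n j)" using V by (simp add: W(2))
    finally have 1: "?V * mat_adjoint ?W * (?W * mat_adjoint ?V) = 1\<^sub>m (sz n j)" .
    have "?W * mat_adjoint ?V * (?V * mat_adjoint ?W) = ?W * (mat_adjoint ?V * ?V) * mat_adjoint ?W"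
      by (simp add: mat_assoc carrier_matD[OF W(1)] carrier_matD[OF V(1)])
    also have "\<dots> = 1\<^sub>m (sz n j)" using W by (simp add: V(2))
    finally have 2: "?W * mat_adjoint ?V * (?V * mat_adjoint ?W) = 1\<^sub>m (sz n j)" .
    show ?thesis using True c 1 2 by (simp add: unitary_mat_def a shared_size)
  qed (simp add: unitary_mat_def)
qed

definition coord_rep :: "nat \<Rightarrow> nat \<Rightarrow> (nat \<Rightarrow> complex mat) \<Rightarrow> complex mat" where
  "coord_rep j n x = frame j n * x j * mat_adjoint (frame j n)"

lemma frame_carrier: "frame j n \<in> carrier_mat (sz n j) (sz n j)"
  "mat_adjoint (frame j n) * frame j n = 1\<^sub>m (sz n j)"
  using frame_unitary[of n j] by (auto simp: unitary_mat_def)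

lemma coord_rep_step:
  assumes j: "j < r n" and x: "x \<in> Elt n"
  shows "coord_rep j (Suc n) (\<phi> n x) = coord_rep j n x"
proof -
  let ?W = "frame j n" and ?V = "shared_unitary n j"
  note W = frame_carrier(1)[of j n]
  have V: "?V \<in> carrier_mat (sz n j) (sz n j)" "mat_adjoint ?V * ?V = 1\<^sub>m (sz n j)"
    using shared_unitary(1)[OF j] by (auto simp: unitary_mat_def)
  have xj: "x j \<in> carrier_mat (sz n j) (sz n j)" by (rule Elt_carrier[OF x shared_index(1)[OF j]])
  have "coord_rep j (Suc n) (\<phi> n x)
      = ?W * mat_adjoint ?V * (?V * x j * mat_adjoint ?V) * mat_adjoint (?W * mat_adjoint ?V)"
    using j by (simp add: coord_rep_def shared_unitary(2)[OF j x])
  also have "\<dots> = ?W * (mat_adjoint ?V * ?V) * x j * (mat_adjoint ?V * ?V) * mat_adjoint ?W"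
    using mat_adjoint_mult[OF W mat_adjoint_carrier[OF V(1)]]
    by (simp add: mat_assoc carrier_matD[OF W] carrier_matD[OF V(1)] carrier_matD[OF xj])
  also have "\<dots> = coord_rep j n x"
    by (simp add: V(2) coord_rep_def right_mult_one_mat[OF W] right_mult_one_mat[OF mult_carrier_mat[OF W xj]])
  finally show ?thesis .
qed

lemma coord_rep_carrier:
  "j < r n \<Longrightarrow> x \<in> Elt n \<Longrightarrow> coord_rep j n x \<in> carrier_mat (sz n j) (sz n j)"
  unfolding coord_rep_def
  by (intro mult_carrier_mat[of _ _ "sz n j"] frame_carrier mat_adjoint_carrier Elt_carrier shared_index)

lemma coord_rep_norm:
  "j < r n \<Longrightarrow> x \<in> Elt n \<Longrightarrow> operator_norm (coord_rep j n x) = operator_norm (x j)"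
  unfolding coord_rep_def
  by (rule operator_norm_unitary_conj[OF frame_unitary Elt_carrier[OF _ shared_index(1)]])

lemma coord_rep_hom:
  assumes j: "j < r n"
  shows "star_hom (direct_sum_algebra (u n)) (matrix_algebra (sz n j)) (coord_rep j n)"
proof -
  let ?W = "frame j n" and ?X = "direct_sum_algebra (u n)"
  note W = frame_carrier(1)[of j n] and WW = frame_carrier(2)[of j n]
  note Wa = mat_adjoint_carrier[OF W]
  have jm: "j < m n" by (rule shared_index(1)[OF j])
  have xc: "x j \<in> carrier_mat (sz n j) (sz n j)" if "x \<in> Elt n" for x by (rule Elt_carrier[OF that jm])
  show ?thesis
    unfolding star_hom_def
  proof (intro conjI ballI allI)
    fix x assume x: "x \<in> Elt n"
    show "coord_rep j n x \<in> elems (matrix_algebra (sz n j))"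
      using coord_rep_carrier[OF j x] by (simp add: matrix_algebra_def)
    show "coord_rep j n (star_op ?X x) = star_op (matrix_algebra (sz n j)) (coord_rep j n x)"
      using jm mat_adjoint_mult[OF mult_carrier_mat[OF W xc[OF x]] Wa] mat_adjoint_mult[OF W xc[OF x]]
      by (simp add: matrix_algebra_def direct_sum_algebra_def coord_rep_def mat_assoc
          carrier_matD[OF W] carrier_matD[OF xc[OF x]])
    fix c show "coord_rep j n (scale_op ?X c x) = scale_op (matrix_algebra (sz n j)) c (coord_rep j n x)"
      using jm mult_smult_distrib[OF W xc[OF x]] mult_smult_assoc_mat[OF mult_carrier_mat[OF W xc[OF x]] Wa]
      by (simp add: matrix_algebra_def direct_sum_algebra_def coord_rep_def)
  next
    fix x y assume x: "x \<in> Elt n" and y: "y \<in> Elt n"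
    show "coord_rep j n (add_op ?X x y) = add_op (matrix_algebra (sz n j)) (coord_rep j n x) (coord_rep j n y)"
      using jm mult_add_distrib_mat[OF W xc[OF x] xc[OF y]]
        add_mult_distrib_mat[OF mult_carrier_mat[OF W xc[OF x]] mult_carrier_mat[OF W xc[OF y]] Wa]
      by (simp add: matrix_algebra_def direct_sum_algebra_def coord_rep_def)
    have "?W * x j * mat_adjoint ?W * (?W * y j * mat_adjoint ?W)
        = ?W * x j * (mat_adjoint ?W * ?W) * y j * mat_adjoint ?W"
      by (simp add: mat_assoc carrier_matD[OF W] carrier_matD[OF xc[OF x]] carrier_matD[OF xc[OF y]])
    also have "\<dots> = ?W * (x j * y j) * mat_adjoint ?W"
      using mult_carrier_mat[OF W xc[OF x]] by (simp add: WW mat_assoc carrier_matD[OF W]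
          carrier_matD[OF xc[OF x]] carrier_matD[OF xc[OF y]])
    finally show "coord_rep j n (mult_op ?X x y) = mult_op (matrix_algebra (sz n j)) (coord_rep j n x) (coord_rep j n y)"
      using jm by (simp add: matrix_algebra_def direct_sum_algebra_def coord_rep_def)
  qed
qed

lemma conn_props:
  assumes x: "x \<in> Elt n"
  shows "connecting_map \<phi> n k x \<in> Elt (n + k)" "\<mu> (n + k) (connecting_map \<phi> n k x) = \<mu> n x"
    "j < r n \<Longrightarrow> coord_rep j (n + k) (connecting_map \<phi> n k x) = coord_rep j n x"
proof -
  have \<mu>\<phi>: "\<mu> (Suc n) (\<phi> n a) = \<mu> n a" if "a \<in> Elt n" for n a
    using lim that by (simp add: inductive_limit_def)
  show in_E: "connecting_map \<phi> n k x \<in> Elt (n + k)" for k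
    using x by (induction k) (simp_all add: \<phi>_in)
  show "\<mu> (n + k) (connecting_map \<phi> n k x) = \<mu> n x"
    by (induction k) (simp_all add: \<mu>\<phi> in_E)
  assume j: "j < r n"
  have jr: "j < r (n + k)" for k using j strict_monoD[OF rmono, of n "n + k"] by (cases k) auto
  show "coord_rep j (n + k) (connecting_map \<phi> n k x) = coord_rep j n x"
    by (induction k) (simp_all add: coord_rep_step[OF jr in_E] del: frame.simps)
qed

lemma norm_op_ge: "x \<in> Elt n \<Longrightarrow> i < m n \<Longrightarrow> operator_norm (x i) \<le> norm_op (direct_sum_algebra (u n)) x"
  by (auto simp: direct_sum_algebra_def intro!: Max_ge)

lemma conn_norm_tendsto:
  "x \<in> Elt n \<Longrightarrow> (\<lambda>k. norm_op (direct_sum_algebra (u (n + k))) (connecting_map \<phi> n k x)) \<longlonglongrightarrow> norm (\<mu> n x)"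
  using lim by (simp add: inductive_limit_def)

text \<open>The corrected coordinate is constant along the connecting maps and bounded by the norm
  at each stage, hence by the limit of these norms.\<close>

lemma coord_rep_le:
  assumes j: "j < r n" and x: "x \<in> Elt n"
  shows "operator_norm (coord_rep j n x) \<le> norm (\<mu> n x)"
proof (rule LIMSEQ_le_const[OF conn_norm_tendsto[OF x]], intro exI allI impI)
  fix k
  have jr: "j < r (n + k)" using j strict_monoD[OF rmono, of n "n + k"] by (cases k) auto
  note c = conn_props(1)[OF x, of k]
  have "operator_norm (coord_rep j n x) = operator_norm (connecting_map \<phi> n k x j)"
    using conn_props(3)[OF x j, of k] coord_rep_norm[OF jr c] by simp
  also have "\<dots> \<le> norm_op (direct_sum_algebra (u (n + k))) (connecting_map \<phi> n k x)"
    by (rule norm_op_ge[OF c shared_index(1)[OF jr]])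
  finally show "operator_norm (coord_rep j n x) \<le> norm_op (direct_sum_algebra (u (n + k))) (connecting_map \<phi> n k x)" .
qed

section \<open>Representations of the union of the images\<close>

definition image_algebra :: "'a set" where
  "image_algebra = (\<Union>n. \<mu> n ` Elt n)"

lemma push_to:
  assumes y: "y \<in> image_algebra"
  shows "\<exists>n. \<forall>M\<ge>n. \<exists>x\<in>Elt M. \<mu> M x = y"
proof -
  obtain n x where x: "x \<in> Elt n" "y = \<mu> n x" using y by (auto simp: image_algebra_def)
  have "\<exists>x'\<in>Elt M. \<mu> M x' = y" if "n \<le> M" for M
    using conn_props(1,2)[OF x(1), of "M - n"] that x(2) by auto
  then show ?thesis by blast
qed

lemma common_stage:
  assumes "y \<in> image_algebra" "z \<in> image_algebra"
  shows "\<exists>n x x'. j < r n \<and> x \<in> Elt n \<and> x' \<in> Elt n \<and> \<mu> n x = y \<and> \<mu> n x' = z"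
proof -
  obtain a b where a: "\<And>M. a \<le> M \<Longrightarrow> \<exists>x\<in>Elt M. \<mu> M x = y" and b: "\<And>M. b \<le> M \<Longrightarrow> \<exists>x\<in>Elt M. \<mu> M x = z"
    using push_to[OF assms(1)] push_to[OF assms(2)] by blast
  \<comment> \<open>A strictly increasing \<open>r\<close> satisfies \<open>n \<le> r n\<close>, so
    \<open>Suc j \<le> n\<close> ensures \<open>j < r n\<close>.\<close>
  define n where "n = max (Suc j) (max a b)"
  have "n \<le> r n" by (rule strict_mono_imp_increasing[OF rmono])
  then have "j < r n" by (simp add: n_def)
  moreover have "a \<le> n" "b \<le> n" by (simp_all add: n_def)
  moreover obtain x where "x \<in> Elt n" "\<mu> n x = y" using a[OF \<open>a \<le> n\<close>] by blast
  moreover obtain x' where "x' \<in> Elt n" "\<mu> n x' = z" using b[OF \<open>b \<le> n\<close>] by blast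
  ultimately show ?thesis by blast
qed

lemma \<mu>_ops:
  assumes "x \<in> Elt n" "y \<in> Elt n"
  shows "\<mu> n (add_op (direct_sum_algebra (u n)) x y) = \<mu> n x + \<mu> n y"
    "\<mu> n (mult_op (direct_sum_algebra (u n)) x y) = \<mu> n x * \<mu> n y"
    "\<mu> n (scale_op (direct_sum_algebra (u n)) c x) = c *\<^sub>C \<mu> n x"
    "\<mu> n (star_op (direct_sum_algebra (u n)) x) = star (\<mu> n x)"
  using \<mu>_hom[of n] assms by (auto simp: star_hom_def whole_algebra_def)

lemma coord_rep_ops:
  assumes "j < r n" "x \<in> Elt n" "y \<in> Elt n"
  shows "coord_rep j n (add_op (direct_sum_algebra (u n)) x y) = coord_rep j n x + coord_rep j n y"
    "coord_rep j n (mult_op (direct_sum_algebra (u n)) x y) = coord_rep j n x * coord_rep j n y"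
    "coord_rep j n (scale_op (direct_sum_algebra (u n)) c x) = c \<cdot>\<^sub>m coord_rep j n x"
    "coord_rep j n (star_op (direct_sum_algebra (u n)) x) = mat_adjoint (coord_rep j n x)"
  using coord_rep_hom[OF assms(1)] assms(2,3) by (auto simp: star_hom_def matrix_algebra_def)

text \<open>The maps to the limit need not be assumed injective: a difference with zero image has
  limit norm 0, and the bound above makes its coordinate vanish.\<close>

lemma coord_rep_unique_stage:
  assumes j: "j < r n" and x: "x \<in> Elt n" and y: "y \<in> Elt n" and eq: "\<mu> n x = \<mu> n y"
  shows "coord_rep j n x = coord_rep j n y"
proof -
  let ?X = "direct_sum_algebra (u n)"
  let ?s = "scale_op ?X (-1) y"
  let ?z = "add_op ?X x ?s"
  have s: "?s \<in> Elt n" by (rule Elt_closed(3)[OF y y])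
  have z: "?z \<in> Elt n" by (rule Elt_closed(1)[OF x s])
  have "\<mu> n ?z = \<mu> n x + (-1) *\<^sub>C \<mu> n y" by (simp only: \<mu>_ops(1)[OF x s] \<mu>_ops(3)[OF y y])
  then have "norm (\<mu> n ?z) = 0" using eq by simp
  then have "operator_norm (coord_rep j n ?z) \<le> 0" using coord_rep_le[OF j z] by simp
  note xc = coord_rep_carrier[OF j x] and yc = coord_rep_carrier[OF j y] and zc = coord_rep_carrier[OF j z]
  have zeq: "coord_rep j n ?z = coord_rep j n x + (-1) \<cdot>\<^sub>m coord_rep j n y"
    by (simp only: coord_rep_ops(1)[OF j x s] coord_rep_ops(3)[OF j y y])
  show ?thesis
  proof (rule eq_matI)
    fix a b assume "a < dim_row (coord_rep j n y)" "b < dim_col (coord_rep j n y)"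
    then have ab: "a < sz n j" "b < sz n j" using yc by auto
    have "cmod (coord_rep j n ?z $$ (a, b)) \<le> 0"
      using entry_le_operator_norm[OF zc ab] \<open>operator_norm (coord_rep j n ?z) \<le> 0\<close> by linarith
    then have "coord_rep j n ?z $$ (a, b) = 0" by simp
    then show "coord_rep j n x $$ (a, b) = coord_rep j n y $$ (a, b)"
      unfolding zeq using xc yc ab by simp
  qed (use xc yc in auto)
qed

lemma coord_rep_unique:
  assumes j: "j < r n" "j < r n'" and x: "x \<in> Elt n" and y: "y \<in> Elt n'" and eq: "\<mu> n x = \<mu> n' y"
  shows "coord_rep j n x = coord_rep j n' y"
proof -
  have jr: "j < r (n + n')" using j(1) strict_monoD[OF rmono, of n "n + n'"] by (cases n') auto
  have "connecting_map \<phi> n' n y \<in> Elt (n + n')" "\<mu> (n + n') (connecting_map \<phi> n' n y) = \<mu> n' y"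
    "coord_rep j (n + n') (connecting_map \<phi> n' n y) = coord_rep j n' y"
    using conn_props(1,2)[OF y, of n] conn_props(3)[OF y j(2), of n] by (simp_all add: add.commute)
  moreover have "coord_rep j (n + n') (connecting_map \<phi> n n' x) = coord_rep j n x"
    by (rule conn_props(3)[OF x j(1)])
  ultimately show ?thesis
    using coord_rep_unique_stage[OF jr conn_props(1)[OF x, of n']] conn_props(2)[OF x, of n'] eq by metis
qed

text \<open>The size of summand \<open>j\<close> is constant from the first stage at which
  \<open>j < r n\<close>; earlier stages may have another size at that index or no such
  summand.\<close>

definition shared_size_of :: "nat \<Rightarrow> nat" where
  "shared_size_of j = sz (LEAST n. j < r n) j"

lemma shared_size_of:
  assumes j: "j < r n" shows "sz n j = shared_size_of j"
proof -
  define n0 where "n0 = (LEAST n. j < r n)"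
  have n0: "j < r n0" unfolding n0_def using j by (rule LeastI)
  have le: "n0 \<le> n" unfolding n0_def using j by (rule Least_le)
  have "sz (n0 + k) j = sz n0 j" for k
  proof (induction k)
    case (Suc k)
    have "j < r (n0 + k)" using n0 strict_monoD[OF rmono, of n0 "n0 + k"] by (cases k) auto
    then show ?case using Suc shared_size[of j "n0 + k"] by simp
  qed simp
  from this[of "n - n0"] show ?thesis using le by (simp add: shared_size_of_def n0_def)
qed

lemma image_subalgebra: "star_subalgebra image_algebra"
proof -
  have mem: "\<mu> n x \<in> image_algebra" if "x \<in> Elt n" for n x using that by (auto simp: image_algebra_def)
  have op2: "y + z \<in> image_algebra" "y * z \<in> image_algebra" "c *\<^sub>C y \<in> image_algebra" "star y \<in> image_algebra"
    if yz: "y \<in> image_algebra" "z \<in> image_algebra" for y z c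
  proof -
    obtain n x x' where x: "x \<in> Elt n" "x' \<in> Elt n" "\<mu> n x = y" "\<mu> n x' = z"
      using common_stage[OF yz, of 0] by blast
    note ops = \<mu>_ops[OF x(1,2)] and cl = Elt_closed[OF x(1,2)]
    show "y + z \<in> image_algebra" using mem[OF cl(1)] ops(1) x(3,4) by simp
    show "y * z \<in> image_algebra" using mem[OF cl(2)] ops(2) x(3,4) by simp
    show "c *\<^sub>C y \<in> image_algebra" using mem[OF cl(3)] ops(3) x(3,4) by simp
    show "star y \<in> image_algebra" using mem[OF cl(4)] ops(4) x(3,4) by simp
  qed
  have "image_algebra \<noteq> {}"
  proof -
    have "(\<lambda>i\<in>{..<m 0}. 1\<^sub>m (sz 0 i)) \<in> Elt 0" by (auto simp: Elt_iff)
    then show ?thesis using mem by blast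
  qed
  then obtain y where "y \<in> image_algebra" by blast
  then have "0 \<in> image_algebra" using op2(3)[of y y 0] by simp
  then show ?thesis using op2 by (auto simp: star_subalgebra_def complex_vector.subspace_def)
qed

text \<open>On the dense union a value is read off at any stage where \<open>j\<close> is shared;
  \<open>coord_rep_unique\<close> makes it independent of the stage and of the preimage.
  Contractivity extends it to the whole algebra.\<close>

lemma shared_rep_exists:
  "\<exists>\<pi>. rep_on UNIV (shared_size_of j) \<pi> \<and> (\<forall>y. operator_norm (\<pi> y) \<le> norm y) \<and>
    (\<forall>n x. j < r n \<longrightarrow> x \<in> Elt n \<longrightarrow> \<pi> (\<mu> n x) = coord_rep j n x)"
proof -
  define g where "g y = (SOME M. \<exists>n x. j < r n \<and> x \<in> Elt n \<and> \<mu> n x = y \<and> M = coord_rep j n x)" for y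
  have g: "g (\<mu> n x) = coord_rep j n x" if jx: "j < r n" "x \<in> Elt n" for n x
  proof -
    have "\<exists>M n' x'. j < r n' \<and> x' \<in> Elt n' \<and> \<mu> n' x' = \<mu> n x \<and> M = coord_rep j n' x'" using jx by blast
    from someI_ex[OF this] obtain n' x' where "j < r n'" "x' \<in> Elt n'" "\<mu> n' x' = \<mu> n x" "g (\<mu> n x) = coord_rep j n' x'"
      unfolding g_def by blast
    then show ?thesis using coord_rep_unique[of j n' n x' x] jx by simp
  qed
  have rep: "rep_on image_algebra (shared_size_of j) g"
    unfolding rep_on_iff
  proof (intro conjI ballI allI)
    fix y z assume yz: "y \<in> image_algebra" "z \<in> image_algebra"
    obtain n x x' where x: "j < r n" "x \<in> Elt n" "x' \<in> Elt n" "\<mu> n x = y" "\<mu> n x' = z"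
      using common_stage[OF yz, of j] by blast
    note ops = \<mu>_ops[OF x(2,3)] and cl = Elt_closed[OF x(2,3)] and cops = coord_rep_ops[OF x(1,2,3)]
    show "g (y + z) = g y + g z" using g[OF x(1) cl(1)] g[OF x(1,2)] g[OF x(1,3)] ops cops x(4,5) by simp
    show "g (y * z) = g y * g z" using g[OF x(1) cl(2)] g[OF x(1,2)] g[OF x(1,3)] ops cops x(4,5) by simp
  next
    fix y assume y: "y \<in> image_algebra"
    obtain n x where x: "j < r n" "x \<in> Elt n" "\<mu> n x = y"
      using common_stage[OF y y, of j] by blast
    note ops = \<mu>_ops[OF x(2,2)] and cl = Elt_closed[OF x(2,2)] and cops = coord_rep_ops[OF x(1,2,2)]
    show "g y \<in> carrier_mat (shared_size_of j) (shared_size_of j)"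
      using g[OF x(1,2)] coord_rep_carrier[OF x(1,2)] x(3) by (simp add: shared_size_of[OF x(1)])
    show "g (star y) = mat_adjoint (g y)" using g[OF x(1) cl(4)] g[OF x(1,2)] ops cops x(3) by simp
    fix c show "g (c *\<^sub>C y) = c \<cdot>\<^sub>m g y" using g[OF x(1) cl(3)] g[OF x(1,2)] ops cops x(3) by simp
  qed
  have contr: "operator_norm (g y) \<le> norm y" if y: "y \<in> image_algebra" for y
  proof -
    obtain n x where x: "j < r n" "x \<in> Elt n" "\<mu> n x = y"
      using common_stage[OF y y, of j] by blast
    then show ?thesis using g[OF x(1,2)] coord_rep_le[OF x(1,2)] by simp
  qed
  have "closure image_algebra = UNIV" using lim by (simp add: inductive_limit_def image_algebra_def)
  from extend_contractive_rep[OF image_subalgebra this rep contr]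
  obtain \<pi> where \<pi>: "rep_on UNIV (shared_size_of j) \<pi>" "\<And>y. y \<in> image_algebra \<Longrightarrow> \<pi> y = g y"
    "\<And>y. operator_norm (\<pi> y) \<le> norm y" by blast
  have "\<pi> (\<mu> n x) = coord_rep j n x" if "j < r n" "x \<in> Elt n" for n x
    using \<pi>(2)[of "\<mu> n x"] g[OF that] that(2) by (auto simp: image_algebra_def)
  then show ?thesis using \<pi> by blast
qed

text \<open>The norm is attained at some summand \<open>k\<close>. If \<open>k\<close> is not
  shared, its column has a nonzero entry at an index shared from the next stage on, and moving one
  stage forward does not lower the norm.\<close>

lemma norm_op_le_shared:
  assumes x: "x \<in> Elt n"
  shows "\<exists>n' j x'. j < r n' \<and> x' \<in> Elt n' \<and> \<mu> n' x' = \<mu> n x \<and>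
    norm_op (direct_sum_algebra (u n)) x \<le> operator_norm (coord_rep j n' x')"
proof -
  have "0 < m n" using r1[of n] rm[of n] by simp
  then have "norm_op (direct_sum_algebra (u n)) x \<in> (\<lambda>i. operator_norm (x i)) ` {..<m n}"
    by (auto simp: direct_sum_algebra_def lessThan_empty_iff intro!: Max_in)
  then obtain k where k: "k < m n" "norm_op (direct_sum_algebra (u n)) x = operator_norm (x k)" by auto
  show ?thesis
  proof (cases "k < r n")
    case True
    then show ?thesis using x k(2) coord_rep_norm[OF True x] by (intro exI[of _ n] exI[of _ k] exI[of _ x]) simp
  next
    case False
    then obtain l where l: "r n \<le> l" "l < r (Suc n)" "A n $$ (l, k) \<noteq> 0" using nz[of n k] k(1) by auto
    have "operator_norm (x k) \<le> operator_norm (\<phi> n x l)"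
      by (rule \<phi>_norm_ge[OF x k(1) shared_index(1)[OF l(2)] l(3)])
    moreover have "\<mu> (Suc n) (\<phi> n x) = \<mu> n x" using conn_props(2)[OF x, of 1] by simp
    ultimately show ?thesis
      using l(2) k(2) \<phi>_in[OF x] coord_rep_norm[OF l(2) \<phi>_in[OF x]]
      by (intro exI[of _ "Suc n"] exI[of _ l] exI[of _ "\<phi> n x"]) simp
  qed
qed

text \<open>If all representations kill \<open>y\<close>, they are small on an approximation
  \<open>z\<close> from the union of the images. They compute the norm of \<open>z\<close>, so
  \<open>z\<close> and therefore \<open>y\<close> are small.\<close>

lemma limit_residually_finite_dimensional: "residually_finite_dimensional TYPE('a)"
proof -
  obtain \<pi> where \<pi>: "\<And>j. rep_on UNIV (shared_size_of j) (\<pi> j)" "\<And>j y. operator_norm (\<pi> j y) \<le> norm y"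
    "\<And>j n x. j < r n \<Longrightarrow> x \<in> Elt n \<Longrightarrow> \<pi> j (\<mu> n x) = coord_rep j n x"
    using shared_rep_exists by metis
  have faith: "y = 0" if zero: "\<And>j. \<pi> j y = 0\<^sub>m (shared_size_of j) (shared_size_of j)" for y
  proof -
    have "norm y \<le> e" if e: "0 < e" for e
    proof -
      have "closure image_algebra = UNIV" using lim by (simp add: inductive_limit_def image_algebra_def)
      then obtain z where z: "z \<in> image_algebra" "dist z y < e / 2"
        using closure_approachable[of y image_algebra] e by (metis UNIV_I half_gt_zero)
      obtain n x where x: "x \<in> Elt n" "z = \<mu> n x" using z(1) by (auto simp: image_algebra_def)
      have small: "operator_norm (\<pi> j z) \<le> e / 2" for j
      proof -
        have c: "\<pi> j z \<in> carrier_mat (shared_size_of j) (shared_size_of j)" using rep_carrier[OF \<pi>(1)] by simp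
        have "\<pi> j (z - y) = \<pi> j z - \<pi> j y" by (rule rep_diff[OF \<pi>(1) star_subalgebra_UNIV]) simp_all
        also have "\<dots> = \<pi> j z" unfolding zero using c by (intro eq_matI) auto
        finally have "operator_norm (\<pi> j z) \<le> norm (z - y)" using \<pi>(2)[of j "z - y"] by simp
        then show ?thesis using z(2) by (simp add: dist_norm)
      qed
      \<comment> \<open>At every stage the norm is dominated by the value of a single representation
        at \<open>z\<close>; the index \<open>j\<close> may vary with \<open>k\<close>.\<close>
      have "norm_op (direct_sum_algebra (u (n + k))) (connecting_map \<phi> n k x) \<le> e / 2" for k
      proof -
        obtain n' j x' where n': "j < r n'" "x' \<in> Elt n'" "\<mu> n' x' = \<mu> (n + k) (connecting_map \<phi> n k x)"
          "norm_op (direct_sum_algebra (u (n + k))) (connecting_map \<phi> n k x) \<le> operator_norm (coord_rep j n' x')"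
          using norm_op_le_shared[OF conn_props(1)[OF x(1), of k]] by blast
        have "coord_rep j n' x' = \<pi> j z" using \<pi>(3)[OF n'(1,2)] n'(3) conn_props(2)[OF x(1), of k] x(2) by simp
        then show ?thesis using n'(4) small[of j] by simp
      qed
      then have "norm z \<le> e / 2"
        unfolding x(2) by (intro LIMSEQ_le_const2[OF conn_norm_tendsto[OF x(1)]]) auto
      then show ?thesis using z(2) norm_triangle_ineq2[of y z] by (simp add: dist_norm norm_minus_commute)
    qed
    then have "norm y \<le> 0" by (rule field_le_epsilon[of _ 0, simplified])
    then show ?thesis by simp
  qed
  show ?thesis
    unfolding residually_finite_dimensional_def
  proof (intro exI[of _ "range (\<lambda>j. (shared_size_of j, \<pi> j))"] conjI allI impI)
    show "\<forall>(k, \<sigma>)\<in>range (\<lambda>j. (shared_size_of j, \<pi> j)). star_hom whole_algebra (matrix_algebra k) \<sigma>"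
      using \<pi>(1) by (auto simp: rep_on_def subalgebra_on_UNIV)
    fix x y :: 'a assume "x \<noteq> y"
    then obtain j where j: "\<pi> j (x - y) \<noteq> 0\<^sub>m (shared_size_of j) (shared_size_of j)" using faith[of "x - y"] by auto
    have "\<pi> j x \<noteq> \<pi> j y"
    proof
      assume "\<pi> j x = \<pi> j y"
      then have "\<pi> j (x - y) = 0\<^sub>m (shared_size_of j) (shared_size_of j)"
        using rep_diff[OF \<pi>(1) star_subalgebra_UNIV, of x y j] rep_carrier[OF \<pi>(1), of y j] by auto
      then show False using j by simp
    qed
    then show "\<exists>(k, \<sigma>)\<in>range (\<lambda>j. (shared_size_of j, \<pi> j)). \<sigma> x \<noteq> \<sigma> y" by auto
  qed
qed

end

theorem property_RFD_residually_finite_dimensional: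
  assumes sim: "simplicial_sequence m u A" and prop_RFD: "property_RFD m u A"
    and assoc: "associated_AF_algebra TYPE('a::cstar_algebra) u A"
  shows "residually_finite_dimensional TYPE('a)"
proof -
  obtain r where r: "strict_mono r" and rn: "\<And>n. 1 \<le> r n" "\<And>n. r n \<le> m n"
    and ueq: "\<And>n j. j < r n \<Longrightarrow> u (Suc n) $ j = u n $ j"
    and blocks: "\<And>n. \<exists>A21 A22 A31 A32.
        A21 \<in> carrier_mat (r (Suc n) - r n) (r n) \<and>
        A22 \<in> carrier_mat (r (Suc n) - r n) (m n - r n) \<and>
        A31 \<in> carrier_mat (m (Suc n) - r (Suc n)) (r n) \<and>
        A32 \<in> carrier_mat (m (Suc n) - r (Suc n)) (m n - r n) \<and>
        A n = four_block_mat (1\<^sub>m (r n)) (0\<^sub>m (r n) (m n - r n)) (A21 @\<^sub>r A31) (A22 @\<^sub>r A32) \<and>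
        (\<forall>j<m n - r n. col A22 j \<noteq> 0\<^sub>v (r (Suc n) - r n))"
    using prop_RFD unfolding property_RFD_def by blast
  have rle: "r n \<le> r (Suc n)" for n using r by (simp add: strict_mono_Suc_iff less_imp_le)
  have diag: "A n $$ (j, j) = 1" if j: "j < r n" for n j
  proof -
    from blocks[of n] obtain A21 A22 A31 A32 where b:
        "A21 \<in> carrier_mat (r (Suc n) - r n) (r n)" "A22 \<in> carrier_mat (r (Suc n) - r n) (m n - r n)"
        "A31 \<in> carrier_mat (m (Suc n) - r (Suc n)) (r n)" "A32 \<in> carrier_mat (m (Suc n) - r (Suc n)) (m n - r n)"
        "A n = four_block_mat (1\<^sub>m (r n)) (0\<^sub>m (r n) (m n - r n)) (A21 @\<^sub>r A31) (A22 @\<^sub>r A32)"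
        "\<forall>j<m n - r n. col A22 j \<noteq> 0\<^sub>v (r (Suc n) - r n)"
      by (elim exE conjE)
    show ?thesis by (rule entries_of_blocks(1)[OF rle rn(2) rn(2) b(1-5) _ j]) (use b(6) in blast)
  qed
  have nz: "\<exists>l. r n \<le> l \<and> l < r (Suc n) \<and> A n $$ (l, k) \<noteq> 0" if k: "r n \<le> k" "k < m n" for n k
  proof -
    from blocks[of n] obtain A21 A22 A31 A32 where b:
        "A21 \<in> carrier_mat (r (Suc n) - r n) (r n)" "A22 \<in> carrier_mat (r (Suc n) - r n) (m n - r n)"
        "A31 \<in> carrier_mat (m (Suc n) - r (Suc n)) (r n)" "A32 \<in> carrier_mat (m (Suc n) - r (Suc n)) (m n - r n)"
        "A n = four_block_mat (1\<^sub>m (r n)) (0\<^sub>m (r n) (m n - r n)) (A21 @\<^sub>r A31) (A22 @\<^sub>r A32)"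
        "\<forall>j<m n - r n. col A22 j \<noteq> 0\<^sub>v (r (Suc n) - r n)"
      by (elim exE conjE)
    show ?thesis by (rule entries_of_blocks(2)[OF rle rn(2) rn(2) b(1-5) _ k]) (use b(6) in blast)
  qed
  obtain \<phi> and \<mu> :: "nat \<Rightarrow> (nat \<Rightarrow> complex mat) \<Rightarrow> 'a" where
    hm: "\<And>n. has_multiplicity_matrix (u n) (u (Suc n)) (\<phi> n) (A n)"
    and lim: "inductive_limit (\<lambda>n. direct_sum_algebra (u n)) \<phi> \<mu>"
    using assoc unfolding associated_AF_algebra_def by blast
  show ?thesis
    by (rule limit_residually_finite_dimensional[OF sim r rn diag nz ueq hm lim])
qed

theorem theorem5p4:
  shows
    "(\<forall>m u A. simplicial_sequence m u A \<and> property_RFD m u A \<and>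
        associated_AF_algebra TYPE('a::cstar_algebra) u A \<longrightarrow>
        residually_finite_dimensional TYPE('a)) \<and>
     (AF_algebra TYPE('a) \<and> separable_space (euclidean :: 'a topology) \<and>
        \<not> finite_dim (UNIV :: 'a set) \<and> residually_finite_dimensional TYPE('a) \<longrightarrow>
        (\<exists>m u A. simplicial_sequence m u A \<and> property_RFD m u A \<and>
           associated_AF_algebra TYPE('a) u A \<and>
           ((\<exists>p :: 'a. full_projection p) \<longrightarrow> nonzero_rows m A)))"
  using property_RFD_residually_finite_dimensional rfd_AF_realization by blast

end
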